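(* Let $n$ be an integer and $p,l$ real numbers with $1<p<2\le n$ and $l>0$. Assume that $$l\le p\ \text{ if } p<\frac{2n}{n+1},\qquad\text{and}\qquad l<\frac{(n-p)(2-p)}{p-1}\ \text{ if } p\ge\frac{2n}{n+1}.$$ Then for every $\theta>0$ the origin $(0,0)$ is irregular (for the $p$-parabolic equation) with respect to $$\Theta_{l,\theta}=\{(x,t)\in\mathbf{R}^{n}\times\mathbf{R}: 0<-t<\theta|x|^l<\theta\}.$$
   Context: Let $n\ge1$ be an integer, $1<p<\infty$, and let $\Theta\subset\mathbf{R}^{n+1}$ be a nonempty bounded open set, with points written $(x,t)$, $x\in\mathbf{R}^n$, $t\in\mathbf{R}$. $\nabla$ and $\operatorname{div}$ are taken with respect to $x$ only, and $\partial\Theta$ is the full topological boundary. The $p$-parabolic equation is $\partial_t u-\Delta_p u=0$, where $\Delta_p u=\operatorname{div}(|\nabla u|^{p-2}\nabla u)$ (the heat equation if $p=2$). Solutions: $u:\Theta\to[-\infty,\infty]$ is a (weak) solution if for every open cylinder $U_{t_1,t_2}=U\times(t_1,t_2)\Subset\Theta$ we have $u\in C([t_1,t_2];L^2(U))\cap L^p(t_1,t_2;W^{1,p}(U))$ and $$\int_{t_1}^{t_2}\int_U|\nabla u|^{p-2}\nabla u\cdot\nabla\varphi\,dx\,dt-\int_{t_1}^{t_2}\int_U u\,\frac{\partial\varphi}{\partial t}\,dx\,dt=0\quad\text{for all }\varphi\in C_0^\infty(U_{t_1,t_2}).$$ A $p$-parabolic function is a continuous solution. Superparabolic functions: $u:\Theta\to(-\infty,\infty]$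 is $p$-superparabolic if (i) $u$ is lower semicontinuous; (ii) $u$ is finite in a dense subset of $\Theta$; (iii) for every space-time box $Q_{t_1,t_2}=Q\times(t_1,t_2)\Subset\Theta$, $Q=(a_1,b_1)\times\dots\times(a_n,b_n)$, and every $h$ that is $p$-parabolic in $Q_{t_1,t_2}$, continuous on $\overline{Q_{t_1,t_2}}$ and satisfies $h\le u$ on the parabolic boundary $(\overline{Q}\times\{t_1\})\cup(\partial Q\times(t_1,t_2])$, we have $h\le u$ in $Q_{t_1,t_2}$. Perron solution: for bounded $f:\partial\Theta\to\mathbf{R}$, let $\mathcal{U}_f$ be the set of $p$-superparabolic $u$ on $\Theta$ with $\liminf_{\Theta\ni\eta\to\xi}u(\eta)\ge f(\xi)$ for all $\xi\in\partial\Theta$, and $\overline{H}_\Theta f(\xi)=\inf_{u\in\mathcal{U}_f}u(\xi)$ for $\xi\in\Theta$. Regularity: $\xi_0\in\partial\Theta$ is regular with respect to $\Theta$ if $\lim_{\Theta\ni\xi\to\xi_0}\overline{H}_\Theta f(\xi)=f(\xi_0)$ for all $f\in C(\partial\Theta)$; otherwise it is irregular. *)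

theory Defs
  imports "HOL-Analysis.Analysis"
begin

section \<open>Function spaces\<close>

text \<open>The spaces \<open>L\<^sup>q(S)\<close> (real exponent \<open>q > 0\<close>), without passing to equivalence classes.\<close>

definition Lq :: "real \<Rightarrow> 'a::euclidean_space set \<Rightarrow> ('a \<Rightarrow> 'b::euclidean_space) set" where
  "Lq q S = {v \<in> borel_measurable (lebesgue_on S). integrable (lebesgue_on S) (\<lambda>x. norm (v x) powr q)}"

primrec Ck :: "nat \<Rightarrow> ('a::euclidean_space \<Rightarrow> real) \<Rightarrow> bool" where
  "Ck 0 f \<longleftrightarrow> continuous_on UNIV f"
| "Ck (Suc k) f \<longleftrightarrow> (\<forall>x. f differentiable (at x)) \<and> (\<forall>v. Ck k (\<lambda>x. frechet_derivative f (at x) v))"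

text \<open>\<open>C\<^sub>0\<^sup>\<infinity>(S)\<close> for open \<open>S\<close>; its members are extended by zero to the whole space.\<close>

definition test_functions :: "'a::euclidean_space set \<Rightarrow> ('a \<Rightarrow> real) set" where
  "test_functions S = {\<phi>. (\<forall>k. Ck k \<phi>) \<and> compact (closure {x. \<phi> x \<noteq> 0}) \<and> closure {x. \<phi> x \<noteq> 0} \<subseteq> S}"

definition grad :: "(real^'n \<Rightarrow> real) \<Rightarrow> real^'n \<Rightarrow> real^'n" where
  "grad f x = (\<chi> i. frechet_derivative f (at x) (axis i 1))"

text \<open>\<open>v \<in> W\<^sup>1\<^sup>,\<^sup>p(U)\<close>, with distributional gradient \<open>g\<close>.\<close>

definition W1p_with_grad :: "real \<Rightarrow> (real^'n) set \<Rightarrow> (real^'n \<Rightarrow> real) \<Rightarrow> (real^'n \<Rightarrow> real^'n) \<Rightarrow> bool" where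
  "W1p_with_grad p U v g \<longleftrightarrow> v \<in> Lq p U \<and> g \<in> Lq p U \<and>
     (\<forall>\<phi>\<in>test_functions U.
        (LINT x|lebesgue_on U. v x *\<^sub>R grad \<phi> x) = - (LINT x|lebesgue_on U. \<phi> x *\<^sub>R g x))"

text \<open>\<open>u \<in> L\<^sup>p(t\<^sub>1,t\<^sub>2;W\<^sup>1\<^sup>,\<^sup>p(U))\<close>, with spatial gradient \<open>G\<close>: almost every time slice lies in
  \<open>W\<^sup>1\<^sup>,\<^sup>p(U)\<close>, and \<open>u\<close> and \<open>G\<close> are jointly measurable and \<open>p\<close>-integrable on the cylinder.\<close>

definition parabolic_W1p_with_grad ::
  "real \<Rightarrow> (real^'n) set \<Rightarrow> real \<Rightarrow> real \<Rightarrow> ((real^'n) \<times> real \<Rightarrow> real) \<Rightarrow> ((real^'n) \<times> real \<Rightarrow> real^'n) \<Rightarrow> bool" where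
  "parabolic_W1p_with_grad p U t1 t2 u G \<longleftrightarrow>
     u \<in> Lq p (U \<times> {t1<..<t2}) \<and> G \<in> Lq p (U \<times> {t1<..<t2}) \<and>
     (AE t in lebesgue_on {t1<..<t2}. W1p_with_grad p U (\<lambda>x. u (x, t)) (\<lambda>x. G (x, t)))"

text \<open>\<open>u \<in> C([t\<^sub>1,t\<^sub>2];L\<^sup>2(U))\<close>.\<close>

definition C_L2 :: "(real^'n) set \<Rightarrow> real \<Rightarrow> real \<Rightarrow> ((real^'n) \<times> real \<Rightarrow> real) \<Rightarrow> bool" where
  "C_L2 U t1 t2 u \<longleftrightarrow>
     (\<forall>t\<in>{t1..t2}. (\<lambda>x. u (x, t)) \<in> Lq 2 U) \<and>
     (\<forall>s\<in>{t1..t2}. ((\<lambda>t. LINT x|lebesgue_on U. (u (x, t) - u (x, s))\<^sup>2) \<longlongrightarrow> 0) (at s within {t1..t2}))"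


section \<open>The \<open>p\<close>-parabolic equation\<close>

definition compactly_inside :: "'a::topological_space set \<Rightarrow> 'a set \<Rightarrow> bool" where
  "compactly_inside A D \<longleftrightarrow> compact (closure A) \<and> closure A \<subseteq> D"

text \<open>Solutions may take infinite values, but only on null sets of each relevant time slice, so the
  integrals are taken of the real-valued function \<open>real_of_ereal \<circ> u\<close>. The spatial gradient \<open>G\<close> is
  unique up to null sets, so that it is immaterial which one is chosen.\<close>

definition weak_solution :: "real \<Rightarrow> ((real^'n) \<times> real) set \<Rightarrow> ((real^'n) \<times> real \<Rightarrow> ereal) \<Rightarrow> bool" where
  "weak_solution p D u \<longleftrightarrow>
     (\<forall>U t1 t2. open U \<and> t1 < t2 \<and> compactly_inside (U \<times> {t1<..<t2}) D \<longrightarrow>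
        (\<forall>t\<in>{t1..t2}. AE x in lebesgue_on U. \<bar>u (x, t)\<bar> \<noteq> \<infinity>) \<and>
        C_L2 U t1 t2 (\<lambda>z. real_of_ereal (u z)) \<and>
        (\<exists>G. parabolic_W1p_with_grad p U t1 t2 (\<lambda>z. real_of_ereal (u z)) G \<and>
          (\<forall>\<phi>\<in>test_functions (U \<times> {t1<..<t2}).
             (LINT t|lebesgue_on {t1<..<t2}. LINT x|lebesgue_on U.
                (norm (G (x, t)) powr (p - 2) *\<^sub>R G (x, t)) \<bullet> grad (\<lambda>y. \<phi> (y, t)) x)
           - (LINT t|lebesgue_on {t1<..<t2}. LINT x|lebesgue_on U.
                real_of_ereal (u (x, t)) * deriv (\<lambda>s. \<phi> (x, s)) t) = 0)))"

text \<open>Continuous functions are real-valued.\<close>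

definition p_parabolic :: "real \<Rightarrow> ((real^'n) \<times> real) set \<Rightarrow> ((real^'n) \<times> real \<Rightarrow> real) \<Rightarrow> bool" where
  "p_parabolic p D h \<longleftrightarrow> continuous_on D h \<and> weak_solution p D (\<lambda>z. ereal (h z))"

definition lower_semicontinuous_on :: "'a::topological_space set \<Rightarrow> ('a \<Rightarrow> ereal) \<Rightarrow> bool" where
  "lower_semicontinuous_on D u \<longleftrightarrow> (\<forall>z\<in>D. u z \<le> Liminf (at z within D) u)"

definition parabolic_boundary :: "(real^'n) set \<Rightarrow> real \<Rightarrow> real \<Rightarrow> ((real^'n) \<times> real) set" where
  "parabolic_boundary Q t1 t2 = closure Q \<times> {t1} \<union> frontier Q \<times> {t1<..t2}"

definition p_superparabolic :: "real \<Rightarrow> ((real^'n) \<times> real) set \<Rightarrow> ((real^'n) \<times> real \<Rightarrow> ereal) \<Rightarrow> bool" where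
  "p_superparabolic p D u \<longleftrightarrow>
     (\<forall>z\<in>D. u z \<noteq> -\<infinity>) \<and>
     lower_semicontinuous_on D u \<and>
     D \<subseteq> closure {z \<in> D. \<bar>u z\<bar> \<noteq> \<infinity>} \<and>
     (\<forall>a b t1 t2 h. let Q = box a b in
        (\<forall>i. a $ i < b $ i) \<and> t1 < t2 \<and> compactly_inside (Q \<times> {t1<..<t2}) D \<and>
        p_parabolic p (Q \<times> {t1<..<t2}) h \<and> continuous_on (closure (Q \<times> {t1<..<t2})) h \<and>
        (\<forall>z\<in>parabolic_boundary Q t1 t2. ereal (h z) \<le> u z) \<longrightarrow>
        (\<forall>z\<in>Q \<times> {t1<..<t2}. ereal (h z) \<le> u z))"


section \<open>Perron solutions and boundary regularity\<close>

definition upper_class ::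
  "real \<Rightarrow> ((real^'n) \<times> real) set \<Rightarrow> ((real^'n) \<times> real \<Rightarrow> real) \<Rightarrow> ((real^'n) \<times> real \<Rightarrow> ereal) set" where
  "upper_class p D f =
     {u. p_superparabolic p D u \<and> (\<forall>\<xi>\<in>frontier D. Liminf (at \<xi> within D) u \<ge> ereal (f \<xi>))}"

definition upper_Perron ::
  "real \<Rightarrow> ((real^'n) \<times> real) set \<Rightarrow> ((real^'n) \<times> real \<Rightarrow> real) \<Rightarrow> (real^'n) \<times> real \<Rightarrow> ereal" where
  "upper_Perron p D f \<xi> = (INF u\<in>upper_class p D f. u \<xi>)"

definition regular_point :: "real \<Rightarrow> ((real^'n) \<times> real) set \<Rightarrow> (real^'n) \<times> real \<Rightarrow> bool" where
  "regular_point p D \<xi>0 \<longleftrightarrow> \<xi>0 \<in> frontier D \<and>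
     (\<forall>f. continuous_on (frontier D) f \<longrightarrow> (upper_Perron p D f \<longlongrightarrow> ereal (f \<xi>0)) (at \<xi>0 within D))"

definition irregular_point :: "real \<Rightarrow> ((real^'n) \<times> real) set \<Rightarrow> (real^'n) \<times> real \<Rightarrow> bool" where
  "irregular_point p D \<xi>0 \<longleftrightarrow> \<xi>0 \<in> frontier D \<and> \<not> regular_point p D \<xi>0"

definition power_domain :: "real \<Rightarrow> real \<Rightarrow> ((real^'n) \<times> real) set" where
  "power_domain l \<theta> = {(x, t). 0 < - t \<and> - t < \<theta> * norm x powr l \<and> \<theta> * norm x powr l < \<theta>}"

end

theory Submission
  imports Defs "HOL-Real_Asymp.Real_Asymp"
begin

text \<open>
  Idea. With \<open>a = 1 / (2 - p)\<close> and \<open>b = l a\<close>, the function \<open>u = c (-t)\<^sup>a |x|\<^sup>-\<^sup>b\<close> is a classical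
  supersolution in \<open>0 < |x| < 1\<close>, \<open>t < 0\<close> once \<open>c\<close> is small: this needs \<open>b (2 - p) \<le> p\<close> and
  \<open>b (p - 1) < n - p\<close>, which is what the two conditions on \<open>l\<close> amount to. It is constant on every
  surface \<open>-t = s |x|\<^sup>l\<close>, with a value that decreases to \<open>0\<close> as \<open>s\<close> decreases to \<open>0\<close>. Let \<open>m\<close> be its value on the bottom
  \<open>-t = \<theta> |x|\<^sup>l\<close> and put \<open>f = m (1 - |x|)\<close>. Then \<open>u + e / (-t)\<close> belongs to the upper class of \<open>f\<close> for
  every \<open>e > 0\<close>, because the extra term does not change the gradient, increases with time and
  blows up on the part \<open>t = 0\<close> of the boundary. Hence the Perron solution is at most \<open>u\<close>, which
  stays below \<open>m = f(0,0)\<close> along \<open>-t = (\<theta>/2) |x|\<^sup>l\<close>.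

  That a classical supersolution \<open>w\<close> is superparabolic is the comparison principle for a weak
  solution \<open>h\<close>. Mollify \<open>h\<close>, its gradient \<open>G\<close> and the flux \<open>A(G)\<close> in space and time. The mollified
  equation holds pointwise and is tested with \<open>(\<tau> - t)\<^sub>+\<^sup>2 (h\<^sub>\<epsilon> - w - \<delta>)\<^sub>+\<^sup>2\<close>. By monotonicity of the
  flux, the only term of the wrong sign is controlled by the \<open>L\<^sup>p\<close> modulus of continuity of \<open>G\<close>
  under translations, so that it vanishes in the limit.
\<close>

section \<open>Smooth bump functions\<close>

text \<open>The exponents come from one computation. The time derivative of \<open>u\<close> is -c a
  (-t)^(a-1) |x|^(-b), and the divergence of its flux is -(b c)^(p-1) (n - \<beta>) (-t)^(a(p-1))
  |x|^(-\<beta>) with \<beta> = (b+1)(p-1) + 1. The choice of \<open>a\<close> makes the two powers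
  of -t equal. Since |x| < 1, the power |x|^(-\<beta>) dominates |x|^(-b) once b \<le> \<beta>, that
  is b(2-p) \<le> p; the sign is right once \<beta> < n, that is b(p-1) < n-p; and because p-1 < 1,
  a small \<open>c\<close> settles the constants. With b = l a the conditions read l \<le> p and
  l(p-1) < (n-p)(2-p); at p = 2n/(n+1) they exchange roles as the sharper one. Two obstacles shape
  the comparison. A weak solution has no classical time derivative, so its equation cannot be tested
  with a function of the solution itself. And the mollified flux is not the flux of the mollified
  gradient, so monotonicity has to be applied under the averaging integral, to the values of
  \<open>G\<close>. The factor in \<tau> - t is there because nothing is assumed at the top of a
  box.\<close>

lemma Ck_compose_affine:
  fixes f :: "'b::euclidean_space \<Rightarrow> real" and L :: "'a::euclidean_space \<Rightarrow> 'b"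
  assumes "Ck k f" "bounded_linear L"
  shows "Ck k (\<lambda>x. f (L x + b))"
  using assms(1)
proof (induction k arbitrary: f)
  case 0
  have "continuous_on UNIV (\<lambda>x. L x + b)"
    by (intro continuous_intros linear_continuous_on assms(2))
  with 0 show ?case
    by (auto intro: continuous_on_compose2[where f = "\<lambda>x. L x + b"])
next
  case (Suc k)
  have L: "((\<lambda>x. L x + b) has_derivative L) (at x)" for x
    using has_derivative_add[OF bounded_linear.has_derivative[OF assms(2) has_derivative_ident] has_derivative_const, of b "at x"]
    by simp
  have d: "((\<lambda>x. f (L x + b)) has_derivative (\<lambda>v. frechet_derivative f (at (L x + b)) (L v))) (at x)" for x
    using Suc.prems frechet_derivative_works by (intro has_derivative_compose[OF L]) auto
  have "frechet_derivative (\<lambda>x. f (L x + b)) (at x) = (\<lambda>v. frechet_derivative f (at (L x + b)) (L v))" for x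
    using frechet_derivative_at[OF d] by simp
  \<comment> \<open>A derivative of the composite along \<open>v\<close> is the derivative of
    \<open>f\<close> along \<open>L v\<close>, composed with the same affine map; this is why the
    induction generalises over \<open>f\<close>.\<close>
  moreover have "Ck k (\<lambda>x. frechet_derivative f (at (L x + b)) (L v))" for v
    using Suc.prems by (intro Suc.IH[of "\<lambda>x. frechet_derivative f (at x) (L v)"]) auto
  ultimately show ?case using d by (auto simp: differentiable_def)
qed

lemma Ck_continuous: "Ck k f \<Longrightarrow> continuous_on UNIV f"
  by (cases k) (auto intro: differentiable_imp_continuous_on simp: differentiable_on_def)

lemma Ck_has_derivative: "Ck (Suc k) f \<Longrightarrow> (f has_derivative frechet_derivative f (at x)) (at x)"
  using frechet_derivative_works by auto

text \<open>The classical flat function exp(-1/s), together with the negative powers of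
  \<open>s\<close> that differentiation produces, so that the family is closed under it.\<close>

definition flat_exp :: "nat \<Rightarrow> real \<Rightarrow> real" where
  "flat_exp k s = (if s \<le> 0 then 0 else exp (- 1 / s) / s ^ k)"

lemma flat_exp_tendsto: "(flat_exp k \<longlongrightarrow> 0) (at 0)"
proof -
  have "((\<lambda>s. exp (- 1 / s) / s ^ k) \<longlongrightarrow> (0::real)) (at_right 0)"
    by real_asymp
  then have "(flat_exp k \<longlongrightarrow> 0) (at_right 0)"
    by (rule Lim_transform_eventually) (auto simp: flat_exp_def eventually_at_right_less eventually_at_filter)
  moreover have "(flat_exp k \<longlongrightarrow> 0) (at_left 0)"
    by (rule Lim_transform_eventually[OF tendsto_const])
      (auto simp: flat_exp_def eventually_at_filter)
  ultimately show ?thesis by (simp add: filterlim_at_split)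
qed

lemma flat_exp_has_derivative:
  "(flat_exp k has_real_derivative flat_exp (k + 2) s - k * flat_exp (k + 1) s) (at s)"
proof -
  consider "s < 0" | "s = 0" | "s > 0" by linarith
  then show ?thesis
  proof cases
    case 1
    have "((\<lambda>_. 0) has_real_derivative flat_exp (k + 2) s - k * flat_exp (k + 1) s) (at s)"
      using 1 by (simp add: flat_exp_def)
    then show ?thesis
      by (rule has_field_derivative_transform_within_open[where S = "{..<0}"]) (use 1 in \<open>auto simp: flat_exp_def\<close>)
  next
    case 2
    \<comment> \<open>Away from 0 the difference quotient is \<open>flat_exp (k + 1)\<close>, which
      tends to 0.\<close>
    have "((\<lambda>h. (flat_exp k (0 + h) - flat_exp k 0) / h) \<longlongrightarrow> 0) (at 0)"
      by (rule Lim_transform_eventually[OF flat_exp_tendsto[of "k + 1"]])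
        (simp add: flat_exp_def eventually_at_filter)
    then show ?thesis using 2 by (simp add: DERIV_def flat_exp_def[of _ 0])
  next
    case 3
    have "((\<lambda>s. exp (- 1 / s) / s ^ k) has_real_derivative
        (exp (- 1 / s) * (1 / s\<^sup>2) * s ^ k - exp (- 1 / s) * (real k * s ^ (k - 1))) / (s ^ k * s ^ k)) (at s)"
      by (rule derivative_eq_intros refl | use 3 in \<open>simp add: power2_eq_square\<close>)+
    also have "(exp (- 1 / s) * (1 / s\<^sup>2) * s ^ k - exp (- 1 / s) * (real k * s ^ (k - 1))) / (s ^ k * s ^ k)
        = flat_exp (k + 2) s - k * flat_exp (k + 1) s"
      using 3 by (cases k) (auto simp: flat_exp_def field_simps power2_eq_square)
    finally show ?thesis
      by (rule has_field_derivative_transform_within_open[where S = "{0<..}"]) (use 3 in \<open>auto simp: flat_exp_def\<close>)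
  qed
qed

text \<open>An algebra of functions that contains the bumps and is closed under directional derivatives,
  so that all its members are smooth.\<close>

inductive bump_algebra :: "real \<Rightarrow> ('a::euclidean_space \<Rightarrow> real) \<Rightarrow> bool" for r where
  const: "bump_algebra r (\<lambda>_. c)"
| linear: "bump_algebra r (\<lambda>z. z \<bullet> v)"
| flat: "bump_algebra r (\<lambda>z. flat_exp k (1 - r * (z \<bullet> z)))"
| add: "bump_algebra r f \<Longrightarrow> bump_algebra r g \<Longrightarrow> bump_algebra r (\<lambda>z. f z + g z)"
| mult: "bump_algebra r f \<Longrightarrow> bump_algebra r g \<Longrightarrow> bump_algebra r (\<lambda>z. f z * g z)"

lemma bump_algebra_derivative:
  "bump_algebra r f \<Longrightarrow> \<exists>f'. (\<forall>z. (f has_derivative f' z) (at z)) \<and> (\<forall>v. bump_algebra r (\<lambda>z. f' z v))"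
proof (induction rule: bump_algebra.induct)
  case (const c)
  show ?case by (rule exI[of _ "\<lambda>_ _. 0"]) (auto intro: bump_algebra.const)
next
  case (linear v)
  show ?case by (rule exI[of _ "\<lambda>_ w. w \<bullet> v"]) (auto intro: bump_algebra.const derivative_eq_intros)
next
  case (flat k)
  let ?g = "\<lambda>s. flat_exp (k + 2) s - k * flat_exp (k + 1) s"
  let ?f' = "\<lambda>z v. (flat_exp (k + 2) (1 - r * (z \<bullet> z)) + (- real k) * flat_exp (k + 1) (1 - r * (z \<bullet> z))) * ((- 2 * r) * (z \<bullet> v))"
  have "((\<lambda>z. flat_exp k (1 - r * (z \<bullet> z))) has_derivative ?f' z) (at z)" for z :: 'a
  proof -
    have "((\<lambda>z. 1 - r * (z \<bullet> z)) has_derivative (\<lambda>v. - 2 * r * (z \<bullet> v))) (at z)"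
      by (auto intro!: derivative_eq_intros simp: inner_commute)
    from has_derivative_compose[OF this flat_exp_has_derivative[unfolded has_field_derivative_def]]
    show ?thesis by (simp add: mult.commute)
  qed
  moreover have "bump_algebra r (\<lambda>z. ?f' z v)" for v :: 'a
    by (intro bump_algebra.intros)
  ultimately show ?case by (intro exI[of _ ?f']) auto
next
  case (add f g)
  then obtain f' g' where "\<forall>z. (f has_derivative f' z) (at z)" "\<forall>v. bump_algebra r (\<lambda>z. f' z v)"
    "\<forall>z. (g has_derivative g' z) (at z)" "\<forall>v. bump_algebra r (\<lambda>z. g' z v)" by blast
  then show ?case
    by (intro exI[of _ "\<lambda>z v. f' z v + g' z v"]) (auto intro: bump_algebra.add derivative_intros)
next
  case (mult f g)
  then obtain f' g' where "\<forall>z. (f has_derivative f' z) (at z)" "\<forall>v. bump_algebra r (\<lambda>z. f' z v)"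
    "\<forall>z. (g has_derivative g' z) (at z)" "\<forall>v. bump_algebra r (\<lambda>z. g' z v)" by blast
  then show ?case using mult.hyps
    by (intro exI[of _ "\<lambda>z v. f z * g' z v + f' z v * g z"])
      (auto intro!: bump_algebra.add bump_algebra.mult has_derivative_mult)
qed

lemma bump_algebra_Ck: "bump_algebra r f \<Longrightarrow> Ck k f"
proof (induction k arbitrary: f)
  case 0
  then obtain f' where "\<forall>z. (f has_derivative f' z) (at z)" using bump_algebra_derivative by blast
  then show ?case by (auto intro: has_derivative_continuous_on)
next
  case (Suc k)
  then obtain f' where f': "\<forall>z. (f has_derivative f' z) (at z)" "\<forall>v. bump_algebra r (\<lambda>z. f' z v)"
    using bump_algebra_derivative by blast
  then have "frechet_derivative f (at z) = f' z" for z using frechet_derivative_at by metis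
  then show ?case using f' Suc.IH by (auto simp: differentiable_def)
qed

text \<open>A smooth even probability density. Evenness is used to see that \<open>J (y - z)\<close>
  has mass 1 in \<open>z\<close> as well as in \<open>y\<close>.\<close>

definition mollifier :: "real \<Rightarrow> ('a::euclidean_space \<Rightarrow> real) \<Rightarrow> bool" where
  "mollifier \<epsilon> J \<longleftrightarrow> (\<forall>k. Ck k J) \<and> (\<forall>z. 0 \<le> J z) \<and> (\<forall>z. \<epsilon> \<le> norm z \<longrightarrow> J z = 0) \<and>
     (\<forall>z. J (- z) = J z) \<and> integral\<^sup>L lborel J = 1"

lemma integrable_continuous_bounded_support:
  fixes f :: "'a::euclidean_space \<Rightarrow> real"
  assumes "continuous_on UNIV f" "\<And>z. r \<le> norm z \<Longrightarrow> f z = 0"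
  shows "integrable lborel f"
proof -
  have "set_integrable lborel (cball 0 r) f"
    unfolding set_integrable_def
    by (rule borel_integrable_compact) (auto intro: continuous_on_subset[OF assms(1)])
  moreover have "(\<lambda>z. indicator (cball 0 r) z *\<^sub>R f z) = f"
    using assms(2) by (fastforce simp: indicator_def)
  ultimately show ?thesis by (simp add: set_integrable_def)
qed

lemma mollifier_exists:
  assumes "0 < \<epsilon>"
  shows "\<exists>J::'a::euclidean_space \<Rightarrow> real. mollifier \<epsilon> J"
proof -
  let ?f = "\<lambda>z::'a. flat_exp 0 (1 - (1 / \<epsilon>\<^sup>2) * (z \<bullet> z))"
  have bump: "bump_algebra (1 / \<epsilon>\<^sup>2) ?f" by (rule bump_algebra.flat)
  then have cont: "continuous_on UNIV ?f" using bump_algebra_Ck Ck_continuous by blast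
  have out: "?f z = 0" if "\<epsilon> \<le> norm z" for z
    using that assms power_mono[OF that, of 2]
    by (auto simp: flat_exp_def divide_simps power2_norm_eq_inner)
  have nonneg: "0 \<le> ?f z" for z by (simp add: flat_exp_def)
  have int: "integrable lborel ?f" using integrable_continuous_bounded_support[OF cont out] .
  have open_U: "open {z. ?f z \<noteq> 0}" by (rule open_Collect_neq[OF cont continuous_on_const])
  \<comment> \<open>Otherwise the open set where \<open>?f\<close> is nonzero would be negligible,
    although it contains 0.\<close>
  have "integral\<^sup>L lborel ?f \<noteq> 0"
  proof
    assume "integral\<^sup>L lborel ?f = 0"
    then have "AE z in lborel. ?f z = 0"
      using integral_nonneg_eq_0_iff_AE[OF int] nonneg by simp
    then have "{z \<in> space lborel. ?f z \<noteq> 0} \<in> null_sets lborel"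
      by (subst AE_iff_null[symmetric]) (use open_U in auto)
    then have "{z. ?f z \<noteq> 0} \<in> null_sets lebesgue"
      by (intro null_sets_completionI) simp
    then have "negligible {z. ?f z \<noteq> 0}" by (simp add: negligible_iff_null_sets)
    moreover have "0 \<in> {z. ?f z \<noteq> 0}" by (simp add: flat_exp_def)
    ultimately show False
      using open_not_negligible[OF open_U] by blast
  qed
  then have pos: "integral\<^sup>L lborel ?f > 0"
    using Bochner_Integration.integral_nonneg[of lborel ?f] nonneg by (simp add: less_le)
  define c where "c = 1 / integral\<^sup>L lborel ?f"
  have "bump_algebra (1 / \<epsilon>\<^sup>2) (\<lambda>z. c * ?f z)"
    by (intro bump_algebra.mult bump_algebra.const bump)
  moreover have "integral\<^sup>L lborel (\<lambda>z. c * ?f z) = 1" using pos by (simp add: c_def)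
  moreover have "0 \<le> c * ?f z" "\<epsilon> \<le> norm z \<longrightarrow> c * ?f z = 0" for z
    using pos nonneg[of z] out[of z] by (simp_all add: c_def)
  ultimately have "mollifier \<epsilon> (\<lambda>z. c * ?f z)"
    unfolding mollifier_def by (intro conjI allI bump_algebra_Ck) simp_all
  then show ?thesis by blast
qed

section \<open>Directional derivatives and mollification\<close>

lemma lborel_nn_integral_translate:
  fixes f :: "'a::euclidean_space \<Rightarrow> ennreal"
  assumes "f \<in> borel_measurable borel"
  shows "(\<integral>\<^sup>+z. f (z + a) \<partial>lborel) = integral\<^sup>N lborel f"
proof -
  have "integral\<^sup>N lborel f = integral\<^sup>N (distr lborel borel ((+) a)) f"
    by (simp add: lborel_distr_plus)
  also have "\<dots> = (\<integral>\<^sup>+z. f (a + z) \<partial>lborel)" using assms by (subst nn_integral_distr) auto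
  finally show ?thesis by (simp add: add.commute)
qed

lemma lborel_integrable_translate:
  fixes f :: "'a::euclidean_space \<Rightarrow> 'b::{banach, second_countable_topology}"
  assumes "integrable lborel f"
  shows "integrable lborel (\<lambda>z. f (z + a))"
proof -
  have "integrable (distr lborel borel ((+) a)) f" using assms by (simp add: lborel_distr_plus)
  then have "integrable lborel (\<lambda>z. f (a + z))"
    using assms by (subst (asm) integrable_distr_eq) auto
  then show ?thesis by (simp add: add.commute)
qed

lemma lborel_integral_translate:
  fixes f :: "'a::euclidean_space \<Rightarrow> 'b::{banach, second_countable_topology}"
  shows "(\<integral>z. f (z + a) \<partial>lborel) = integral\<^sup>L lborel f"
proof (cases "integrable lborel f")
  case True
  have "integral\<^sup>L lborel f = integral\<^sup>L (distr lborel borel ((+) a)) f"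
    by (simp add: lborel_distr_plus)
  also have "\<dots> = (\<integral>z. f (a + z) \<partial>lborel)" using True by (subst integral_distr) auto
  finally show ?thesis by (simp add: add.commute)
next
  \<comment> \<open>Here both sides take the default value 0 of the Bochner integral: translating
    back shows that neither function is integrable.\<close>
  case False
  then have "\<not> integrable lborel (\<lambda>z. f (z + a))"
    using lborel_integrable_translate[of "\<lambda>z. f (z + a)" "- a"] by auto
  with False show ?thesis by (simp add: not_integrable_integral_eq)
qed

text \<open>Only the restriction to a line matters, so that space and time derivatives are treated
  separately and no total derivative is ever required.\<close>

definition has_dderiv :: "('a::real_normed_vector \<Rightarrow> real) \<Rightarrow> 'a \<Rightarrow> real \<Rightarrow> 'a \<Rightarrow> bool" where
  "has_dderiv f e d z \<longleftrightarrow> ((\<lambda>s. f (z + s *\<^sub>R e)) has_real_derivative d) (at 0)"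

lemma has_dderiv_line:
  assumes "has_dderiv f e d (z + s *\<^sub>R e)"
  shows "((\<lambda>s. f (z + s *\<^sub>R e)) has_real_derivative d) (at s)"
proof -
  have "((\<lambda>r. f (z + (r + s) *\<^sub>R e)) has_real_derivative d) (at 0)"
    using assms by (simp add: has_dderiv_def scaleR_add_left ac_simps)
  then show ?thesis using DERIV_shift[of "\<lambda>r. f (z + r *\<^sub>R e)" d 0 s] by simp
qed

text \<open>The mean value inequality; it supplies the dominating functions when difference
  quotients are passed to the limit under an integral.\<close>

lemma has_dderiv_quotient_bound:
  assumes "\<And>z. has_dderiv f e (f' z) z" "\<And>z. \<bar>f' z\<bar> \<le> M"
  shows "\<bar>f (z + s *\<^sub>R e) - f z\<bar> \<le> M * \<bar>s\<bar>"
proof -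
  have "norm (f (z + s *\<^sub>R e) - f (z + 0 *\<^sub>R e)) \<le> M * norm (s - 0)"
    by (rule field_differentiable_bound[where S = UNIV and f = "\<lambda>s. f (z + s *\<^sub>R e)" and f' = "\<lambda>s. f' (z + s *\<^sub>R e)"])
      (use assms in \<open>auto intro: has_dderiv_line\<close>)
  then show ?thesis by simp
qed

text \<open>By translation invariance, the difference quotients of \<open>\<Psi>\<close> have integral zero.\<close>

lemma integral_dderiv_eq_0:
  fixes \<Psi> :: "'a::euclidean_space \<Rightarrow> real"
  assumes der: "\<And>z. has_dderiv \<Psi> e (\<Psi>' z) z" and bd: "\<And>z. \<bar>\<Psi>' z\<bar> \<le> M"
    and supp: "\<And>z. r \<le> norm z \<Longrightarrow> \<Psi> z = 0" and int: "integrable lborel \<Psi>"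
  shows "integrable lborel \<Psi>'" "integral\<^sup>L lborel \<Psi>' = 0"
proof -
  \<comment> \<open>Steps of length at most 1 keep the supports of all quotients in one ball of
    radius r + |e|.\<close>
  define X :: "nat \<Rightarrow> real" where "X n = inverse (real (Suc n))" for n
  define q where "q n z = (\<Psi> (z + X n *\<^sub>R e) - \<Psi> z) / X n" for n z
  have X: "X \<longlonglongrightarrow> 0" "0 < X n" "X n \<le> 1" for n
    unfolding X_def by (rule LIMSEQ_inverse_real_of_nat) (auto simp: divide_simps)
  have q_int: "integrable lborel (q n)" for n
    unfolding q_def by (intro integrable_divide_zero Bochner_Integration.integrable_diff int lborel_integrable_translate)
  have q_0: "integral\<^sup>L lborel (q n) = 0" for n
    unfolding q_def by (simp add: int lborel_integrable_translate lborel_integral_translate)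
  have q_lim: "(\<lambda>n. q n z) \<longlonglongrightarrow> \<Psi>' z" for z
  proof -
    have "((\<lambda>s. (\<Psi> (z + s *\<^sub>R e) - \<Psi> z) / s) \<longlongrightarrow> \<Psi>' z) (at 0)"
      using der[of z] by (simp add: has_dderiv_def DERIV_def)
    then show ?thesis unfolding q_def
      using X by (auto simp: tendsto_at_iff_sequentially o_def less_le)
  qed
  have q_bd: "norm (q n z) \<le> M * indicator (cball 0 (r + norm e)) z" for n z
  proof (cases "norm z \<le> r + norm e")
    case True
    have "\<bar>\<Psi> (z + X n *\<^sub>R e) - \<Psi> z\<bar> \<le> M * X n"
      using has_dderiv_quotient_bound[OF der bd, of z "X n"] X(2)[of n] by simp
    then show ?thesis using True X(2)[of n] by (simp add: q_def divide_le_eq)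
  next
    case False
    have "norm (X n *\<^sub>R e) \<le> 1 * norm e"
      using X(2,3)[of n] unfolding norm_scaleR by (intro mult_right_mono) auto
    then have "r \<le> norm (z + X n *\<^sub>R e)" using False norm_diff_ineq[of z "X n *\<^sub>R e"] by linarith
    moreover have "r \<le> norm z" using False norm_ge_zero[of e] by linarith
    ultimately show ?thesis using False supp by (simp add: q_def)
  qed
  have meas: "\<Psi>' \<in> borel_measurable lborel"
    by (rule borel_measurable_LIMSEQ_metric[where f = q]) (use q_int q_lim in auto)
  have w: "integrable lborel (\<lambda>z::'a. M * indicator (cball 0 (r + norm e)) z :: real)"
    using emeasure_lborel_cball_finite[of "0::'a" "r + norm e"]
    by (intro integrable_mult_right integrable_real_indicator) auto
  have q_meas: "q n \<in> borel_measurable lborel" for n using q_int by auto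
  have "(\<lambda>n. integral\<^sup>L lborel (q n)) \<longlonglongrightarrow> integral\<^sup>L lborel \<Psi>'"
    by (rule integral_dominated_convergence[OF meas q_meas w]) (use q_lim q_bd in auto)
  then show "integral\<^sup>L lborel \<Psi>' = 0" using q_0 by (simp add: LIMSEQ_const_iff)
  show "integrable lborel \<Psi>'"
    by (rule integrable_dominated_convergence[where s = q, OF meas q_meas w]) (use q_lim q_bd in auto)
qed

text \<open>The kernel is \<open>J (y - z)\<close> rather than \<open>J (z - y)\<close>: for fixed
  \<open>z\<close> it is then literally a translate of \<open>J\<close>, to be used as a test
  function in \<open>y\<close>. The price is a minus sign in the derivative.\<close>

definition mollify :: "('a::euclidean_space \<Rightarrow> real) \<Rightarrow> ('a \<Rightarrow> 'b::euclidean_space) \<Rightarrow> 'a \<Rightarrow> 'b" where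
  "mollify J f z = (\<integral>y. J (y - z) *\<^sub>R f y \<partial>lborel)"

lemma mollify_integrable:
  fixes f :: "'a::euclidean_space \<Rightarrow> 'b::euclidean_space"
  assumes "continuous_on UNIV J" "\<And>z. \<bar>J z\<bar> \<le> M" "integrable lborel f"
  shows "integrable lborel (\<lambda>y. J (y - z) *\<^sub>R f y)"
proof (rule Bochner_Integration.integrable_bound)
  show "integrable lborel (\<lambda>y. M * norm (f y))" using assms by simp
  have "J \<in> borel_measurable borel" using assms(1) by (rule borel_measurable_continuous_onI)
  then show "(\<lambda>y. J (y - z) *\<^sub>R f y) \<in> borel_measurable lborel" using assms(3) by measurable
  show "AE y in lborel. norm (J (y - z) *\<^sub>R f y) \<le> norm (M * norm (f y))"
  proof (rule AE_I2)
    fix y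
    have "\<bar>J (y - z)\<bar> * norm (f y) \<le> \<bar>M\<bar> * norm (f y)"
      using assms(2)[of "y - z"] by (intro mult_right_mono) auto
    then show "norm (J (y - z) *\<^sub>R f y) \<le> norm (M * norm (f y))" by (simp add: abs_mult)
  qed
qed

lemma continuous_on_mollify:
  fixes f :: "'a::euclidean_space \<Rightarrow> 'b::euclidean_space"
  assumes J: "continuous_on UNIV J" "\<And>z. \<bar>J z\<bar> \<le> M" and f: "integrable lborel f"
  shows "continuous_on UNIV (mollify J f)"
proof -
  have "(\<lambda>n. mollify J f (X n)) \<longlonglongrightarrow> mollify J f z" if "X \<longlonglongrightarrow> z" for X z
    unfolding mollify_def
  proof (rule integral_dominated_convergence)
    show "integrable lborel (\<lambda>y. M * norm (f y))" using f by simp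
    show "AE y in lborel. (\<lambda>n. J (y - X n) *\<^sub>R f y) \<longlonglongrightarrow> J (y - z) *\<^sub>R f y"
      using that by (intro AE_I2 tendsto_intros continuous_on_tendsto_compose[OF J(1)]) auto
    show "AE y in lborel. norm (J (y - X n) *\<^sub>R f y) \<le> M * norm (f y)" for n
      using J(2) by (auto intro!: mult_right_mono)
  qed (use mollify_integrable[OF J f] in auto)
  then show ?thesis by (auto simp: continuous_on_sequentially o_def)
qed

lemma has_dderiv_mollify:
  fixes f :: "'a::euclidean_space \<Rightarrow> real"
  assumes J: "continuous_on UNIV J" "\<And>z. \<bar>J z\<bar> \<le> M"
    and J': "continuous_on UNIV J'" "\<And>z. \<bar>J' z\<bar> \<le> M'"
    and der: "\<And>z. has_dderiv J e (J' z) z" and f: "integrable lborel f"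
  shows "has_dderiv (mollify J f) e (- mollify J' f z) z"
proof -
  have "(\<lambda>n. (mollify J f (z + X n *\<^sub>R e) - mollify J f z) / X n) \<longlonglongrightarrow> - mollify J' f z"
    if X: "\<And>n. X n \<noteq> 0" "X \<longlonglongrightarrow> 0" for X
  proof -
    have "(\<lambda>n. \<integral>y. (J (y - (z + X n *\<^sub>R e)) - J (y - z)) / X n * f y \<partial>lborel) \<longlonglongrightarrow> (\<integral>y. - J' (y - z) * f y \<partial>lborel)"
    proof (rule integral_dominated_convergence)
      show "integrable lborel (\<lambda>y. M' * norm (f y))" using f by simp
      show "(\<lambda>y. - J' (y - z) * f y) \<in> borel_measurable lborel"
        using mollify_integrable[OF J' f, of z] by auto
      show "(\<lambda>y. (J (y - (z + X n *\<^sub>R e)) - J (y - z)) / X n * f y) \<in> borel_measurable lborel" for n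
        using borel_measurable_integrable[OF mollify_integrable[OF J f, of "z + X n *\<^sub>R e"]]
          borel_measurable_integrable[OF mollify_integrable[OF J f, of z]]
        by (simp add: left_diff_distrib diff_divide_distrib borel_measurable_divide)
      show "AE y in lborel. (\<lambda>n. (J (y - (z + X n *\<^sub>R e)) - J (y - z)) / X n * f y) \<longlonglongrightarrow> - J' (y - z) * f y"
      proof (intro AE_I2 tendsto_mult_right)
        fix y
        have "((\<lambda>s. (J (y - z + s *\<^sub>R e) - J (y - z)) / s) \<longlongrightarrow> J' (y - z)) (at 0)"
          using der[of "y - z"] by (simp add: has_dderiv_def DERIV_def)
        \<comment> \<open>Moving \<open>z\<close> by \<open>X n *\<^sub>R e\<close> moves the
          argument of \<open>J\<close> the opposite way, whence the sign in the conclusion.\<close>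
        moreover have "(\<lambda>n. - X n) \<longlonglongrightarrow> 0" using tendsto_minus[OF X(2)] by simp
        ultimately have "(\<lambda>n. (J (y - z + (- X n) *\<^sub>R e) - J (y - z)) / (- X n)) \<longlonglongrightarrow> J' (y - z)"
          using X(1) unfolding tendsto_at_iff_sequentially o_def
          by (elim allE[of _ "\<lambda>n. - X n"]) auto
        from tendsto_minus[OF this]
        show "(\<lambda>n. (J (y - (z + X n *\<^sub>R e)) - J (y - z)) / X n) \<longlonglongrightarrow> - J' (y - z)"
          by (simp add: algebra_simps)
      qed
      show "AE y in lborel. norm ((J (y - (z + X n *\<^sub>R e)) - J (y - z)) / X n * f y) \<le> M' * norm (f y)" for n
      proof (rule AE_I2)
        fix y
        have "\<bar>J (y - z + (- X n) *\<^sub>R e) - J (y - z)\<bar> \<le> M' * \<bar>- X n\<bar>"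
          by (rule has_dderiv_quotient_bound[OF der J'(2)])
        then have "\<bar>(J (y - (z + X n *\<^sub>R e)) - J (y - z)) / X n\<bar> \<le> M'"
          using X(1)[of n] by (simp add: divide_le_eq algebra_simps)
        then show "norm ((J (y - (z + X n *\<^sub>R e)) - J (y - z)) / X n * f y) \<le> M' * norm (f y)"
          unfolding norm_mult by (intro mult_right_mono) auto
      qed
    qed
    moreover have "(mollify J f (z + X n *\<^sub>R e) - mollify J f z) / X n
        = (\<integral>y. (J (y - (z + X n *\<^sub>R e)) - J (y - z)) / X n * f y \<partial>lborel)" for n
      using mollify_integrable[OF J f, of "z + X n *\<^sub>R e"] mollify_integrable[OF J f, of z]
      by (simp add: mollify_def left_diff_distrib diff_divide_distrib)
    ultimately have "(\<lambda>n. (mollify J f (z + X n *\<^sub>R e) - mollify J f z) / X n) \<longlonglongrightarrow> (\<integral>y. - J' (y - z) * f y \<partial>lborel)"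
      by (simp only:)
    then show ?thesis by (simp add: mollify_def)
  qed
  then show ?thesis
    by (auto simp: has_dderiv_def DERIV_def tendsto_at_iff_sequentially o_def)
qed

section \<open>Approximation of integrable functions by continuous ones in the mean\<close>

lemma ennreal_norm_le_add:
  "norm a \<le> norm b + norm c \<Longrightarrow> ennreal (norm a) \<le> ennreal (norm b) + ennreal (norm c)"
  by (metis ennreal_leI ennreal_plus norm_ge_zero)

text \<open>Induction over integrable functions. For the indicator of a Borel set, regularity gives
  a closed set inside and an open set outside that differ by little, and a Urysohn function
  interpolates between them; sums and dominated limits follow by the triangle inequality.\<close>

lemma lborel_L1_dense:
  fixes f :: "'a::euclidean_space \<Rightarrow> 'b::euclidean_space"
  assumes "integrable lborel f"
  shows "\<forall>\<eta>>0. \<exists>\<Phi>. continuous_on UNIV \<Phi> \<and>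
     (\<integral>\<^sup>+z. ennreal (norm (f z - \<Phi> z)) \<partial>lborel) < ennreal \<eta>"
  using assms
proof induction
  case (base A c)
  show ?case
  proof (intro allI impI)
    fix \<eta> :: real assume "\<eta> > 0"
    \<comment> \<open>The 2 accounts for the two exceptional sets \<open>U - A\<close> and
      \<open>V - - A\<close>, the added 1 for the case \<open>c = 0\<close>.\<close>
    define \<eta>' where "\<eta>' = \<eta> / (2 * (norm c + 1))"
    have \<eta>': "\<eta>' > 0" using \<open>\<eta> > 0\<close> by (auto simp: \<eta>'_def intro!: divide_pos_pos add_nonneg_pos)
    have A: "A \<in> sets borel" using base by simp
    obtain U where U: "open U" "A \<subseteq> U" "emeasure lborel (U - A) < ennreal \<eta>'"
      using outer_regular_lborel[OF A \<eta>'] by blast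
    \<comment> \<open>Outer regularity of the complement: \<open>- V\<close> is a closed subset of
      \<open>A\<close> that misses only a small part of it.\<close>
    obtain V where V: "open V" "- A \<subseteq> V" "emeasure lborel (V - (- A)) < ennreal \<eta>'"
      using outer_regular_lborel[of "- A", OF _ \<eta>'] A by (metis sets.compl_sets space_borel Compl_eq_Diff_UNIV)
    have [measurable]: "A \<in> sets borel" "U \<in> sets borel" "V \<in> sets borel" using A U V by auto
    obtain \<Phi> :: "'a \<Rightarrow> 'b" where \<Phi>: "continuous_on UNIV \<Phi>" "\<And>z. \<Phi> z \<in> closed_segment c 0"
      "\<And>z. z \<in> - V \<Longrightarrow> \<Phi> z = c" "\<And>z. z \<in> - U \<Longrightarrow> \<Phi> z = 0"
      using Urysohn[of "- V" "- U" c 0] U V by (auto simp: closed_Compl)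
    have bound: "norm (indicator A z *\<^sub>R c - \<Phi> z) \<le> norm c * (indicator (U - A) z + indicator (V - - A) z)" for z
    proof -
      have "norm (\<Phi> z) \<le> norm c" "norm (c - \<Phi> z) \<le> norm c"
        using segment_bound[OF \<Phi>(2)[of z]] by (auto simp: norm_minus_commute)
      then show ?thesis using \<Phi>(3)[of z] \<Phi>(4)[of z] by (auto simp: indicator_def)
    qed
    have "(\<integral>\<^sup>+z. ennreal (norm (indicator A z *\<^sub>R c - \<Phi> z)) \<partial>lborel)
      \<le> (\<integral>\<^sup>+z. ennreal (norm c) * (indicator (U - A) z + indicator (V - - A) z) \<partial>lborel)"
    proof (rule nn_integral_mono)
      fix z
      have "ennreal (norm c) * (indicator (U - A) z + indicator (V - - A) z)
        = ennreal (norm c * (indicator (U - A) z + indicator (V - - A) z))"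
        by (auto simp: indicator_def)
      then show "ennreal (norm (indicator A z *\<^sub>R c - \<Phi> z))
        \<le> ennreal (norm c) * (indicator (U - A) z + indicator (V - - A) z)"
        using ennreal_leI[OF bound[of z]] by (simp only:)
    qed
    also have "\<dots> = ennreal (norm c) * (emeasure lborel (U - A) + emeasure lborel (V - - A))"
      by (simp add: nn_integral_cmult nn_integral_add del: Diff_Compl)
    also have "\<dots> \<le> ennreal (norm c) * (ennreal \<eta>' + ennreal \<eta>')"
      by (rule mult_left_mono[OF add_mono[OF less_imp_le[OF U(3)] less_imp_le[OF V(3)]]]) simp
    also have "\<dots> = ennreal (norm c * (2 * \<eta>'))"
    proof -
      have "ennreal \<eta>' + ennreal \<eta>' = ennreal (2 * \<eta>')"
        using \<eta>' by (subst ennreal_plus[symmetric]) auto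
      then show ?thesis using \<eta>' by (simp only: ennreal_mult norm_ge_zero)
    qed
    also have "\<dots> < ennreal \<eta>"
    proof (rule ennreal_lessI)
      have "norm c + 1 > 0" by (intro add_nonneg_pos) auto
      then show "norm c * (2 * \<eta>') < \<eta>" using \<open>\<eta> > 0\<close> by (simp add: \<eta>'_def field_simps)
    qed fact
    finally show "\<exists>\<Phi>. continuous_on UNIV \<Phi> \<and>
     (\<integral>\<^sup>+z. ennreal (norm (indicator A z *\<^sub>R c - \<Phi> z)) \<partial>lborel) < ennreal \<eta>"
      using \<Phi>(1) by blast
  qed
next
  case (add f g)
  show ?case
  proof (intro allI impI)
    fix \<eta> :: real assume "\<eta> > 0"
    then have \<eta>: "\<eta> / 2 > 0" by simp
    obtain \<Phi> where \<Phi>: "continuous_on UNIV \<Phi>"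
      "(\<integral>\<^sup>+z. ennreal (norm (f z - \<Phi> z)) \<partial>lborel) < ennreal (\<eta> / 2)"
      using add.IH(1) \<eta> by blast
    obtain \<Psi> where \<Psi>: "continuous_on UNIV \<Psi>"
      "(\<integral>\<^sup>+z. ennreal (norm (g z - \<Psi> z)) \<partial>lborel) < ennreal (\<eta> / 2)"
      using add.IH(2) \<eta> by blast
    have [measurable]: "\<Phi> \<in> borel_measurable borel" "\<Psi> \<in> borel_measurable borel"
      "f \<in> borel_measurable borel" "g \<in> borel_measurable borel"
      using \<Phi>(1) \<Psi>(1) add.hyps by (auto intro: borel_measurable_continuous_onI)
    have "(\<integral>\<^sup>+z. ennreal (norm ((f z + g z) - (\<Phi> z + \<Psi> z))) \<partial>lborel)
      \<le> (\<integral>\<^sup>+z. ennreal (norm (f z - \<Phi> z)) + ennreal (norm (g z - \<Psi> z)) \<partial>lborel)"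
      by (intro nn_integral_mono ennreal_norm_le_add norm_diff_triangle_ineq)
    also have "\<dots> = (\<integral>\<^sup>+z. ennreal (norm (f z - \<Phi> z)) \<partial>lborel) + (\<integral>\<^sup>+z. ennreal (norm (g z - \<Psi> z)) \<partial>lborel)"
      by (intro nn_integral_add) measurable
    also have "\<dots> < ennreal (\<eta> / 2) + ennreal (\<eta> / 2)"
      using \<Phi>(2) \<Psi>(2) by (rule add_strict_mono)
    also have "\<dots> = ennreal \<eta>" using \<open>\<eta> > 0\<close> by (subst ennreal_plus[symmetric]) auto
    finally show "\<exists>\<Phi>. continuous_on UNIV \<Phi> \<and>
       (\<integral>\<^sup>+z. ennreal (norm (f z + g z - \<Phi> z)) \<partial>lborel) < ennreal \<eta>"
      using \<Phi>(1) \<Psi>(1)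
      by (intro exI[of _ "\<lambda>z. \<Phi> z + \<Psi> z"]) (auto intro: continuous_intros)
  qed
next
  case (lim f s)
  show ?case
  proof (intro allI impI)
    fix \<eta> :: real assume "\<eta> > 0"
    then have \<eta>: "\<eta> / 2 > 0" by simp
    have [measurable]: "f \<in> borel_measurable borel" "s i \<in> borel_measurable borel" for i
      using lim.hyps by auto
    have "(\<lambda>i. \<integral>\<^sup>+z. ennreal (norm (f z - s i z)) \<partial>lborel) \<longlonglongrightarrow> 0"
    proof (rule nn_integral_dominated_convergence_norm[where w = "\<lambda>z. 2 * norm (f z)"])
      show "(\<integral>\<^sup>+ z. ennreal (2 * norm (f z)) \<partial>lborel) < \<infinity>"
        using lim.hyps by (simp add: integrable_iff_bounded ennreal_mult nn_integral_cmult ennreal_mult_less_top)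
    qed (use lim.hyps in auto)
    then obtain i where i: "(\<integral>\<^sup>+z. ennreal (norm (f z - s i z)) \<partial>lborel) < ennreal (\<eta> / 2)"
      using order_tendstoD(2)[of _ 0 sequentially "ennreal (\<eta> / 2)"] \<eta>
      by (auto simp: eventually_sequentially)
    obtain \<Phi> where \<Phi>: "continuous_on UNIV \<Phi>"
      "(\<integral>\<^sup>+z. ennreal (norm (s i z - \<Phi> z)) \<partial>lborel) < ennreal (\<eta> / 2)"
      using lim.IH \<eta> by blast
    have [measurable]: "\<Phi> \<in> borel_measurable borel" 
      using \<Phi>(1) by (auto intro: borel_measurable_continuous_onI)
    have "(\<integral>\<^sup>+z. ennreal (norm (f z - \<Phi> z)) \<partial>lborel)
      \<le> (\<integral>\<^sup>+z. ennreal (norm (f z - s i z)) + ennreal (norm (s i z - \<Phi> z)) \<partial>lborel)"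
      by (intro nn_integral_mono ennreal_norm_le_add norm_diff_triangle_le) auto
    also have "\<dots> = (\<integral>\<^sup>+z. ennreal (norm (f z - s i z)) \<partial>lborel) + (\<integral>\<^sup>+z. ennreal (norm (s i z - \<Phi> z)) \<partial>lborel)"
      by (intro nn_integral_add) measurable
    also have "\<dots> < ennreal (\<eta> / 2) + ennreal (\<eta> / 2)"
      using i \<Phi>(2) by (rule add_strict_mono)
    also have "\<dots> = ennreal \<eta>" using \<open>\<eta> > 0\<close> by (subst ennreal_plus[symmetric]) auto
    finally show "\<exists>\<Phi>. continuous_on UNIV \<Phi> \<and>
       (\<integral>\<^sup>+z. ennreal (norm (f z - \<Phi> z)) \<partial>lborel) < ennreal \<eta>"
      using \<Phi>(1) by blast
  qed
qed

section \<open>Boundedness, derivatives and total mass of mollifiers\<close>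

lemma mollifier_continuous: "mollifier \<epsilon> J \<Longrightarrow> continuous_on UNIV J"
  using Ck_continuous by (auto simp: mollifier_def)

lemma continuous_bounded_support_bounded:
  fixes f :: "'a::euclidean_space \<Rightarrow> real"
  assumes "continuous_on UNIV f" "\<And>z. r < norm z \<Longrightarrow> f z = 0"
  shows "\<exists>M. \<forall>z. \<bar>f z\<bar> \<le> M"
proof -
  have "compact (f ` cball 0 r)"
    using assms(1) by (intro compact_continuous_image continuous_on_subset[OF assms(1)]) auto
  then obtain M where M: "\<forall>x\<in>f ` cball 0 r. norm x \<le> M"
    using compact_imp_bounded bounded_iff by blast
  have "\<bar>f z\<bar> \<le> max M 0" for z
  proof (cases "norm z \<le> r")
    case True
    then have "\<bar>f z\<bar> \<le> M" using M by auto
    then show ?thesis by simp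
  qed (use assms(2) in simp)
  then show ?thesis by blast
qed

lemma mollifier_bounded:
  assumes "mollifier \<epsilon> J"
  shows "\<exists>M. \<forall>z. \<bar>J z\<bar> \<le> M"
  by (rule continuous_bounded_support_bounded[OF mollifier_continuous[OF assms], of \<epsilon>])
    (use assms in \<open>auto simp: mollifier_def\<close>)

lemma mollifier_derivative:
  fixes J :: "'a::euclidean_space \<Rightarrow> real" and e :: 'a
  assumes J: "mollifier \<epsilon> J"
  defines "J' \<equiv> \<lambda>z. frechet_derivative J (at z) e"
  shows "continuous_on UNIV J'" "\<exists>M. \<forall>z. \<bar>J' z\<bar> \<le> M" "has_dderiv J e (J' z) z"
proof -
  have "Ck (Suc (Suc 0)) J" using J by (simp add: mollifier_def del: Ck.simps)
  then have diff: "(J has_derivative frechet_derivative J (at z)) (at z)" for z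
    by (rule Ck_has_derivative)
  have "Ck (Suc 0) J" using J by (simp add: mollifier_def del: Ck.simps)
  then show cont: "continuous_on UNIV J'" unfolding J'_def by simp
  have "J' z = 0" if "\<epsilon> < norm z" for z
  proof -
    have "((\<lambda>_. 0) has_derivative (\<lambda>_. 0)) (at z)" by simp
    moreover have "open {z::'a. \<epsilon> < norm z}"
      by (intro open_Collect_less continuous_intros)
    ultimately have "(J has_derivative (\<lambda>_. 0)) (at z)"
      by (rule has_derivative_transform_within_open) (use that J in \<open>auto simp: mollifier_def\<close>)
    then have "frechet_derivative J (at z) = (\<lambda>_. 0)" using frechet_derivative_at by metis
    then show ?thesis by (simp add: J'_def)
  qed
  then show "\<exists>M. \<forall>z. \<bar>J' z\<bar> \<le> M" by (rule continuous_bounded_support_bounded[OF cont])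
  have "((\<lambda>s::real. z + s *\<^sub>R e) has_derivative (\<lambda>s. s *\<^sub>R e)) (at 0)"
    by (auto intro!: derivative_eq_intros)
  moreover have "(J has_derivative frechet_derivative J (at z)) (at (z + 0 *\<^sub>R e))"
    using diff by simp
  ultimately have "((\<lambda>s. J (z + s *\<^sub>R e)) has_derivative (\<lambda>s. frechet_derivative J (at z) (s *\<^sub>R e))) (at 0)"
    by (rule has_derivative_compose)
  moreover have "frechet_derivative J (at z) (s *\<^sub>R e) = J' z * s" for s
    using linear_scale[OF has_derivative_linear[OF diff[of z]]] by (simp add: J'_def mult.commute)
  ultimately show "has_dderiv J e (J' z) z"
    unfolding has_dderiv_def has_field_derivative_def by (simp add: mult_commute_abs)
qed

lemma mollifier_integrable:
  assumes "mollifier \<epsilon> J"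
  shows "integrable lborel J"
  by (rule integrable_continuous_bounded_support[OF mollifier_continuous[OF assms], of \<epsilon>])
    (use assms in \<open>auto simp: mollifier_def\<close>)

lemma mollifier_nn_integral:
  fixes J :: "'a::euclidean_space \<Rightarrow> real"
  assumes "mollifier \<epsilon> J"
  shows "(\<integral>\<^sup>+y. ennreal (J (y - z)) \<partial>lborel) = 1" "(\<integral>\<^sup>+z. ennreal (J (y - z)) \<partial>lborel) = 1"
proof -
  have [measurable]: "J \<in> borel_measurable borel"
    using mollifier_integrable[OF assms] by auto
  have 1: "(\<integral>\<^sup>+y. ennreal (J y) \<partial>lborel) = 1"
    using assms mollifier_integrable[OF assms] by (subst nn_integral_eq_integral) (auto simp: mollifier_def)
  show 2: "(\<integral>\<^sup>+y. ennreal (J (y - z)) \<partial>lborel) = 1" for z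
    using lborel_nn_integral_translate[of "\<lambda>y. ennreal (J y)" "- z"] 1 by simp
  have "J (y - z) = J (z - y)" for z
    using assms by (metis mollifier_def minus_diff_eq)
  then show "(\<integral>\<^sup>+z. ennreal (J (y - z)) \<partial>lborel) = 1" using 2[of y] by simp
qed

text \<open>Each kernel has mass 1 in either of its variables: integrate out the variable that
  \<open>q\<close> does not see, then exchange the other one with \<open>z\<close>. A pointwise
  bound by functions of \<open>y\<close> alone and of \<open>y'\<close> alone thus becomes a bound
  by their integrals.\<close>

lemma nn_integral_double_mollify:
  fixes J :: "'a::euclidean_space \<Rightarrow> real"
  assumes J: "mollifier \<epsilon> J" and [measurable]: "q \<in> borel_measurable borel"
  shows "(\<integral>\<^sup>+z. \<integral>\<^sup>+y. \<integral>\<^sup>+y'. ennreal (J (y - z)) * ennreal (J (y' - z)) * q y \<partial>lborel \<partial>lborel \<partial>lborel) = integral\<^sup>N lborel q"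
    and "(\<integral>\<^sup>+z. \<integral>\<^sup>+y. \<integral>\<^sup>+y'. ennreal (J (y - z)) * ennreal (J (y' - z)) * q y' \<partial>lborel \<partial>lborel \<partial>lborel) = integral\<^sup>N lborel q"
proof -
  have [measurable]: "J \<in> borel_measurable borel"
    using mollifier_integrable[OF J] by auto
  have swap: "(\<integral>\<^sup>+z. \<integral>\<^sup>+y. ennreal (J (y - z)) * q y \<partial>lborel \<partial>lborel) = integral\<^sup>N lborel q"
    by (subst lborel_pair.Fubini') (auto simp: nn_integral_multc mollifier_nn_integral[OF J])
  show "(\<integral>\<^sup>+z. \<integral>\<^sup>+y. \<integral>\<^sup>+y'. ennreal (J (y - z)) * ennreal (J (y' - z)) * q y \<partial>lborel \<partial>lborel \<partial>lborel) = integral\<^sup>N lborel q"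
    using swap by (simp add: nn_integral_multc nn_integral_cmult mollifier_nn_integral[OF J])
  show "(\<integral>\<^sup>+z. \<integral>\<^sup>+y. \<integral>\<^sup>+y'. ennreal (J (y - z)) * ennreal (J (y' - z)) * q y' \<partial>lborel \<partial>lborel \<partial>lborel) = integral\<^sup>N lborel q"
    using swap by (simp add: mult.assoc nn_integral_multc nn_integral_cmult mollifier_nn_integral[OF J])
qed

lemma nn_integral_double_mollify_indicator:
  fixes J :: "'a::euclidean_space \<Rightarrow> real"
  assumes J: "mollifier \<epsilon> J" and [measurable]: "A \<in> sets borel"
  shows "(\<integral>\<^sup>+z. \<integral>\<^sup>+y. \<integral>\<^sup>+y'. ennreal (J (y - z)) * ennreal (J (y' - z)) * (c * indicator A z) \<partial>lborel \<partial>lborel \<partial>lborel) = c * emeasure lborel A"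
proof -
  have [measurable]: "J \<in> borel_measurable borel"
    using mollifier_integrable[OF J] by auto
  show ?thesis
    by (simp add: nn_integral_multc nn_integral_cmult nn_integral_cmult_indicator mollifier_nn_integral[OF J])
qed

section \<open>The mollification error\<close>

text \<open>Young's inequality with a free weight and crude constants, by comparing \<open>b\<close>
  with \<open>K * a\<close>. For large \<open>K\<close> the second coefficient is small; the large
  first one will only meet the tail of |G|^p.\<close>

lemma powr_mult_le_weighted:
  fixes a b K p :: real
  assumes "0 \<le> a" "0 \<le> b" "0 < K" "1 < p"
  shows "a powr (p - 1) * b \<le> K * a powr p + K powr (1 - p) * b powr p"
proof (cases "b \<le> K * a")
  case True
  have "a powr (p - 1) * b \<le> a powr (p - 1) * (K * a)" by (intro mult_left_mono True) simp
  also have "\<dots> = K * a powr p" using assms powr_mult_base[of a "p - 1"] by (simp add: mult_ac)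
  finally show ?thesis using assms by (smt (verit) mult_nonneg_nonneg powr_ge_zero)
next
  case False
  then have "a powr (p - 1) * b \<le> (b / K) powr (p - 1) * b"
    using assms by (intro mult_right_mono powr_mono2) (auto simp: field_simps)
  also have "\<dots> = K powr (1 - p) * b powr p"
    using assms powr_mult_base[of b "p - 1"]
    by (simp add: powr_divide powr_diff field_simps)
  finally show ?thesis using assms by (smt (verit) mult_nonneg_nonneg powr_ge_zero)
qed

lemma nn_integral_tail:
  fixes f :: "'a \<Rightarrow> 'b::euclidean_space"
  assumes f: "f \<in> borel_measurable M" "integrable M (\<lambda>z. norm (f z) powr p)" and "0 < \<eta>"
  shows "\<exists>R\<ge>0. (\<integral>\<^sup>+z. ennreal (indicator {z. R < norm (f z)} z * norm (f z) powr p) \<partial>M) < ennreal \<eta>"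
proof -
  let ?g = "\<lambda>n z. indicator {z. real n < norm (f z)} z * norm (f z) powr p"
  have [measurable]: "f \<in> borel_measurable M" by fact
  have lim: "(\<lambda>n. integral\<^sup>L M (?g n)) \<longlonglongrightarrow> integral\<^sup>L M (\<lambda>_. 0)"
  proof (rule integral_dominated_convergence[OF _ _ f(2)])
    show "AE z in M. (\<lambda>n. ?g n z) \<longlonglongrightarrow> 0"
    proof (rule AE_I2)
      fix z
      have "eventually (\<lambda>n. norm (f z) \<le> real n) sequentially"
        using eventually_ge_at_top[of "nat \<lceil>norm (f z)\<rceil>"] by eventually_elim linarith
      then show "(\<lambda>n. ?g n z) \<longlonglongrightarrow> 0"
        by (intro tendsto_eventually) (auto elim!: eventually_mono)
    qed
    show "AE z in M. norm (?g n z) \<le> norm (f z) powr p" for n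
      by (auto simp: indicator_def)
  qed measurable
  have int: "integrable M (?g n)" for n
    by (rule Bochner_Integration.integrable_bound[OF f(2)]) (auto simp: indicator_def)
  from lim have "eventually (\<lambda>n. integral\<^sup>L M (?g n) < \<eta>) sequentially"
    using \<open>0 < \<eta>\<close> by (intro order_tendstoD(2)) auto
  then obtain n where n: "integral\<^sup>L M (?g n) < \<eta>" by (auto simp: eventually_sequentially)
  have "(\<integral>\<^sup>+z. ennreal (?g n z) \<partial>M) = ennreal (integral\<^sup>L M (?g n))"
    by (rule nn_integral_eq_integral[OF int]) auto
  then show ?thesis using n \<open>0 < \<eta>\<close> by (intro exI[of _ "real n"]) (auto intro: ennreal_lessI)
qed

lemma ennreal_mult_divide_5:
  "0 < c \<Longrightarrow> 0 \<le> \<eta> \<Longrightarrow> ennreal c * ennreal (\<eta> / (5 * c)) = ennreal (\<eta> / 5)"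
  by (subst ennreal_mult[symmetric]) auto

text \<open>The oscillation of \<open>G\<close> between two independent points near the same
  \<open>z\<close>, weighted by \<open>B\<close> and integrated over \<open>z\<close> in
  \<open>A\<close>. For \<open>A = K\<close> and the weight |G|^(p-1) + M0 it is the integral of the
  bound in \<open>flux_defect_bound\<close>.\<close>

definition double_mollification_error ::
  "('a::euclidean_space \<Rightarrow> real) \<Rightarrow> 'a set \<Rightarrow> ('a \<Rightarrow> real) \<Rightarrow> ('a \<Rightarrow> 'b::euclidean_space) \<Rightarrow> ennreal" where
  "double_mollification_error J A B G = (\<integral>\<^sup>+z. \<integral>\<^sup>+y. \<integral>\<^sup>+y'. ennreal (J (y - z)) * ennreal (J (y' - z)) *
      (ennreal (B y * norm (G y' - G y)) * indicator A z) \<partial>lborel \<partial>lborel \<partial>lborel)"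

text \<open>Where \<open>|G| \<le> R\<close> the weight is bounded and \<open>L\<^sup>1\<close> density of continuous functions suffices; the part
  where \<open>|G| > R\<close> is absorbed by the tail of \<open>|G|\<^sup>p\<close>.\<close>

lemma double_mollification_error_small:
  fixes G :: "'a::euclidean_space \<Rightarrow> 'b::euclidean_space"
  assumes p: "1 < p" and Gp: "integrable lborel (\<lambda>z. norm (G z) powr p)" and G: "integrable lborel G"
    and A: "bounded A" "A \<in> sets borel" and M0: "0 \<le> M0" and \<eta>: "0 < \<eta>"
  shows "\<exists>\<epsilon>0>0. \<forall>\<epsilon> J. 0 < \<epsilon> \<longrightarrow> \<epsilon> \<le> \<epsilon>0 \<longrightarrow> mollifier \<epsilon> J \<longrightarrow>
    double_mollification_error J A (\<lambda>y. norm (G y) powr (p - 1) + M0) G \<le> ennreal \<eta>"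
proof -
  have Gm[measurable]: "G \<in> borel_measurable borel" using G by auto
  define I where "I = (\<integral>z. norm (G z) powr p \<partial>lborel)"
  have I: "0 \<le> I" by (simp add: I_def)
  \<comment> \<open>The target \<eta> is spent in fifths: two in \<open>a\<close> (approximation and
    tail), two in \<open>b\<close> (approximation and Young's second term), one in \<omega>.
    \<open>K\<close> takes care of Young's second term against the whole energy
    \<open>I\<close>.\<close>
  obtain K where K: "0 < K" "K powr (1 - p) * I \<le> \<eta> / 5"
  proof
    define K where "K = (5 * (I + 1) / \<eta>) powr (1 / (p - 1))"
    show "0 < K" using I \<eta> by (simp add: K_def)
    have "K powr (1 - p) = 1 / (5 * (I + 1) / \<eta>)"
    proof -
      have "1 / (p - 1) * (1 - p) = - 1" using p by (simp add: divide_simps)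
      then show ?thesis using I \<eta> by (simp only: K_def powr_powr) (simp add: powr_minus_divide)
    qed
    then have eq: "K powr (1 - p) * (I + 1) = \<eta> / 5" using I \<eta> by (simp add: divide_simps) (simp add: algebra_simps)
    have "K powr (1 - p) * I \<le> K powr (1 - p) * (I + 1)" by (intro mult_left_mono) auto
    with eq show "K powr (1 - p) * I \<le> \<eta> / 5" by simp
  qed
  \<comment> \<open>Chosen after \<open>K\<close>, since the tail enters with the factor
    \<open>K + 1\<close>: \<open>K\<close> from Young's inequality, 1 from the product |G y|^(p-1)
    |G y|.\<close>
  obtain R where R: "0 \<le> R"
    "(\<integral>\<^sup>+z. ennreal (indicator {z. R < norm (G z)} z * norm (G z) powr p) \<partial>lborel) < ennreal (\<eta> / (5 * (K + 1)))"
    using nn_integral_tail[of G lborel p "\<eta> / (5 * (K + 1))"] Gp K \<eta> by auto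
  \<comment> \<open>Bounds the whole weight where |G| \<le> R, and bounds \<open>M0\<close>
    everywhere.\<close>
  define c where "c = R powr (p - 1) + M0 + 1"
  have c: "0 < c" using M0 by (simp add: c_def add_nonneg_pos)
  obtain \<Phi> where \<Phi>: "continuous_on UNIV \<Phi>" "(\<integral>\<^sup>+z. ennreal (norm (G z - \<Phi> z)) \<partial>lborel) < ennreal (\<eta> / (5 * c))"
    using lborel_L1_dense[OF G] \<eta> c by (meson divide_pos_pos mult_pos_pos zero_less_numeral)
  have [measurable]: "\<Phi> \<in> borel_measurable borel" using \<Phi>(1) by (rule borel_measurable_continuous_onI)
  define m where "m = measure lborel A"
  have A_m: "emeasure lborel A = ennreal m"
    using emeasure_bounded_finite[OF A(1)] by (simp add: m_def emeasure_eq_ennreal_measure less_top)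
  define \<omega> where "\<omega> = \<eta> / (5 * c * (m + 1))"
  have "0 \<le> m" by (simp add: m_def)
  have \<omega>: "0 < \<omega>" "c * \<omega> * m \<le> \<eta> / 5"
  proof -
    have "0 < m + 1" using \<open>0 \<le> m\<close> by simp
    then show "0 < \<omega>" unfolding \<omega>_def using c \<eta> by (intro divide_pos_pos mult_pos_pos) auto
    then have "c * \<omega> * m \<le> c * \<omega> * (m + 1)" using c by (intro mult_left_mono) auto
    also have "\<dots> = \<eta> / 5" unfolding \<omega>_def using c \<open>0 < m + 1\<close> by (simp add: divide_simps)
    finally show "c * \<omega> * m \<le> \<eta> / 5" .
  qed
  obtain r where r: "\<forall>z\<in>A. norm z \<le> r" using A(1) bounded_iff by blast
  have "uniformly_continuous_on (cball 0 (r + 1)) \<Phi>"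
    by (intro compact_uniformly_continuous continuous_on_subset[OF \<Phi>(1)]) auto
  then obtain d where d: "0 < d"
    "\<And>y y'. y \<in> cball 0 (r + 1) \<Longrightarrow> y' \<in> cball 0 (r + 1) \<Longrightarrow> dist y' y < d \<Longrightarrow> dist (\<Phi> y') (\<Phi> y) < \<omega>"
    unfolding uniformly_continuous_on_def using \<omega>(1) by metis
  \<comment> \<open>The bound is separated into a function of \<open>y\<close> and a function of
    \<open>y'\<close>, as \<open>nn_integral_double_mollify\<close> wants.\<close>
  define a where "a y = c * norm (G y - \<Phi> y) + (K + 1) * (indicator {z. R < norm (G z)} y * norm (G y) powr p)" for y
  define b where "b y = c * norm (G y - \<Phi> y) + K powr (1 - p) * norm (G y) powr p" for y
  have ab0: "0 \<le> a y" "0 \<le> b y" for y using c K by (auto simp: a_def b_def)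
  have [measurable]: "a \<in> borel_measurable borel" "b \<in> borel_measurable borel" unfolding a_def b_def by measurable
  have a_int: "(\<integral>\<^sup>+y. ennreal (a y) \<partial>lborel) \<le> ennreal (2 * \<eta> / 5)"
  proof -
    have "(\<integral>\<^sup>+y. ennreal (a y) \<partial>lborel) = (\<integral>\<^sup>+y. ennreal c * ennreal (norm (G y - \<Phi> y)) + ennreal (K + 1) * ennreal (indicator {z. R < norm (G z)} y * norm (G y) powr p) \<partial>lborel)"
      unfolding a_def using c K by (intro nn_integral_cong) (simp add: ennreal_mult)
    also have "\<dots> = ennreal c * (\<integral>\<^sup>+y. ennreal (norm (G y - \<Phi> y)) \<partial>lborel) + ennreal (K + 1) * (\<integral>\<^sup>+y. ennreal (indicator {z. R < norm (G z)} y * norm (G y) powr p) \<partial>lborel)"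
      by (simp add: nn_integral_add nn_integral_cmult)
    also have "\<dots> \<le> ennreal c * ennreal (\<eta> / (5 * c)) + ennreal (K + 1) * ennreal (\<eta> / (5 * (K + 1)))"
      using R(2) \<Phi>(2) by (intro add_mono mult_left_mono) auto
    also have "\<dots> = ennreal (\<eta> / 5) + ennreal (\<eta> / 5)"
      using c K \<eta> by (simp only: ennreal_mult_divide_5 less_imp_le add_pos_pos zero_less_one)
    also have "\<dots> = ennreal (2 * \<eta> / 5)"
      using \<eta> by (subst ennreal_plus[symmetric]) auto
    finally show ?thesis .
  qed
  have b_int: "(\<integral>\<^sup>+y. ennreal (b y) \<partial>lborel) \<le> ennreal (2 * \<eta> / 5)"
  proof -
    have "(\<integral>\<^sup>+y. ennreal (b y) \<partial>lborel) = (\<integral>\<^sup>+y. ennreal c * ennreal (norm (G y - \<Phi> y)) + ennreal (K powr (1 - p)) * ennreal (norm (G y) powr p) \<partial>lborel)"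
      unfolding b_def using c K by (intro nn_integral_cong) (simp add: ennreal_mult)
    also have "\<dots> = ennreal c * (\<integral>\<^sup>+y. ennreal (norm (G y - \<Phi> y)) \<partial>lborel) + ennreal (K powr (1 - p)) * (\<integral>\<^sup>+y. ennreal (norm (G y) powr p) \<partial>lborel)"
      by (simp add: nn_integral_add nn_integral_cmult)
    also have "(\<integral>\<^sup>+y. ennreal (norm (G y) powr p) \<partial>lborel) = ennreal I"
      unfolding I_def by (rule nn_integral_eq_integral[OF Gp]) auto
    also have "ennreal c * (\<integral>\<^sup>+y. ennreal (norm (G y - \<Phi> y)) \<partial>lborel) + ennreal (K powr (1 - p)) * ennreal I
      \<le> ennreal c * ennreal (\<eta> / (5 * c)) + ennreal (\<eta> / 5)"
      using \<Phi>(2) K(2) I by (intro add_mono mult_left_mono) (auto simp: ennreal_mult[symmetric] intro: ennreal_leI)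
    also have "\<dots> = ennreal (\<eta> / 5) + ennreal (\<eta> / 5)"
      using c \<eta> by (simp only: ennreal_mult_divide_5 less_imp_le)
    also have "\<dots> = ennreal (2 * \<eta> / 5)"
      using \<eta> by (subst ennreal_plus[symmetric]) auto
    finally show ?thesis .
  qed
  have pointwise: "(norm (G y) powr (p - 1) + M0) * norm (G y' - G y) \<le> a y + b y' + c * \<omega>"
    if "norm (\<Phi> y' - \<Phi> y) \<le> \<omega>" for y y'
  proof -
    have tri: "norm (G y' - G y) \<le> norm (G y' - \<Phi> y') + \<omega> + norm (G y - \<Phi> y)"
    proof -
      have "G y' - G y = (G y' - \<Phi> y') + (\<Phi> y' - \<Phi> y) - (G y - \<Phi> y)" by simp
      then show ?thesis using that norm_triangle_ineq4[of "(G y' - \<Phi> y') + (\<Phi> y' - \<Phi> y)" "G y - \<Phi> y"]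
          norm_triangle_ineq[of "G y' - \<Phi> y'" "\<Phi> y' - \<Phi> y"] by simp
    qed
    have main: "c * norm (G y' - G y) \<le> c * norm (G y' - \<Phi> y') + c * \<omega> + c * norm (G y - \<Phi> y)"
      using mult_left_mono[OF tri, of c] c by (simp add: algebra_simps)
    show ?thesis
    proof (cases "norm (G y) \<le> R")
      case True
      then have "norm (G y) powr (p - 1) + M0 \<le> c"
        using p powr_mono2[of "p - 1" "norm (G y)" R] by (simp add: c_def)
      then have "(norm (G y) powr (p - 1) + M0) * norm (G y' - G y) \<le> c * norm (G y' - G y)"
        by (intro mult_right_mono) auto
      moreover have "0 \<le> K powr (1 - p) * norm (G y') powr p" by simp
      moreover have "a y = c * norm (G y - \<Phi> y)" using True by (simp add: a_def)
      ultimately show ?thesis using main unfolding b_def by linarith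
    next
      case False
      have "M0 * norm (G y' - G y) \<le> c * norm (G y' - G y)"
        by (intro mult_right_mono) (auto simp: c_def add_nonneg_nonneg)
      moreover have "norm (G y) powr (p - 1) * norm (G y' - G y) \<le> norm (G y) powr (p - 1) * norm (G y') + norm (G y) powr (p - 1) * norm (G y)"
        using mult_left_mono[OF norm_triangle_ineq4[of "G y'" "G y"], of "norm (G y) powr (p - 1)"]
        by (simp add: algebra_simps)
      moreover have "norm (G y) powr (p - 1) * norm (G y') \<le> K * norm (G y) powr p + K powr (1 - p) * norm (G y') powr p"
        using p K by (intro powr_mult_le_weighted) auto
      moreover have "norm (G y) powr (p - 1) * norm (G y) = norm (G y) powr p"
        using powr_mult_base[of "norm (G y)" "p - 1"] by (simp add: mult.commute)
      ultimately show ?thesis using main False by (simp add: a_def b_def algebra_simps)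
    qed
  qed
  show ?thesis
  \<comment> \<open>Radius at most 1 keeps \<open>y\<close> and \<open>y'\<close> in
    \<open>cball 0 (r + 1)\<close>; radius at most \<open>d / 2\<close> puts them within distance
    \<open>d\<close> of each other.\<close>
  proof (intro exI[of _ "min 1 (d / 2)"] conjI allI impI)
    show "0 < min 1 (d / 2)" using d by simp
    fix \<epsilon> and J :: "'a \<Rightarrow> real"
    assume \<epsilon>: "0 < \<epsilon>" "\<epsilon> \<le> min 1 (d / 2)" and J: "mollifier \<epsilon> J"
    have [measurable]: "J \<in> borel_measurable borel"
      using mollifier_integrable[OF J] by auto
    have [measurable]: "A \<in> sets borel" by fact
    have am: "(\<lambda>y. ennreal (a y)) \<in> borel_measurable borel" and bm: "(\<lambda>y. ennreal (b y)) \<in> borel_measurable borel"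
      by measurable
    let ?w = "\<lambda>z y y'. ennreal (J (y - z)) * ennreal (J (y' - z))"
    have le: "?w z y y' * (ennreal ((norm (G y) powr (p - 1) + M0) * norm (G y' - G y)) * indicator A z)
      \<le> ?w z y y' * ennreal (a y) + ?w z y y' * ennreal (b y') + ?w z y y' * (ennreal (c * \<omega>) * indicator A z)" for z y y'
    proof (cases "z \<in> A \<and> norm (y - z) < \<epsilon> \<and> norm (y' - z) < \<epsilon>")
      case True
      have z: "norm z \<le> r" using r True by auto
      have "norm y \<le> r + 1" "norm y' \<le> r + 1"
        using True \<epsilon> z norm_triangle_sub[of y z] norm_triangle_sub[of y' z] by linarith+
      moreover have "dist y' y < d"
        using True \<epsilon> dist_triangle_less_add[of y' z \<epsilon> y \<epsilon>] by (simp add: dist_norm)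
      ultimately have "norm (\<Phi> y' - \<Phi> y) \<le> \<omega>" using d(2)[of y y'] by (simp add: dist_norm)
      have "ennreal ((norm (G y) powr (p - 1) + M0) * norm (G y' - G y)) \<le> ennreal (a y) + ennreal (b y') + ennreal (c * \<omega>)"
      proof -
        have "ennreal (a y + b y' + c * \<omega>) = ennreal (a y) + ennreal (b y') + ennreal (c * \<omega>)"
          using ab0 c \<omega>(1) by (simp add: add_nonneg_nonneg)
        then show ?thesis using ennreal_leI[OF pointwise[OF \<open>norm (\<Phi> y' - \<Phi> y) \<le> \<omega>\<close>]] by (simp only:)
      qed
      from mult_left_mono[OF this, of "?w z y y'"] show ?thesis
        using True by (simp add: distrib_left)
    next
      case False
      then have "z \<notin> A \<or> J (y - z) = 0 \<or> J (y' - z) = 0" using J by (auto simp: mollifier_def not_less)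
      then show ?thesis by auto
    qed
    have "double_mollification_error J A (\<lambda>y. norm (G y) powr (p - 1) + M0) G
      \<le> (\<integral>\<^sup>+z. \<integral>\<^sup>+y. \<integral>\<^sup>+y'. ?w z y y' * ennreal (a y) + ?w z y y' * ennreal (b y') + ?w z y y' * (ennreal (c * \<omega>) * indicator A z) \<partial>lborel \<partial>lborel \<partial>lborel)"
      unfolding double_mollification_error_def by (intro nn_integral_mono le)
    also have "\<dots> = (\<integral>\<^sup>+z. \<integral>\<^sup>+y. \<integral>\<^sup>+y'. ?w z y y' * ennreal (a y) \<partial>lborel \<partial>lborel \<partial>lborel)
      + (\<integral>\<^sup>+z. \<integral>\<^sup>+y. \<integral>\<^sup>+y'. ?w z y y' * ennreal (b y') \<partial>lborel \<partial>lborel \<partial>lborel)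
      + (\<integral>\<^sup>+z. \<integral>\<^sup>+y. \<integral>\<^sup>+y'. ?w z y y' * (ennreal (c * \<omega>) * indicator A z) \<partial>lborel \<partial>lborel \<partial>lborel)"
      by (simp add: nn_integral_add)
    also have "\<dots> = (\<integral>\<^sup>+y. ennreal (a y) \<partial>lborel) + (\<integral>\<^sup>+y. ennreal (b y) \<partial>lborel) + ennreal (c * \<omega>) * emeasure lborel A"
      by (simp only: nn_integral_double_mollify(1)[OF J am] nn_integral_double_mollify(2)[OF J bm]
          nn_integral_double_mollify_indicator[OF J A(2)])
    also have "\<dots> \<le> ennreal (2 * \<eta> / 5) + ennreal (2 * \<eta> / 5) + ennreal (\<eta> / 5)"
      using a_int b_int \<omega> c \<open>0 \<le> m\<close> unfolding A_m
      by (intro add_mono) (auto simp: ennreal_mult[symmetric] intro: ennreal_leI)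
    also have "\<dots> = ennreal (2 * \<eta> / 5 + 2 * \<eta> / 5 + \<eta> / 5)"
      using \<eta> by (simp only: ennreal_plus add_nonneg_nonneg divide_nonneg_pos less_imp_le mult_nonneg_nonneg zero_less_numeral)
    also have "2 * \<eta> / 5 + 2 * \<eta> / 5 + \<eta> / 5 = \<eta>" by simp
    finally show "double_mollification_error J A (\<lambda>y. norm (G y) powr (p - 1) + M0) G \<le> ennreal \<eta>" .
  qed
qed

section \<open>The comparison principle\<close>

definition p_flux :: "real \<Rightarrow> 'a::euclidean_space \<Rightarrow> 'a" where
  "p_flux p a = norm a powr (p - 2) *\<^sub>R a"

lemma norm_powr_mult_norm: "norm a powr (p - 2) * norm a = norm a powr (p - 1)"
  using powr_mult_base[of "norm a" "p - 2"] by (simp add: mult.commute)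

lemma norm_p_flux: "norm (p_flux p a) = norm a powr (p - 1)"
  by (simp add: p_flux_def norm_powr_mult_norm)

text \<open>By Cauchy-Schwarz the pairing is at least (|a|^(p-1) - |b|^(p-1)) (|a| - |b|), and
  s^(p-1) is increasing.\<close>

lemma p_flux_monotone:
  assumes "1 < p"
  shows "0 \<le> (a - b) \<bullet> (p_flux p a - p_flux p b)"
proof -
  have cross: "norm x powr (p - 2) * (x \<bullet> y) \<le> norm x powr (p - 1) * norm y" for x y :: 'a
  proof -
    have "norm x powr (p - 2) * (x \<bullet> y) \<le> norm x powr (p - 2) * (norm x * norm y)"
      by (intro mult_left_mono norm_cauchy_schwarz) simp
    also have "\<dots> = norm x powr (p - 1) * norm y" by (simp add: norm_powr_mult_norm[symmetric])
    finally show ?thesis .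
  qed
  have sq: "norm x powr (p - 2) * (x \<bullet> x) = norm x powr (p - 1) * norm x" for x :: 'a
    by (simp add: norm_powr_mult_norm[symmetric] power2_norm_eq_inner[symmetric] power2_eq_square)
  have "0 \<le> (norm a powr (p - 1) - norm b powr (p - 1)) * (norm a - norm b)"
  proof (cases "norm a \<le> norm b")
    case True
    then have "norm a powr (p - 1) \<le> norm b powr (p - 1)" using assms by (intro powr_mono2) auto
    then show ?thesis using True by (intro mult_nonpos_nonpos) auto
  next
    case False
    then have "norm b powr (p - 1) \<le> norm a powr (p - 1)" using assms by (intro powr_mono2) auto
    then show ?thesis using False by (intro mult_nonneg_nonneg) auto
  qed
  also have "\<dots> \<le> norm a powr (p - 2) * (a \<bullet> a) - norm a powr (p - 2) * (a \<bullet> b)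
      - norm b powr (p - 2) * (b \<bullet> a) + norm b powr (p - 2) * (b \<bullet> b)"
    using cross[of a b] cross[of b a] sq[of a] sq[of b] by (simp add: algebra_simps)
  also have "\<dots> = (a - b) \<bullet> (p_flux p a - p_flux p b)"
    by (simp add: p_flux_def inner_diff_left inner_diff_right inner_commute[of b a] right_diff_distrib)
  finally show ?thesis .
qed

text \<open>Powers of the positive part. The exponent 2 gives a continuously differentiable
  truncation; 1 occurs in its derivative and 3 in its primitive. The exponent 0 gives the constant
  1, not a truncation.\<close>

definition pos_pow :: "nat \<Rightarrow> real \<Rightarrow> real" where
  "pos_pow k s = (max 0 s) ^ k"

lemma continuous_on_pos_pow[continuous_intros]:
  "continuous_on A f \<Longrightarrow> continuous_on A (\<lambda>z. pos_pow k (f z))"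
  unfolding pos_pow_def by (intro continuous_intros)

lemma pos_pow_nonneg[simp]: "0 \<le> pos_pow k s"
  by (simp add: pos_pow_def)

lemma pos_pow_eq_0: "s \<le> 0 \<Longrightarrow> 0 < k \<Longrightarrow> pos_pow k s = 0"
  by (simp add: pos_pow_def)

lemma pos_pow_mono: "s \<le> t \<Longrightarrow> pos_pow k s \<le> pos_pow k t"
  unfolding pos_pow_def by (intro power_mono) auto

lemma DERIV_pos_pow: "(pos_pow (Suc (Suc k)) has_real_derivative real (Suc (Suc k)) * pos_pow (Suc k) s) (at s)"
proof -
  consider "s < 0" | "s = 0" | "s > 0" by linarith
  then show ?thesis
  proof cases
    case 1
    have "((\<lambda>_. 0) has_real_derivative real (Suc (Suc k)) * pos_pow (Suc k) s) (at s)"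
      using 1 by (simp add: pos_pow_def)
    then show ?thesis
      by (rule has_field_derivative_transform_within_open[where S = "{..<0}"]) (use 1 in \<open>auto simp: pos_pow_def\<close>)
  next
    case 2
    have "((\<lambda>h. (pos_pow (Suc (Suc k)) (0 + h) - pos_pow (Suc (Suc k)) 0) / h) \<longlongrightarrow> 0) (at 0)"
    proof (rule Lim_null_comparison)
      have "norm ((pos_pow (Suc (Suc k)) (0 + h) - pos_pow (Suc (Suc k)) 0) / h) \<le> \<bar>h\<bar> ^ Suc k" for h :: real
      proof (cases "h \<le> 0")
        case True
        then have "max 0 h = 0" by simp
        then have "pos_pow (Suc (Suc k)) (0 + h) = 0" "pos_pow (Suc (Suc k)) 0 = 0" by (simp_all add: pos_pow_def)
        then show ?thesis by (simp del: power_Suc)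
      qed (simp add: pos_pow_def)
      then show "\<forall>\<^sub>F h in at 0. norm ((pos_pow (Suc (Suc k)) (0 + h) - pos_pow (Suc (Suc k)) 0) / h) \<le> \<bar>h\<bar> ^ Suc k"
        by simp
      show "((\<lambda>h::real. \<bar>h\<bar> ^ Suc k) \<longlongrightarrow> 0) (at 0)"
        by (auto intro!: tendsto_eq_intros)
    qed
    then show ?thesis using 2 by (simp add: DERIV_def pos_pow_def[of _ 0])
  next
    case 3
    have "((\<lambda>s. s ^ Suc (Suc k)) has_real_derivative real (Suc (Suc k)) * pos_pow (Suc k) s) (at s)"
      using 3 DERIV_pow[of "Suc (Suc k)" s] by (simp add: pos_pow_def)
    then show ?thesis
      by (rule has_field_derivative_transform_within_open[where S = "{0<..}"]) (use 3 in \<open>auto simp: pos_pow_def\<close>)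
  qed
qed

lemma DERIV_pos_pow2: "(pos_pow 2 has_real_derivative 2 * pos_pow 1 s) (at s)"
  using DERIV_pos_pow[of 0 s] by (simp add: numeral_2_eq_2)

lemma DERIV_pos_pow3: "(pos_pow 3 has_real_derivative 3 * pos_pow 2 s) (at s)"
  using DERIV_pos_pow[of 1 s] by (simp add: numeral_2_eq_2 numeral_3_eq_3)

section \<open>Calculus of directional derivatives\<close>

lemma has_dderiv_mult:
  "has_dderiv f e f' z \<Longrightarrow> has_dderiv g e g' z \<Longrightarrow> has_dderiv (\<lambda>z. f z * g z) e (f' * g z + f z * g') z"
  unfolding has_dderiv_def by (auto intro!: derivative_eq_intros)

lemma has_dderiv_diff:
  "has_dderiv f e f' z \<Longrightarrow> has_dderiv g e g' z \<Longrightarrow> has_dderiv (\<lambda>z. f z - g z) e (f' - g') z"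
  unfolding has_dderiv_def by (auto intro!: derivative_eq_intros)

lemma has_dderiv_const: "has_dderiv (\<lambda>_. c) e 0 z"
  unfolding has_dderiv_def by (auto intro!: derivative_eq_intros)

lemma has_dderiv_snd: "has_dderiv snd e (snd e) z"
  unfolding has_dderiv_def by (auto intro!: derivative_eq_intros)

lemma has_dderiv_chain:
  "has_dderiv f e f' z \<Longrightarrow> (g has_real_derivative g') (at (f z)) \<Longrightarrow> has_dderiv (\<lambda>z. g (f z)) e (g' * f') z"
  unfolding has_dderiv_def by (rule DERIV_chain2) auto

lemma has_dderiv_transform_open:
  assumes "has_dderiv f e d z" "open S" "z \<in> S" "\<And>x. x \<in> S \<Longrightarrow> f x = g x"
  shows "has_dderiv g e d z"
proof -
  have "open ((\<lambda>s::real. z + s *\<^sub>R e) -` S)"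
    by (intro open_vimage assms(2) continuous_intros)
  with assms show ?thesis unfolding has_dderiv_def
    by (elim has_field_derivative_transform_within_open) auto
qed

text \<open>The form in which integration by parts is used. Continued by 0, \<Psi> is differentiable
  along \<open>e\<close> everywhere: on \<open>N\<close> by assumption, and off \<open>K\<close>
  because the complement of \<open>K\<close> is open.\<close>

lemma integral_dderiv_compact_support:
  fixes \<Psi> \<Psi>' :: "'a::euclidean_space \<Rightarrow> real"
  assumes N: "open N" and K: "compact K" "K \<subseteq> N"
    and der: "\<And>z. z \<in> N \<Longrightarrow> has_dderiv \<Psi> e (\<Psi>' z) z"
    and cont: "continuous_on N \<Psi>" "continuous_on N \<Psi>'"
    and zero: "\<And>z. z \<in> N - K \<Longrightarrow> \<Psi> z = 0"
  shows "integrable lborel (\<lambda>z. indicator K z * \<Psi>' z)" "(\<integral>z. indicator K z * \<Psi>' z \<partial>lborel) = 0"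
proof -
  have op: "open (N - K)" "open (- K)" using N K by (auto simp: open_Diff compact_imp_closed open_Compl)
  have zero': "\<Psi>' z = 0" if "z \<in> N - K" for z
  proof -
    have "has_dderiv \<Psi> e 0 z"
      by (rule has_dderiv_transform_open[OF has_dderiv_const op(1) that]) (use zero in auto)
    moreover have "has_dderiv \<Psi> e (\<Psi>' z) z" using der that by auto
    ultimately show ?thesis unfolding has_dderiv_def by (rule DERIV_unique[symmetric])
  qed
  have der1: "has_dderiv (\<lambda>z. indicator K z * \<Psi> z) e (indicator K z * \<Psi>' z) z" for z
  proof (cases "z \<in> N")
    case True
    have "has_dderiv \<Psi> e (indicator K z * \<Psi>' z) z"
      using der[OF True] zero'[of z] True by (cases "z \<in> K") auto
    then show ?thesis
      by (rule has_dderiv_transform_open[OF _ N True]) (use zero in \<open>auto simp: indicator_def\<close>)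
  next
    case False
    then have "z \<in> - K" using K by auto
    then show ?thesis
      using has_dderiv_transform_open[OF has_dderiv_const[of 0 e z] op(2), of "\<lambda>z. indicator K z * \<Psi> z"] by simp
  qed
  have "compact (\<Psi>' ` K)"
    by (intro compact_continuous_image continuous_on_subset[OF cont(2)] K)
  then obtain M where M: "\<forall>x\<in>\<Psi>' ` K. norm x \<le> M"
    using compact_imp_bounded bounded_iff by blast
  have bd: "\<bar>indicator K z * \<Psi>' z\<bar> \<le> max M 0" for z
  proof (cases "z \<in> K")
    case True
    then have "\<bar>\<Psi>' z\<bar> \<le> M" using M by auto
    then show ?thesis using True by simp
  qed simp
  obtain r where "\<forall>z\<in>K. norm z \<le> r" using compact_imp_bounded[OF K(1)] bounded_iff by blast
  then have supp: "indicator K z * \<Psi> z = 0" if "r + 1 \<le> norm z" for z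
    using that by (force simp: indicator_def)
  have int: "integrable lborel (\<lambda>z. indicator K z * \<Psi> z)"
    using borel_integrable_compact[OF K(1) continuous_on_subset[OF cont(1) K(2)]] by simp
  show "integrable lborel (\<lambda>z. indicator K z * \<Psi>' z)" "(\<integral>z. indicator K z * \<Psi>' z \<partial>lborel) = 0"
    using integral_dderiv_eq_0[OF der1 bd supp int] by simp_all
qed

lemma test_functions_mollifier:
  assumes J: "mollifier \<epsilon> J" and sub: "cball z \<epsilon> \<subseteq> C"
  shows "(\<lambda>y. J (y - z)) \<in> test_functions C"
    and "frechet_derivative (\<lambda>y. J (y - z)) (at y) v = frechet_derivative J (at (y - z)) v"
proof -
  have "Ck k (\<lambda>y. J (y - z))" for k
    using Ck_compose_affine[of k J "\<lambda>y. y" "- z"] J by (simp add: mollifier_def bounded_linear_ident)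
  moreover have "{y. J (y - z) \<noteq> 0} \<subseteq> cball z \<epsilon>"
  proof
    fix y assume "y \<in> {y. J (y - z) \<noteq> 0}"
    then have "\<not> \<epsilon> \<le> norm (y - z)" using J by (auto simp: mollifier_def)
    then show "y \<in> cball z \<epsilon>" by (simp add: dist_norm norm_minus_commute)
  qed
  then have "closure {y. J (y - z) \<noteq> 0} \<subseteq> cball z \<epsilon>" by (intro closure_minimal) auto
  ultimately show "(\<lambda>y. J (y - z)) \<in> test_functions C"
    using sub by (auto simp: test_functions_def compact_eq_bounded_closed intro: bounded_subset[OF bounded_cball])
  have "Ck (Suc 0) J" using J by (simp add: mollifier_def del: Ck.simps)
  then have "(J has_derivative frechet_derivative J (at (y - z))) (at (y - z))" by (rule Ck_has_derivative)
  moreover have "((\<lambda>y. y - z) has_derivative (\<lambda>v. v)) (at y)"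
    by (auto intro!: derivative_eq_intros)
  ultimately have "((\<lambda>y. J (y - z)) has_derivative frechet_derivative J (at (y - z))) (at y)"
    using has_derivative_compose[of "\<lambda>y. y - z" "\<lambda>v. v" y UNIV J "frechet_derivative J (at (y - z))"]
    by simp
  then show "frechet_derivative (\<lambda>y. J (y - z)) (at y) v = frechet_derivative J (at (y - z)) v"
    using frechet_derivative_at by metis
qed

section \<open>Derivatives, components and accuracy of mollified functions\<close>

lemma dderiv_mollify:
  fixes f :: "'a::euclidean_space \<Rightarrow> real"
  assumes "mollifier \<epsilon> J" "integrable lborel f"
  shows "has_dderiv (mollify J f) e (- mollify (\<lambda>y. frechet_derivative J (at y) e) f z) z"
    "continuous_on UNIV (mollify (\<lambda>y. frechet_derivative J (at y) e) f)"
proof -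
  obtain M where M: "\<And>z. \<bar>J z\<bar> \<le> M" using mollifier_bounded[OF assms(1)] by blast
  obtain M' where M': "\<And>z. \<bar>frechet_derivative J (at z) e\<bar> \<le> M'"
    using mollifier_derivative(2)[OF assms(1), of e] by blast
  show "has_dderiv (mollify J f) e (- mollify (\<lambda>y. frechet_derivative J (at y) e) f z) z"
    by (rule has_dderiv_mollify[OF mollifier_continuous[OF assms(1)] M mollifier_derivative(1)[OF assms(1)] M'
          mollifier_derivative(3)[OF assms(1)] assms(2)])
  show "continuous_on UNIV (mollify (\<lambda>y. frechet_derivative J (at y) e) f)"
    by (rule continuous_on_mollify[OF mollifier_derivative(1)[OF assms(1)] M' assms(2)])
qed

lemma continuous_mollify:
  fixes f :: "'a::euclidean_space \<Rightarrow> 'b::euclidean_space"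
  assumes "mollifier \<epsilon> J" "integrable lborel f"
  shows "continuous_on UNIV (mollify J f)"
proof -
  obtain M where M: "\<And>z. \<bar>J z\<bar> \<le> M" using mollifier_bounded[OF assms(1)] by blast
  show ?thesis by (rule continuous_on_mollify[OF mollifier_continuous[OF assms(1)] M assms(2)])
qed

text \<open>For signed \<open>f\<close>: \<open>ennreal\<close> cuts off at 0, so the right side
  integrates the positive part.\<close>

lemma ennreal_integral_le_nn_integral:
  fixes f :: "'a \<Rightarrow> real"
  assumes "integrable M f"
  shows "ennreal (integral\<^sup>L M f) \<le> (\<integral>\<^sup>+x. ennreal (f x) \<partial>M)"
proof -
  have "integral\<^sup>L M f \<le> (\<integral>x. max 0 (f x) \<partial>M)"
    using assms by (intro integral_mono integrable_max) auto
  then have "ennreal (integral\<^sup>L M f) \<le> ennreal (\<integral>x. max 0 (f x) \<partial>M)" by (rule ennreal_leI)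
  also have "\<dots> = (\<integral>\<^sup>+x. ennreal (max 0 (f x)) \<partial>M)"
    using assms by (intro nn_integral_eq_integral[symmetric] integrable_max) auto
  also have "\<dots> = (\<integral>\<^sup>+x. ennreal (f x) \<partial>M)"
  proof (rule nn_integral_cong)
    fix x
    show "ennreal (max 0 (f x)) = ennreal (f x)" by (cases "0 \<le> f x") (auto simp: ennreal_neg max_def)
  qed
  finally show ?thesis .
qed

lemma mollify_nth:
  fixes f :: "'a::euclidean_space \<Rightarrow> real^'n"
  assumes "mollifier \<epsilon> J" "integrable lborel f"
  shows "mollify J f z $ i = mollify J (\<lambda>y. f y $ i) z"
proof -
  obtain M where M: "\<And>z. \<bar>J z\<bar> \<le> M" using mollifier_bounded[OF assms(1)] by blast
  have "integrable lborel (\<lambda>y. J (y - z) *\<^sub>R f y)"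
    by (rule mollify_integrable[OF mollifier_continuous[OF assms(1)] M assms(2)])
  from integral_bounded_linear[OF bounded_linear_vec_nth[of i] this] show ?thesis
    by (simp add: mollify_def)
qed

lemma mollify_close:
  fixes f :: "'a::euclidean_space \<Rightarrow> real"
  assumes J: "mollifier \<epsilon> J" and f: "integrable lborel f"
    and close: "\<And>y. norm (y - z) < \<epsilon> \<Longrightarrow> \<bar>f y - c\<bar> \<le> \<eta>"
  shows "\<bar>mollify J f z - c\<bar> \<le> \<eta>"
proof -
  obtain M where M: "\<And>z. \<bar>J z\<bar> \<le> M" using mollifier_bounded[OF J] by blast
  have Jt: "integrable lborel (\<lambda>y. J (y - z))"
    using lborel_integrable_translate[OF mollifier_integrable[OF J], of "- z"] by simp
  have J1: "(\<integral>y. J (y - z) \<partial>lborel) = 1"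
    using lborel_integral_translate[of J "- z"] J by (simp add: mollifier_def)
  have Jf: "integrable lborel (\<lambda>y. J (y - z) * f y)"
    using mollify_integrable[OF mollifier_continuous[OF J] M f, of z] by simp
  have J0: "0 \<le> J y" for y using J by (simp add: mollifier_def)
  have ptw: "\<bar>J (y - z) * f y - J (y - z) * c\<bar> \<le> J (y - z) * \<eta>" for y
  proof (cases "norm (y - z) < \<epsilon>")
    case True
    have "\<bar>J (y - z) * f y - J (y - z) * c\<bar> = J (y - z) * \<bar>f y - c\<bar>"
      using J0 by (simp add: right_diff_distrib[symmetric] abs_mult)
    then show ?thesis using close[OF True] J0 by (simp add: mult_left_mono)
  next
    case False
    then have "J (y - z) = 0" using J by (auto simp: mollifier_def)
    then show ?thesis by simp
  qed
  have "mollify J f z - c = (\<integral>y. J (y - z) * f y - J (y - z) * c \<partial>lborel)"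
    using Jf Jt J1 by (simp add: mollify_def)
  also have "\<bar>\<dots>\<bar> \<le> (\<integral>y. \<bar>J (y - z) * f y - J (y - z) * c\<bar> \<partial>lborel)"
    by (rule integral_abs_bound)
  also have "\<dots> \<le> (\<integral>y. J (y - z) * \<eta> \<partial>lborel)"
    using ptw Jf Jt by (intro integral_mono) auto
  also have "\<dots> = \<eta>" using J1 by simp
  finally show ?thesis .
qed

section \<open>Energy estimate in a cylinder\<close>

abbreviation ex :: "'n \<Rightarrow> (real^'n) \<times> real" where "ex i \<equiv> (axis i 1, 0)"
abbreviation et :: "(real^'n) \<times> real" where "et \<equiv> (0, 1)"

text \<open>\<open>H\<close> and \<open>G\<close> are Borel functions on the whole space: in the application, the weak solution and a
  Borel version of its gradient on the cylinder \<open>C\<close>, extended by zero.\<close>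

locale parabolic_comparison =
  fixes p \<delta> \<tau> :: real and C K :: "((real^'n) \<times> real) set"
    and H w wt :: "(real^'n) \<times> real \<Rightarrow> real" and G W :: "(real^'n) \<times> real \<Rightarrow> real^'n"
    and dF :: "'n \<Rightarrow> (real^'n) \<times> real \<Rightarrow> real"
  assumes p: "1 < p" and \<delta>: "0 < \<delta>"
    and C: "open C" and K: "compact K" "K \<subseteq> C"
    and H: "integrable lborel H" "continuous_on C H"
    and G: "integrable lborel G" "integrable lborel (\<lambda>z. norm (G z) powr p)"
      "integrable lborel (\<lambda>z. p_flux p (G z))"
    and weak_grad: "\<And>\<phi> i. \<phi> \<in> test_functions C \<Longrightarrow>
      (\<integral>y. frechet_derivative \<phi> (at y) (ex i) * H y \<partial>lborel) = - (\<integral>y. \<phi> y * G y $ i \<partial>lborel)"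
    and weak_eq: "\<And>\<phi>. \<phi> \<in> test_functions C \<Longrightarrow>
      (\<Sum>i\<in>UNIV. \<integral>y. frechet_derivative \<phi> (at y) (ex i) * p_flux p (G y) $ i \<partial>lborel)
        = (\<integral>y. frechet_derivative \<phi> (at y) et * H y \<partial>lborel)"
    and w_x: "\<And>z i. z \<in> C \<Longrightarrow> has_dderiv w (ex i) (W z $ i) z"
    and w_t: "\<And>z. z \<in> C \<Longrightarrow> has_dderiv w et (wt z) z"
    and W_x: "\<And>z i. z \<in> C \<Longrightarrow> has_dderiv (\<lambda>z. p_flux p (W z) $ i) (ex i) (dF i z) z"
    and cont: "continuous_on C w" "continuous_on C wt" "continuous_on C W" "\<And>i. continuous_on C (dF i)"
      "continuous_on C (\<lambda>z. p_flux p (W z))"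
    and super: "\<And>z. z \<in> C \<Longrightarrow> (\<Sum>i\<in>UNIV. dF i z) \<le> wt z"
    and superlevel: "\<And>z. z \<in> C \<Longrightarrow> snd z \<le> \<tau> \<Longrightarrow> \<delta> / 2 \<le> H z - w z \<Longrightarrow> z \<in> K"
begin

definition flux :: "(real^'n) \<times> real \<Rightarrow> real^'n" where "flux z = p_flux p (G z)"

lemma flux_nth: "integrable lborel (\<lambda>z. flux z $ i)"
  unfolding flux_def using integrable_bounded_linear[OF bounded_linear_vec_nth G(3)] by simp

text \<open>Test the weak gradient with \<open>J (y - z)\<close>; the sign from differentiating
  \<open>mollify\<close> cancels the one from the weak derivative.\<close>

lemma dderiv_mollify_H_x:
  assumes J: "mollifier \<epsilon> J" and sub: "cball z \<epsilon> \<subseteq> C"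
  shows "has_dderiv (mollify J H) (ex i) (mollify J G z $ i) z"
proof -
  have "- mollify (\<lambda>y. frechet_derivative J (at y) (ex i)) H z = mollify J G z $ i"
    using weak_grad[OF test_functions_mollifier(1)[OF J sub], of i]
    by (simp add: mollify_nth[OF J G(1)] test_functions_mollifier(2)[OF J sub]) (simp add: mollify_def)
  then show ?thesis using dderiv_mollify(1)[OF J H(1), of "ex i" z] by simp
qed

text \<open>The mollified equation: the sum on the right is the divergence of the mollified flux,
  written with the derivative on the kernel.\<close>

lemma dderiv_mollify_H_t:
  assumes J: "mollifier \<epsilon> J" and sub: "cball z \<epsilon> \<subseteq> C"
  shows "has_dderiv (mollify J H) et
    (\<Sum>i\<in>UNIV. - mollify (\<lambda>y. frechet_derivative J (at y) (ex i)) (\<lambda>y. flux y $ i) z) z"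
proof -
  have "- mollify (\<lambda>y. frechet_derivative J (at y) et) H z
    = (\<Sum>i\<in>UNIV. - mollify (\<lambda>y. frechet_derivative J (at y) (ex i)) (\<lambda>y. flux y $ i) z)"
    using weak_eq[OF test_functions_mollifier(1)[OF J sub]]
    by (simp add: test_functions_mollifier(2)[OF J sub] mollify_def flux_def sum_negf)
  then show ?thesis using dderiv_mollify(1)[OF J H(1), of et z] by simp
qed

text \<open>The mollified fluxes are compared with \<open>W z\<close> through the values \<open>G y\<close>, where the monotonicity of the
  flux applies; replacing \<open>mollify J G z\<close> by \<open>G y\<close> costs the integral on the right.\<close>

lemma flux_defect_bound:
  assumes J: "mollifier \<epsilon> J" and M0: "norm (W z) powr (p - 1) \<le> M0"
  shows "ennreal (- ((mollify J G z - W z) \<bullet> (mollify J flux z - p_flux p (W z))))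
    \<le> (\<integral>\<^sup>+y. \<integral>\<^sup>+y'. ennreal (J (y - z)) * ennreal (J (y' - z)) *
        ennreal ((norm (G y) powr (p - 1) + M0) * norm (G y' - G y)) \<partial>lborel \<partial>lborel)"
proof -
  obtain M where M: "\<And>z. \<bar>J z\<bar> \<le> M" using mollifier_bounded[OF J] by blast
  have J0: "0 \<le> J y" for y using J unfolding mollifier_def by blast
  have Jt: "integrable lborel (\<lambda>y. J (y - z))"
    using lborel_integrable_translate[OF mollifier_integrable[OF J], of "- z"] by simp
  have J1: "(\<integral>y. J (y - z) \<partial>lborel) = 1"
    using lborel_integral_translate[of J "- z"] J by (simp add: mollifier_def)
  have int_G: "integrable lborel (\<lambda>y. J (y - z) *\<^sub>R G y)"
    and int_B: "integrable lborel (\<lambda>y. J (y - z) *\<^sub>R flux y)"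
    unfolding flux_def
    by (rule mollify_integrable[OF mollifier_continuous[OF J] M G(1)] mollify_integrable[OF mollifier_continuous[OF J] M G(3)])+
  have [measurable]: "J \<in> borel_measurable borel" "G \<in> borel_measurable borel"
    using mollifier_integrable[OF J] G by auto
  let ?D = "mollify J G z - W z"
  let ?f = "\<lambda>y. ?D \<bullet> (J (y - z) *\<^sub>R (flux y - p_flux p (W z)))"
  have int_BF: "integrable lborel (\<lambda>y. J (y - z) *\<^sub>R (flux y - p_flux p (W z)))"
    unfolding scaleR_diff_right using int_B Jt by (intro Bochner_Integration.integrable_diff integrable_scaleR_left)
  then have int_f: "integrable lborel ?f" by (intro integrable_inner_right) auto
  have "mollify J flux z - p_flux p (W z) = (\<integral>y. J (y - z) *\<^sub>R (flux y - p_flux p (W z)) \<partial>lborel)"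
    unfolding scaleR_diff_right using int_B Jt J1 by (simp add: mollify_def)
  then have "?D \<bullet> (mollify J flux z - p_flux p (W z)) = (\<integral>y. ?f y \<partial>lborel)"
    by (simp only:) (rule integral_inner_right[symmetric, OF int_BF])
  then have "ennreal (- (?D \<bullet> (mollify J flux z - p_flux p (W z)))) = ennreal (\<integral>y. - ?f y \<partial>lborel)"
    by simp
  also have "\<dots> \<le> (\<integral>\<^sup>+y. ennreal (- ?f y) \<partial>lborel)"
    using int_f by (intro ennreal_integral_le_nn_integral) auto
  also have "\<dots> \<le> (\<integral>\<^sup>+y. \<integral>\<^sup>+y'. ennreal (J (y - z)) * ennreal (J (y' - z)) *
        ennreal ((norm (G y) powr (p - 1) + M0) * norm (G y' - G y)) \<partial>lborel \<partial>lborel)"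
  proof (rule nn_integral_mono)
    fix y
    have "?D \<bullet> (flux y - p_flux p (W z))
      = (G y - W z) \<bullet> (flux y - p_flux p (W z)) + (mollify J G z - G y) \<bullet> (flux y - p_flux p (W z))"
      by (simp add: inner_diff_left)
    moreover have "0 \<le> (G y - W z) \<bullet> (flux y - p_flux p (W z))"
      unfolding flux_def by (rule p_flux_monotone[OF p])
    moreover have "\<bar>(mollify J G z - G y) \<bullet> (flux y - p_flux p (W z))\<bar>
      \<le> norm (mollify J G z - G y) * norm (flux y - p_flux p (W z))"
      by (rule Cauchy_Schwarz_ineq2)
    moreover have "norm (flux y - p_flux p (W z)) \<le> norm (G y) powr (p - 1) + M0"
      using norm_triangle_ineq4[of "flux y" "p_flux p (W z)"] M0 unfolding flux_def norm_p_flux by linarith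
    then have "norm (mollify J G z - G y) * norm (flux y - p_flux p (W z))
      \<le> (norm (G y) powr (p - 1) + M0) * norm (mollify J G z - G y)"
      by (subst mult.commute) (intro mult_right_mono, auto)
    ultimately have "- (?D \<bullet> (flux y - p_flux p (W z)))
      \<le> (norm (G y) powr (p - 1) + M0) * norm (mollify J G z - G y)" by linarith
    from mult_left_mono[OF this J0[of "y - z"]]
    have "ennreal (- ?f y) \<le> ennreal (J (y - z) * (norm (G y) powr (p - 1) + M0) * norm (mollify J G z - G y))"
      by (intro ennreal_leI) (simp add: mult_ac)
    also have "\<dots> = ennreal (J (y - z) * (norm (G y) powr (p - 1) + M0)) * ennreal (norm (mollify J G z - G y))"
      by (rule ennreal_mult'') simp
    also have "mollify J G z - G y = (\<integral>y'. J (y' - z) *\<^sub>R (G y' - G y) \<partial>lborel)"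
      unfolding scaleR_diff_right using int_G Jt J1 by (simp add: mollify_def)
    also have "ennreal (norm \<dots>) \<le> (\<integral>\<^sup>+y'. ennreal (norm (J (y' - z) *\<^sub>R (G y' - G y))) \<partial>lborel)"
      unfolding scaleR_diff_right using int_G Jt
      by (intro integral_norm_bound_ennreal Bochner_Integration.integrable_diff integrable_scaleR_left)
    also have "ennreal (J (y - z) * (norm (G y) powr (p - 1) + M0)) * \<dots>
      = (\<integral>\<^sup>+y'. ennreal (J (y - z) * (norm (G y) powr (p - 1) + M0)) * ennreal (norm (J (y' - z) *\<^sub>R (G y' - G y))) \<partial>lborel)"
      by (rule nn_integral_cmult[symmetric]) measurable
    also have "\<dots> = (\<integral>\<^sup>+y'. ennreal (J (y - z)) * ennreal (J (y' - z)) *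
        ennreal ((norm (G y) powr (p - 1) + M0) * norm (G y' - G y)) \<partial>lborel)"
    proof (rule nn_integral_cong)
      fix y'
      have "0 \<le> norm (G y) powr (p - 1) + M0"
        using order_trans[OF _ M0, of 0] by (simp add: add_nonneg_nonneg)
      then show "ennreal (J (y - z) * (norm (G y) powr (p - 1) + M0)) * ennreal (norm (J (y' - z) *\<^sub>R (G y' - G y)))
        = ennreal (J (y - z)) * ennreal (J (y' - z)) * ennreal ((norm (G y) powr (p - 1) + M0) * norm (G y' - G y))"
        using J0 by (simp add: ennreal_mult[symmetric] mult_ac)
    qed
    finally show "ennreal (- ?f y) \<le> (\<integral>\<^sup>+y'. ennreal (J (y - z)) * ennreal (J (y' - z)) *
        ennreal ((norm (G y) powr (p - 1) + M0) * norm (G y' - G y)) \<partial>lborel)"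
      by (simp add: mult_left_mono)
  qed
  finally show ?thesis .
qed


text \<open>Two exact derivatives vanishing outside \<open>K\<close> have integral zero: in time
  that of \<kappa>^2 S^3 / 3, in space those of \<kappa>^2 S^2 times the components of the flux
  difference, where \<kappa> and \<open>S\<close> are the positive parts of \<tau> - t and of the
  excess over \<delta>. Subtracting them leaves the term from differentiating \<kappa>^2, which is
  the left side, against the pairing of gradient and flux differences, which
  \<open>flux_defect_bound\<close> controls.\<close>

lemma energy_bound:
  assumes J: "mollifier \<epsilon> J" and N: "open N" "K \<subseteq> N" and sub: "\<And>z. z \<in> N \<Longrightarrow> cball z \<epsilon> \<subseteq> C" and \<epsilon>: "0 < \<epsilon>"
    and close: "\<And>z. z \<in> N \<Longrightarrow> \<bar>mollify J H z - H z\<bar> \<le> \<delta> / 2"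
    and M0: "\<And>z. z \<in> K \<Longrightarrow> norm (W z) powr (p - 1) \<le> M0"
    and X: "\<And>z. z \<in> K \<Longrightarrow> 2 * pos_pow 2 (\<tau> - snd z) * pos_pow 1 (mollify J H z - w z - \<delta>) \<le> X"
  shows "ennreal (\<integral>z. indicator K z * (2 / 3 * pos_pow 1 (\<tau> - snd z) * pos_pow 3 (mollify J H z - w z - \<delta>)) \<partial>lborel)
    \<le> ennreal X * double_mollification_error J K (\<lambda>y. norm (G y) powr (p - 1) + M0) G"
proof -
  have NC: "N \<subseteq> C" using sub \<epsilon> by (meson centre_in_cball less_imp_le subset_eq)
  define \<kappa> where "\<kappa> k z = pos_pow k (\<tau> - snd z)" for k and z :: "(real^'n) \<times> real"
  define v where "v z = mollify J H z - w z - \<delta>" for z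
  define S where "S k z = pos_pow k (v z)" for k z
  define Bx where "Bx i z = - mollify (\<lambda>y. frechet_derivative J (at y) (ex i)) (\<lambda>y. flux y $ i) z" for i z
  \<comment> \<open>\<open>?D\<close> is the gradient of \<open>v\<close> and \<open>?E\<close> the
    difference of the fluxes; \<open>Bx i\<close> is the derivative of the mollified flux component
    i in its own direction.\<close>
  let ?D = "\<lambda>z. mollify J G z - W z" and ?E = "\<lambda>z. mollify J flux z - p_flux p (W z)"
  have flux_int: "integrable lborel flux" using G(3) by (simp add: flux_def[abs_def])
  have cont_N: "continuous_on N w" "continuous_on N wt" "continuous_on N W" "continuous_on N (dF i)"
      "continuous_on N (\<lambda>z. p_flux p (W z))" "continuous_on N (mollify J H)" "continuous_on N (mollify J G)"
      "continuous_on N (mollify J flux)" "continuous_on N (Bx i)" for i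
    using cont continuous_on_subset[OF _ NC] continuous_mollify[OF J] H G flux_int dderiv_mollify(2)[OF J flux_nth]
    unfolding Bx_def by (auto intro: continuous_on_subset[OF _ subset_UNIV] intro!: continuous_on_minus)
  have cont_\<kappa>: "continuous_on N (\<kappa> k)" for k unfolding \<kappa>_def by (intro continuous_intros)
  have cont_v: "continuous_on N v" unfolding v_def by (intro continuous_intros cont_N)
  have cont_S: "continuous_on N (S k)" for k unfolding S_def by (intro continuous_intros cont_v)
  have \<kappa>_x: "has_dderiv (\<kappa> 2) (ex i) 0 z" for i z
    using has_dderiv_chain[OF has_dderiv_diff[OF has_dderiv_const[of \<tau>] has_dderiv_snd] DERIV_pos_pow2, of "ex i" z]
    by (simp add: \<kappa>_def[abs_def])
  have \<kappa>_t: "has_dderiv (\<kappa> 2) et (- 2 * \<kappa> 1 z) z" for z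
    using has_dderiv_chain[OF has_dderiv_diff[OF has_dderiv_const[of \<tau>] has_dderiv_snd] DERIV_pos_pow2, of et z]
    by (simp add: \<kappa>_def[abs_def])
  have v_x: "has_dderiv v (ex i) (?D z $ i) z" if "z \<in> N" for i z
    using has_dderiv_diff[OF has_dderiv_diff[OF dderiv_mollify_H_x[OF J sub[OF that]] w_x] has_dderiv_const[of \<delta>]] that NC
    by (auto simp: v_def[abs_def])
  have v_t: "has_dderiv v et ((\<Sum>i\<in>UNIV. Bx i z) - wt z) z" if "z \<in> N" for z
    using has_dderiv_diff[OF has_dderiv_diff[OF dderiv_mollify_H_t[OF J sub[OF that]] w_t] has_dderiv_const[of \<delta>]] that NC
    by (auto simp: v_def[abs_def] Bx_def)
  have E_x: "has_dderiv (\<lambda>z. ?E z $ i) (ex i) (Bx i z - dF i z) z" if "z \<in> N" for i z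
    using has_dderiv_diff[OF dderiv_mollify(1)[OF J flux_nth[of i]] W_x[OF subsetD[OF NC that], of i]]
    by (simp add: Bx_def mollify_nth[OF J flux_int])
  \<comment> \<open>Outside \<open>K\<close> and up to time \<tau>, \<open>H - w\<close> is below
    \<delta>/2 and mollification adds at most \<delta>/2, so \<open>v\<close> is not positive; after
    \<tau> the time factor vanishes.\<close>
  have vanish: "\<kappa> 2 z * S k z = 0" if "z \<in> N - K" "0 < k" for z k
  proof (cases "snd z \<le> \<tau>")
    case True
    then have "H z - w z < \<delta> / 2" using superlevel[of z] that NC by force
    moreover have "\<bar>mollify J H z - H z\<bar> \<le> \<delta> / 2" using close that by blast
    ultimately have "v z \<le> 0" unfolding v_def by linarith
    then show ?thesis using that by (simp add: S_def pos_pow_eq_0)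
  next
    case False
    then show ?thesis by (simp add: \<kappa>_def pos_pow_eq_0)
  qed
  define R1 where "R1 z = - 2 * \<kappa> 1 z * (S 3 z / 3) + \<kappa> 2 z * (S 2 z * ((\<Sum>i\<in>UNIV. Bx i z) - wt z))" for z
  define R2 where "R2 i z = \<kappa> 2 z * (2 * S 1 z * ?D z $ i) * ?E z $ i + \<kappa> 2 z * S 2 z * (Bx i z - dF i z)" for i z
  have d1: "has_dderiv (\<lambda>z. \<kappa> 2 z * (S 3 z / 3)) et (R1 z) z" if "z \<in> N" for z
  proof -
    have "((\<lambda>s. pos_pow 3 s / 3) has_real_derivative pos_pow 2 (v z)) (at (v z))"
      using DERIV_cdivide[OF DERIV_pos_pow3[of "v z"], of 3] by simp
    from has_dderiv_mult[OF \<kappa>_t has_dderiv_chain[OF v_t[OF that] this]]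
    show ?thesis by (simp add: R1_def S_def)
  qed
  have c1: "continuous_on N (\<lambda>z. \<kappa> 2 z * (S 3 z / 3))" "continuous_on N R1"
    unfolding R1_def by (intro continuous_intros cont_N cont_S cont_\<kappa>; simp)+
  have z1: "\<kappa> 2 z * (S 3 z / 3) = 0" if "z \<in> N - K" for z using vanish[OF that, of 3] by simp
  note R1 = integral_dderiv_compact_support[OF N(1) K(1) N(2) d1 c1 z1]
  have d2: "has_dderiv (\<lambda>z. \<kappa> 2 z * S 2 z * ?E z $ i) (ex i) (R2 i z) z" if "z \<in> N" for i z
  proof -
    from has_dderiv_mult[OF has_dderiv_mult[OF \<kappa>_x has_dderiv_chain[OF v_x[OF that] DERIV_pos_pow2]] E_x[OF that]]
    show ?thesis by (simp add: R2_def S_def)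
  qed
  have c2: "continuous_on N (\<lambda>z. \<kappa> 2 z * S 2 z * ?E z $ i)" "continuous_on N (R2 i)" for i
    unfolding R2_def by (intro continuous_intros cont_N cont_S cont_\<kappa>)+
  have z2: "\<kappa> 2 z * S 2 z * ?E z $ i = 0" if "z \<in> N - K" for i z using vanish[OF that, of 2] by simp
  note R2 = integral_dderiv_compact_support[OF N(1) K(1) N(2) d2 c2 z2]
  let ?L = "\<lambda>z. 2 / 3 * \<kappa> 1 z * S 3 z" and ?Q = "\<lambda>z. 2 * \<kappa> 2 z * S 1 z * - (?D z \<bullet> ?E z)"
  have cont_K: "integrable lborel (\<lambda>z. indicator K z * f z)" if "continuous_on N f" for f :: "(real^'n) \<times> real \<Rightarrow> real"
    using borel_integrable_compact[OF K(1) continuous_on_subset[OF that N(2)]] by simp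
  have L_int: "integrable lborel (\<lambda>z. indicator K z * ?L z)"
    by (intro cont_K continuous_intros cont_S cont_\<kappa>)
  have Q_int: "integrable lborel (\<lambda>z. indicator K z * ?Q z)"
    by (intro cont_K continuous_intros cont_N cont_S cont_\<kappa>)
  \<comment> \<open>The divergence of the mollified flux cancels between \<open>R1\<close> and the
    sum of the \<open>R2 i\<close>. Besides \<open>?Q\<close> there remains \<kappa>^2 S^2 times the
    divergence of the flux of \<open>W\<close> minus \<open>wt\<close>, which is nonpositive by
    \<open>super\<close>.\<close>
  have "?L z + R1 z + (\<Sum>i\<in>UNIV. - R2 i z) \<le> ?Q z" if "z \<in> K" for z
  proof -
    have zC: "z \<in> C" using that K by auto
    have "(\<Sum>i\<in>UNIV. - R2 i z) = - (2 * \<kappa> 2 z * S 1 z * (?D z \<bullet> ?E z)) - \<kappa> 2 z * S 2 z * ((\<Sum>i\<in>UNIV. Bx i z) - (\<Sum>i\<in>UNIV. dF i z))"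
      unfolding R2_def sum_negf sum.distrib
      by (simp add: inner_vec_def sum_distrib_left sum_subtractf[symmetric] mult_ac)
    moreover have "0 \<le> \<kappa> 2 z * S 2 z * (wt z - (\<Sum>i\<in>UNIV. dF i z))"
      using super[OF zC] by (intro mult_nonneg_nonneg) (auto simp: \<kappa>_def S_def)
    ultimately show ?thesis unfolding R1_def by (simp add: algebra_simps)
  qed
  then have ineq: "indicator K z * ?L z + indicator K z * R1 z + (\<Sum>i\<in>UNIV. - (indicator K z * R2 i z)) \<le> indicator K z * ?Q z" for z
    by (cases "z \<in> K") auto
  have "(\<integral>z. indicator K z * ?L z \<partial>lborel)
    = (\<integral>z. indicator K z * ?L z + indicator K z * R1 z + (\<Sum>i\<in>UNIV. - (indicator K z * R2 i z)) \<partial>lborel)"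
    using L_int R1 R2 by simp
  also have "\<dots> \<le> (\<integral>z. indicator K z * ?Q z \<partial>lborel)"
    using L_int R1 R2 Q_int ineq by (intro integral_mono Bochner_Integration.integrable_add Bochner_Integration.integrable_sum integrable_minus) auto
  finally have "ennreal (\<integral>z. indicator K z * ?L z \<partial>lborel) \<le> ennreal (\<integral>z. indicator K z * ?Q z \<partial>lborel)"
    by (rule ennreal_leI)
  also have "\<dots> \<le> (\<integral>\<^sup>+z. ennreal (indicator K z * ?Q z) \<partial>lborel)"
    by (rule ennreal_integral_le_nn_integral[OF Q_int])
  also have "\<dots> \<le> (\<integral>\<^sup>+z. ennreal X * (\<integral>\<^sup>+y. \<integral>\<^sup>+y'. ennreal (J (y - z)) * ennreal (J (y' - z)) *
        (ennreal ((norm (G y) powr (p - 1) + M0) * norm (G y' - G y)) * indicator K z) \<partial>lborel \<partial>lborel) \<partial>lborel)"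
  proof (rule nn_integral_mono)
    fix z
    show "ennreal (indicator K z * ?Q z) \<le> ennreal X * (\<integral>\<^sup>+y. \<integral>\<^sup>+y'. ennreal (J (y - z)) * ennreal (J (y' - z)) *
        (ennreal ((norm (G y) powr (p - 1) + M0) * norm (G y' - G y)) * indicator K z) \<partial>lborel \<partial>lborel)"
    proof (cases "z \<in> K")
      case True
      have "ennreal (indicator K z * ?Q z) = ennreal (2 * \<kappa> 2 z * S 1 z) * ennreal (- (?D z \<bullet> ?E z))"
        using True by (simp only: indicator_simps mult_1_left) (rule ennreal_mult', simp add: \<kappa>_def S_def)
      also have "\<dots> \<le> ennreal X * (\<integral>\<^sup>+y. \<integral>\<^sup>+y'. ennreal (J (y - z)) * ennreal (J (y' - z)) *
        ennreal ((norm (G y) powr (p - 1) + M0) * norm (G y' - G y)) \<partial>lborel \<partial>lborel)"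
        using X[OF True] flux_defect_bound[OF J M0[OF True]]
        by (intro mult_mono ennreal_leI) (auto simp: \<kappa>_def S_def v_def)
      finally show ?thesis using True by simp
    qed simp
  qed
  also have "\<dots> = ennreal X * double_mollification_error J K (\<lambda>y. norm (G y) powr (p - 1) + M0) G"
  proof -
    have [measurable]: "J \<in> borel_measurable borel" "G \<in> borel_measurable borel" "K \<in> sets borel"
      using mollifier_integrable[OF J] G compact_imp_closed[OF K(1)] by auto
    show ?thesis unfolding double_mollification_error_def by (rule nn_integral_cmult) measurable
  qed
  finally show ?thesis by (simp add: \<kappa>_def S_def v_def)
qed

end

section \<open>Comparison by letting the mollification radius shrink\<close>

lemma compact_image_bounded_above:
  fixes f :: "'a::topological_space \<Rightarrow> real"
  assumes "compact K" "continuous_on K f"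
  shows "\<exists>M. \<forall>z\<in>K. f z \<le> M"
proof -
  have "bdd_above (f ` K)"
    by (intro bounded_imp_bdd_above compact_imp_bounded compact_continuous_image assms)
  then show ?thesis by (auto simp: bdd_above_def)
qed

context parabolic_comparison
begin

text \<open>An excess above \<delta> at \<open>z0\<close> persists on a ball and bounds the left
  side of \<open>energy_bound\<close> from below, uniformly in the radius of mollification, whereas
  the right side becomes arbitrarily small.\<close>

theorem subsolution_le_supersolution:
  assumes z0: "z0 \<in> C" "snd z0 < \<tau>"
  shows "H z0 - w z0 \<le> \<delta>"
proof (rule ccontr)
  assume "\<not> H z0 - w z0 \<le> \<delta>"
  define m where "m = H z0 - w z0 - \<delta>"
  have m: "0 < m" using \<open>\<not> H z0 - w z0 \<le> \<delta>\<close> by (simp add: m_def)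
  obtain \<rho> where \<rho>: "0 < \<rho>" "(\<Union>x\<in>K. cball x \<rho>) \<subseteq> C"
    using compact_subset_open_imp_cball_epsilon_subset[OF K(1) C K(2)] by blast
  define K1 where "K1 = (\<Union>x\<in>K. cball x \<rho>)"
  \<comment> \<open>As a sum of two compact sets the closed neighbourhood is compact, so
    \<open>H\<close> is uniformly continuous on it.\<close>
  have "K1 = {x + y |x y. x \<in> K \<and> y \<in> cball 0 \<rho>}"
  proof (intro subset_antisym subsetI)
    fix z assume "z \<in> K1"
    then obtain x where "x \<in> K" "z \<in> cball x \<rho>" unfolding K1_def by blast
    then have "z = x + (z - x)" "x \<in> K" "z - x \<in> cball 0 \<rho>" by (simp_all add: dist_norm norm_minus_commute)
    then show "z \<in> {x + y |x y. x \<in> K \<and> y \<in> cball 0 \<rho>}" by blast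
  next
    fix z assume "z \<in> {x + y |x y. x \<in> K \<and> y \<in> cball 0 \<rho>}"
    then obtain x y where "z = x + y" "x \<in> K" "y \<in> cball 0 \<rho>" by blast
    then have "x \<in> K" "z \<in> cball x \<rho>" by (simp_all add: dist_norm)
    then show "z \<in> K1" unfolding K1_def by blast
  qed
  then have K1: "compact K1" using compact_sums[OF K(1) compact_cball[of 0 \<rho>]] by simp
  have "uniformly_continuous_on K1 H"
    using \<rho>(2) by (intro compact_uniformly_continuous K1 continuous_on_subset[OF H(2)]) (simp add: K1_def)
  \<comment> \<open>\<delta>/2 is the accuracy that \<open>energy_bound\<close> asks for; m/4
    preserves an excess of m/2 wherever \<open>H - w\<close> exceeds \<delta> + 3m/4.\<close>
  moreover have "0 < min (\<delta> / 2) (m / 4)" using \<delta> m by simp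
  ultimately obtain d where d: "0 < d"
    "\<And>y y'. y \<in> K1 \<Longrightarrow> y' \<in> K1 \<Longrightarrow> dist y' y < d \<Longrightarrow> dist (H y') (H y) < min (\<delta> / 2) (m / 4)"
    unfolding uniformly_continuous_on_def by metis
  define N where "N = (\<Union>x\<in>K. ball x (\<rho> / 2))"
  have N: "open N" "K \<subseteq> N" using \<rho>(1) by (auto simp: N_def intro!: bexI)
  have N_K1: "cball z \<epsilon> \<subseteq> K1" if "z \<in> N" "\<epsilon> \<le> \<rho> / 2" for z \<epsilon>
  proof
    fix y assume y: "y \<in> cball z \<epsilon>"
    from that obtain x where x: "x \<in> K" "dist x z < \<rho> / 2" by (auto simp: N_def)
    then have "dist x y \<le> \<rho>" using y that dist_triangle[of x y z] by simp
    then show "y \<in> K1" using x by (auto simp: K1_def)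
  qed
  have close: "\<bar>mollify J H z - H z\<bar> \<le> min (\<delta> / 2) (m / 4)"
    if "mollifier \<epsilon> J" "\<epsilon> \<le> d" "\<epsilon> \<le> \<rho> / 2" "z \<in> N" for J \<epsilon> z
  proof (rule mollify_close[OF that(1) H(1)])
    fix y assume y: "norm (y - z) < \<epsilon>"
    have "0 < \<epsilon>" using y norm_ge_zero[of "y - z"] by linarith
    then have "y \<in> K1" "z \<in> K1" using N_K1[OF that(4,3)] y by (auto simp: dist_norm norm_minus_commute)
    then have "dist (H y) (H z) < min (\<delta> / 2) (m / 4)" using d(2)[of z y] y that by (simp add: dist_norm)
    then show "\<bar>H y - H z\<bar> \<le> min (\<delta> / 2) (m / 4)" by (simp add: dist_real_def)
  qed
  have W_cont: "continuous_on K (\<lambda>z. norm (p_flux p (W z)))"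
    by (intro continuous_intros continuous_on_subset[OF cont(5) K(2)])
  obtain M0 where "\<forall>z\<in>K. norm (p_flux p (W z)) \<le> M0"
    using compact_image_bounded_above[OF K(1) W_cont] by blast
  then have M0: "norm (W z) powr (p - 1) \<le> M0" if "z \<in> K" for z
    using that unfolding norm_p_flux by blast
  \<comment> \<open>The bound is taken with \<open>H\<close> in place of its mollification, hence
    does not depend on the radius; the error of at most \<delta>/2 is absorbed by the subtracted
    \<delta>.\<close>
  have X_cont: "continuous_on K (\<lambda>z. 2 * pos_pow 2 (\<tau> - snd z) * pos_pow 1 (H z - w z))"
    by (intro continuous_intros continuous_on_subset[OF cont(1) K(2)] continuous_on_subset[OF H(2) K(2)])
  obtain X where X: "\<forall>z\<in>K. 2 * pos_pow 2 (\<tau> - snd z) * pos_pow 1 (H z - w z) \<le> X"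
    using compact_image_bounded_above[OF K(1) X_cont] by blast
  define g where "g z = H z - w z" for z
  have g: "continuous_on C g" unfolding g_def by (intro continuous_intros H cont)
  define B where "B = {z \<in> C. \<delta> + 3 * m / 4 < g z} \<inter> {z. snd z < (snd z0 + \<tau>) / 2}"
  have "open {z \<in> C. \<delta> + 3 * m / 4 < g z}"
    using continuous_open_preimage[OF g C open_greaterThan[of "\<delta> + 3 * m / 4"]]
    by (simp add: vimage_def Int_def)
  moreover have "open {z :: (real^'n) \<times> real. snd z < (snd z0 + \<tau>) / 2}"
    by (intro open_Collect_less continuous_intros)
  ultimately have "open B" unfolding B_def by blast
  moreover have "z0 \<in> B"
  proof -
    have "g z0 = \<delta> + m" by (simp add: g_def m_def)
    then show ?thesis using z0 m by (simp add: B_def)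
  qed
  ultimately obtain r where r: "0 < r" "ball z0 r \<subseteq> B" using open_contains_ball by blast
  \<comment> \<open>A lower bound for the integrand on the ball: there \<tau> - t is at least half
    its value at \<open>z0\<close>, and the mollified excess is at least m/2.\<close>
  define q where "q = 2 / 3 * pos_pow 1 ((\<tau> - snd z0) / 2) * pos_pow 3 (m / 2)"
  have q: "0 < q" using z0 m by (simp add: q_def pos_pow_def)
  have vol: "0 < measure lborel (ball z0 r)" using content_ball_pos[OF r(1), of z0] by simp
  \<comment> \<open>Makes 2 (|X| + 1) \<eta> equal to \<open>q\<close> times the volume of the ball,
    so that the upper bound |X| \<eta> falls strictly below the lower bound.\<close>
  define \<eta> where "\<eta> = q * measure lborel (ball z0 r) / (2 * (\<bar>X\<bar> + 1))"
  have \<eta>: "0 < \<eta>" unfolding \<eta>_def using q vol by (intro divide_pos_pos mult_pos_pos) auto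
  have "0 \<le> M0" using M0[of z0] superlevel[of z0] z0 m \<delta> order_trans[OF powr_ge_zero] by (simp add: m_def)
  obtain \<epsilon>0 where \<epsilon>0: "0 < \<epsilon>0" "\<And>\<epsilon> J. 0 < \<epsilon> \<Longrightarrow> \<epsilon> \<le> \<epsilon>0 \<Longrightarrow> mollifier \<epsilon> J \<Longrightarrow>
    double_mollification_error J K (\<lambda>y. norm (G y) powr (p - 1) + M0) G \<le> ennreal \<eta>"
    using double_mollification_error_small[OF p G(2,1) compact_imp_bounded[OF K(1)] _ \<open>0 \<le> M0\<close> \<eta>]
      borel_closed[OF compact_imp_closed[OF K(1)]] by blast
  define \<epsilon> where "\<epsilon> = min \<epsilon>0 (min d (\<rho> / 2))"
  have \<epsilon>: "0 < \<epsilon>" "\<epsilon> \<le> \<epsilon>0" "\<epsilon> \<le> d" "\<epsilon> \<le> \<rho> / 2" using \<epsilon>0(1) d(1) \<rho>(1) by (auto simp: \<epsilon>_def)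
  obtain J :: "(real^'n) \<times> real \<Rightarrow> real" where J: "mollifier \<epsilon> J" using mollifier_exists[OF \<epsilon>(1)] by blast
  note close = close[OF J \<epsilon>(3,4)]
  let ?f = "\<lambda>z. 2 / 3 * pos_pow 1 (\<tau> - snd z) * pos_pow 3 (mollify J H z - w z - \<delta>)"
  have "ennreal (\<integral>z. indicator K z * ?f z \<partial>lborel)
    \<le> ennreal X * double_mollification_error J K (\<lambda>y. norm (G y) powr (p - 1) + M0) G"
  proof (rule energy_bound[OF J N _ \<epsilon>(1) _ M0])
    show "cball z \<epsilon> \<subseteq> C" if "z \<in> N" for z using N_K1[OF that \<epsilon>(4)] \<rho>(2) by (simp add: K1_def)
    show "\<bar>mollify J H z - H z\<bar> \<le> \<delta> / 2" if "z \<in> N" for z using close[OF that] by simp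
    show "2 * pos_pow 2 (\<tau> - snd z) * pos_pow 1 (mollify J H z - w z - \<delta>) \<le> X" if "z \<in> K" for z
    proof -
      have "\<bar>mollify J H z - H z\<bar> \<le> \<delta> / 2" using close[of z] that N by auto
      then have "pos_pow 1 (mollify J H z - w z - \<delta>) \<le> pos_pow 1 (H z - w z)"
        using \<delta> by (intro pos_pow_mono) linarith
      then have "2 * pos_pow 2 (\<tau> - snd z) * pos_pow 1 (mollify J H z - w z - \<delta>)
        \<le> 2 * pos_pow 2 (\<tau> - snd z) * pos_pow 1 (H z - w z)" by (intro mult_left_mono) auto
      then show ?thesis using X that by force
    qed
  qed
  also have "\<dots> \<le> ennreal X * ennreal \<eta>" 
    by (rule mult_left_mono[OF \<epsilon>0(2)[OF \<epsilon>(1,2) J]]) simp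
  also have "\<dots> \<le> ennreal \<bar>X\<bar> * ennreal \<eta>" by (intro mult_right_mono ennreal_leI) auto
  also have "\<dots> = ennreal (\<bar>X\<bar> * \<eta>)" using \<eta> by (simp add: ennreal_mult)
  finally have "(\<integral>z. indicator K z * ?f z \<partial>lborel) \<le> \<bar>X\<bar> * \<eta>"
    using \<eta> by (subst (asm) ennreal_le_iff) auto
  also have "\<dots> < 2 * (\<bar>X\<bar> + 1) * \<eta>" using \<eta> by (intro mult_strict_right_mono) auto
  also have "\<dots> = q * measure lborel (ball z0 r)" by (simp add: \<eta>_def)
  also have "\<dots> = (\<integral>z. indicator (ball z0 r) z * q \<partial>lborel)"
    by (simp add: mult.commute)
  also have "\<dots> \<le> (\<integral>z. indicator K z * ?f z \<partial>lborel)"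
  proof (rule integral_mono)
    show "integrable lborel (\<lambda>z. indicator (ball z0 r) z * q)"
      using emeasure_bounded_finite[OF bounded_ball[of z0 r]]
      by (intro integrable_mult_left integrable_real_indicator) auto
    have "continuous_on K ?f"
      by (intro continuous_intros continuous_on_subset[OF cont(1) K(2)]
          continuous_on_subset[OF continuous_mollify[OF J H(1)] subset_UNIV])
    from borel_integrable_compact[OF K(1) this] show "integrable lborel (\<lambda>z. indicator K z * ?f z)" by simp
    fix z :: "(real^'n) \<times> real"
    show "indicator (ball z0 r) z * q \<le> indicator K z * ?f z"
    proof (cases "z \<in> ball z0 r")
      case True
      then have zB: "z \<in> C" "\<delta> + 3 * m / 4 < H z - w z" "snd z < (snd z0 + \<tau>) / 2"
        using r(2) by (auto simp: B_def g_def)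
      then have zK: "z \<in> K" using superlevel[of z] z0 m \<delta> by auto
      have cl: "\<bar>mollify J H z - H z\<bar> \<le> m / 4" using close[of z] zK N by auto
      have "pos_pow 1 ((\<tau> - snd z0) / 2) * pos_pow 3 (m / 2)
        \<le> pos_pow 1 (\<tau> - snd z) * pos_pow 3 (mollify J H z - w z - \<delta>)"
      proof (intro mult_mono pos_pow_mono)
        show "(\<tau> - snd z0) / 2 \<le> \<tau> - snd z" using zB(3) by (simp add: field_simps)
        show "m / 2 \<le> mollify J H z - w z - \<delta>" using zB(2) cl by linarith
      qed auto
      then show ?thesis using True zK by (simp add: q_def mult.commute)
    qed (simp add: indicator_def)
  qed
  finally show False by simp
qed

end

section \<open>Weak solutions\<close>

text \<open>A bridge from the restricted Lebesgue measures in the definition of weak solutions to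
  \<open>lborel\<close>, where Fubini and translations are available: \<open>g\<close> is a Borel
  version of \<open>f\<close> extended by zero.\<close>

lemma lebesgue_on_integral_eq_lborel:
  fixes f g :: "'a::euclidean_space \<Rightarrow> 'b::euclidean_space"
  assumes "U \<in> sets lebesgue" and g: "g \<in> borel_measurable borel"
    and ae: "AE x in lebesgue. indicator U x *\<^sub>R f x = g x"
  shows "integral\<^sup>L (lebesgue_on U) f = integral\<^sup>L lborel g"
proof -
  have g': "g \<in> borel_measurable lebesgue" using g by (simp add: measurable_completion)
  have "AE x in lebesgue. g x = indicator U x *\<^sub>R f x" using ae by (auto simp: eq_commute)
  then have f': "(\<lambda>x. indicator U x *\<^sub>R f x) \<in> borel_measurable lebesgue"
    by (rule borel_measurable_AE[OF g'])
  have "integral\<^sup>L (lebesgue_on U) f = (\<integral>x. indicator U x *\<^sub>R f x \<partial>lebesgue)"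
    using assms(1) by (intro integral_restrict_space) simp
  also have "\<dots> = integral\<^sup>L lebesgue g" by (rule integral_cong_AE[OF f' g' ae])
  also have "\<dots> = integral\<^sup>L lborel g" using g by (intro integral_completion) simp
  finally show ?thesis .
qed

text \<open>Fubini for null sets with time as the outer variable. The exceptional set is first
  enclosed in a Borel null set, since exchanging the two quantifiers requires measurability.\<close>

lemma AE_lborel_prod_commute:
  fixes P :: "'a::euclidean_space \<times> 'b::euclidean_space \<Rightarrow> bool"
  assumes "AE z in lborel. P z"
  shows "AE t in lborel. AE x in lborel. P (x, t)"
proof -
  obtain N where N: "{z \<in> space lborel. \<not> P z} \<subseteq> N" "emeasure lborel N = 0" "N \<in> sets lborel"
    by (rule AE_E[OF assms]) blast
  have N': "N \<in> sets (lborel \<Otimes>\<^sub>M lborel)" using N(3) by (simp only: lborel_prod)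
  have "AE z in lborel. z \<notin> N" using N(2,3) by (intro AE_not_in null_setsI)
  then have "AE z in lborel \<Otimes>\<^sub>M lborel. z \<notin> N" by (simp only: lborel_prod)
  from lborel_pair.AE_pair[OF this] have "AE x in lborel. AE t in lborel. (x, t) \<notin> N" .
  moreover have "{z \<in> space (lborel \<Otimes>\<^sub>M lborel). (fst z, snd z) \<notin> N} \<in> sets (lborel \<Otimes>\<^sub>M lborel)"
    using sets.compl_sets[OF N'] by (simp add: set_diff_eq)
  ultimately have "AE t in lborel. AE x in lborel. (x, t) \<notin> N"
    by (subst lborel_pair.AE_commute[symmetric]) auto
  moreover have "P z" if "z \<notin> N" for z using N(1) that by auto
  ultimately show ?thesis by (auto elim!: eventually_mono)
qed

text \<open>A weak gradient is only Lebesgue measurable, so its individual slices may fail to be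
  measurable; those of a Borel version are Borel.\<close>

lemma borel_representative:
  fixes G :: "'a::euclidean_space \<Rightarrow> real^'n"
  assumes C: "C \<in> sets borel" and G: "G \<in> borel_measurable (lebesgue_on C)"
  obtains G' where "G' \<in> borel_measurable borel" "\<And>z. z \<notin> C \<Longrightarrow> G' z = 0"
    "AE z in lborel. z \<in> C \<longrightarrow> G z = G' z"
proof -
  have "(\<lambda>z. indicator C z *\<^sub>R G z) \<in> borel_measurable lebesgue"
    using G C by (subst (asm) borel_measurable_restrict_space_iff) auto
  then have "(\<lambda>z. (indicator C z *\<^sub>R G z) $ i) \<in> borel_measurable lebesgue" for i
    by (rule measurable_compose[OF _ borel_measurable_continuous_onI]) (intro continuous_intros)
  then have "\<exists>g. g \<in> borel_measurable lborel \<and> (AE z in lborel. (indicator C z *\<^sub>R G z) $ i = g z)" for i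
    using completion_ex_borel_measurable_real by blast
  then obtain g where g: "\<And>i. g i \<in> borel_measurable lborel"
    "\<And>i. AE z in lborel. (indicator C z *\<^sub>R G z) $ i = g i z" by metis
  define G' where "G' z = indicator C z *\<^sub>R (\<chi> i. g i z)" for z
  have [measurable]: "g i \<in> borel_measurable borel" for i using g(1) by simp
  have "(\<lambda>z. indicator C z * g i z) \<in> borel_measurable borel" for i using C by measurable
  then have "G' \<in> borel_measurable borel"
    unfolding borel_measurable_euclidean_space[of G'] by (auto simp: G'_def Basis_vec_def inner_axis)
  moreover have "G' z = 0" if "z \<notin> C" for z using that by (simp add: G'_def)
  moreover have "AE z in lborel. \<forall>i\<in>UNIV. (indicator C z *\<^sub>R G z) $ i = g i z"
    using g(2) by (intro AE_finite_allI) auto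
  then have "AE z in lborel. z \<in> C \<longrightarrow> G z = G' z"
    by eventually_elim (auto simp: G'_def vec_eq_iff)
  ultimately show thesis by (rule that)
qed

section \<open>Derivatives and time slices of test functions\<close>

lemma test_function_derivative:
  fixes \<phi> :: "'a::euclidean_space \<Rightarrow> real"
  assumes "\<phi> \<in> test_functions S"
  shows "continuous_on UNIV \<phi>" "\<exists>M. \<forall>z. \<bar>\<phi> z\<bar> \<le> M"
    "(\<phi> has_derivative frechet_derivative \<phi> (at z)) (at z)"
    "continuous_on UNIV (\<lambda>z. frechet_derivative \<phi> (at z) v)"
    "\<exists>M. \<forall>z. \<bar>frechet_derivative \<phi> (at z) v\<bar> \<le> M"
proof -
  have Ck: "Ck k \<phi>" for k using assms by (simp add: test_functions_def)
  show cont: "continuous_on UNIV \<phi>" by (rule Ck_continuous[OF Ck])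
  show der: "(\<phi> has_derivative frechet_derivative \<phi> (at z)) (at z)" for z
    by (rule Ck_has_derivative[OF Ck])
  have "Ck (Suc 0) \<phi>" by (rule Ck)
  then show cont': "continuous_on UNIV (\<lambda>z. frechet_derivative \<phi> (at z) v)" by simp
  let ?K = "closure {z. \<phi> z \<noteq> 0}"
  have "compact ?K" using assms by (simp add: test_functions_def)
  then obtain r where r: "\<forall>z\<in>?K. norm z \<le> r" using compact_imp_bounded bounded_iff by blast
  have zero: "\<phi> z = 0" if "z \<notin> ?K" for z using that closure_subset[of "{z. \<phi> z \<noteq> 0}"] by auto
  then show "\<exists>M. \<forall>z. \<bar>\<phi> z\<bar> \<le> M"
    using r by (intro continuous_bounded_support_bounded[OF cont, of r]) (meson not_less)
  have "frechet_derivative \<phi> (at z) v = 0" if "r < norm z" for z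
  proof -
    have z: "z \<in> - ?K" using r that by (meson ComplI not_less)
    have "(\<phi> has_derivative (\<lambda>_. 0)) (at z)"
    proof (rule has_derivative_transform_within_open[OF _ _ z])
      show "((\<lambda>_. 0) has_derivative (\<lambda>_. 0)) (at z)" by simp
      show "open (- ?K)" by (rule open_Compl[OF closed_closure])
      show "0 = \<phi> x" if "x \<in> - ?K" for x using zero[OF ComplD[OF that]] by (rule sym)
    qed
    then show ?thesis using frechet_derivative_at by metis
  qed
  then show "\<exists>M. \<forall>z. \<bar>frechet_derivative \<phi> (at z) v\<bar> \<le> M"
    by (rule continuous_bounded_support_bounded[OF cont'])
qed

lemma test_function_slice:
  fixes \<phi> :: "(real^'n) \<times> real \<Rightarrow> real"
  assumes \<phi>: "\<phi> \<in> test_functions (U \<times> T)"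
  shows "(\<lambda>x. \<phi> (x, t)) \<in> test_functions U"
    "grad (\<lambda>x. \<phi> (x, t)) x = (\<chi> i. frechet_derivative \<phi> (at (x, t)) (ex i))"
    "deriv (\<lambda>s. \<phi> (x, s)) t = frechet_derivative \<phi> (at (x, t)) et"
proof -
  have bl: "bounded_linear (\<lambda>x::real^'n. (x, 0::real))" by (intro bounded_linear_Pair bounded_linear_ident bounded_linear_zero)
  have "Ck k (\<lambda>x. \<phi> (x, t))" for k
    using Ck_compose_affine[OF _ bl, of k \<phi> "(0, t)"] \<phi> by (simp add: test_functions_def)
  \<comment> \<open>The support of a slice lies in the projection of the whole support, which is
    compact and therefore closed.\<close>
  moreover have "closure {x. \<phi> (x, t) \<noteq> 0} \<subseteq> fst ` closure {z. \<phi> z \<noteq> 0}" (is "_ \<subseteq> fst ` ?K")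
  proof (rule closure_minimal)
    show "{x. \<phi> (x, t) \<noteq> 0} \<subseteq> fst ` ?K" using closure_subset by force
    show "closed (fst ` ?K)"
      using \<phi> by (intro compact_imp_closed compact_continuous_image continuous_intros) (simp add: test_functions_def)
  qed
  moreover have "compact (fst ` ?K)"
    using \<phi> by (intro compact_continuous_image continuous_intros) (simp add: test_functions_def)
  moreover have "fst ` ?K \<subseteq> U" using \<phi> by (auto simp: test_functions_def)
  ultimately show "(\<lambda>x. \<phi> (x, t)) \<in> test_functions U"
    by (auto simp: test_functions_def compact_eq_bounded_closed intro: bounded_subset)
  note der = test_function_derivative(3)[OF \<phi>, of "(x, t)"]
  have "((\<lambda>x. (x, t)) has_derivative (\<lambda>v. (v, 0))) (at x)" by (auto intro!: derivative_eq_intros)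
  from has_derivative_compose[OF this der]
  have "frechet_derivative (\<lambda>x. \<phi> (x, t)) (at x) = (\<lambda>v. frechet_derivative \<phi> (at (x, t)) (v, 0))"
    using frechet_derivative_at by metis
  then show "grad (\<lambda>x. \<phi> (x, t)) x = (\<chi> i. frechet_derivative \<phi> (at (x, t)) (ex i))"
    by (simp add: grad_def)
  have "((\<lambda>s. (x, s)) has_derivative (\<lambda>v. (0, v))) (at t)" by (auto intro!: derivative_eq_intros)
  from has_derivative_compose[OF this der]
  have "((\<lambda>s. \<phi> (x, s)) has_derivative (\<lambda>v. frechet_derivative \<phi> (at (x, t)) (0, v))) (at t)" .
  moreover have "(\<lambda>v. frechet_derivative \<phi> (at (x, t)) (0, v)) = (*) (frechet_derivative \<phi> (at (x, t)) et)"
  proof (rule ext)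
    fix v :: real
    show "frechet_derivative \<phi> (at (x, t)) (0, v) = frechet_derivative \<phi> (at (x, t)) et * v"
      using linear_scale[OF has_derivative_linear[OF der], of v et] by (simp add: mult.commute)
  qed
  ultimately have "((\<lambda>s. \<phi> (x, s)) has_real_derivative frechet_derivative \<phi> (at (x, t)) et) (at t)"
    unfolding has_field_derivative_def by (simp only:)
  then show "deriv (\<lambda>s. \<phi> (x, s)) t = frechet_derivative \<phi> (at (x, t)) et" by (rule DERIV_imp_deriv)
qed

lemma integrable_bounded_scaleR:
  fixes f :: "'a \<Rightarrow> 'b::euclidean_space"
  assumes "integrable M f" "g \<in> borel_measurable M" "\<And>z. \<bar>g z\<bar> \<le> B"
  shows "integrable M (\<lambda>z. g z *\<^sub>R f z)"
proof (rule Bochner_Integration.integrable_bound)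
  show "integrable M (\<lambda>z. B * norm (f z))" using assms(1) by simp
  show "(\<lambda>z. g z *\<^sub>R f z) \<in> borel_measurable M" using assms(1,2) by measurable
  have "\<bar>g z\<bar> * norm (f z) \<le> \<bar>B\<bar> * norm (f z)" for z
    using assms(3)[of z] by (intro mult_right_mono) auto
  then show "AE z in M. norm (g z *\<^sub>R f z) \<le> norm (B * norm (f z))" by (simp add: abs_mult)
qed

text \<open>Converts the slicewise and iterated integrals of the definition into integrals over the
  whole space, in exactly the form that the locale \<open>parabolic_comparison\<close>
  assumes.\<close>

lemma weak_solution_borel_data:
  fixes h :: "(real^'n) \<times> real \<Rightarrow> real"
  assumes p: "1 < p" and U: "open U"
    and bd: "compact (closure (U \<times> {s1<..<s2}))" and h: "continuous_on (closure (U \<times> {s1<..<s2})) h"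
    and W: "parabolic_W1p_with_grad p U s1 s2 h G"
    and eq: "\<And>\<phi>. \<phi> \<in> test_functions (U \<times> {s1<..<s2}) \<Longrightarrow>
             (LINT t|lebesgue_on {s1<..<s2}. LINT x|lebesgue_on U.
                (norm (G (x, t)) powr (p - 2) *\<^sub>R G (x, t)) \<bullet> grad (\<lambda>y. \<phi> (y, t)) x)
           - (LINT t|lebesgue_on {s1<..<s2}. LINT x|lebesgue_on U. h (x, t) * deriv (\<lambda>s. \<phi> (x, s)) t) = 0"
  defines "C \<equiv> U \<times> {s1<..<s2}" and "H \<equiv> \<lambda>z. indicator (U \<times> {s1<..<s2}) z * h z"
  shows "integrable lborel H \<and> (\<exists>G'. integrable lborel G' \<and> integrable lborel (\<lambda>z. norm (G' z) powr p) \<and>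
      integrable lborel (\<lambda>z. p_flux p (G' z)) \<and>
      (\<forall>\<phi>\<in>test_functions C. \<forall>i.
        (\<integral>y. frechet_derivative \<phi> (at y) (ex i) * H y \<partial>lborel) = - (\<integral>y. \<phi> y * G' y $ i \<partial>lborel)) \<and>
      (\<forall>\<phi>\<in>test_functions C.
        (\<Sum>i\<in>UNIV. \<integral>y. frechet_derivative \<phi> (at y) (ex i) * p_flux p (G' y) $ i \<partial>lborel)
          = (\<integral>y. frechet_derivative \<phi> (at y) et * H y \<partial>lborel)))"
proof -
  let ?T = "{s1<..<s2}"
  have C: "open C" unfolding C_def using U by (intro open_Times) auto
  then have C_borel[measurable]: "C \<in> sets borel" by simp
  have "bounded C" unfolding C_def using bounded_subset[OF compact_imp_bounded[OF bd] closure_subset] .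
  then have C_int: "integrable lborel (indicator C :: _ \<Rightarrow> real)"
    using emeasure_bounded_finite[of C] C_borel by (intro integrable_real_indicator) auto
  have H_int: "integrable lborel H"
  proof -
    have "integrable lborel (\<lambda>z. indicator C z *\<^sub>R (indicator (closure C) z *\<^sub>R h z))"
      using integrable_mult_indicator[OF _ borel_integrable_compact[OF bd h], of C] C_borel by (simp add: C_def)
    also have "(\<lambda>z. indicator C z *\<^sub>R (indicator (closure C) z *\<^sub>R h z)) = H"
      using closure_subset[of C] by (auto simp: H_def C_def[symmetric] fun_eq_iff indicator_def)
    finally show ?thesis .
  qed
  have G_meas: "G \<in> borel_measurable (lebesgue_on C)" and Gp: "integrable (lebesgue_on C) (\<lambda>z. norm (G z) powr p)"
    using W by (auto simp: parabolic_W1p_with_grad_def Lq_def C_def)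
  obtain G' where G'[measurable]: "G' \<in> borel_measurable borel" and G'0: "\<And>z. z \<notin> C \<Longrightarrow> G' z = 0"
    and G'_eq: "AE z in lborel. z \<in> C \<longrightarrow> G z = G' z"
    using borel_representative[OF C_borel G_meas] by blast
  have G'_p: "integrable lborel (\<lambda>z. norm (G' z) powr p)"
  proof -
    have int: "integrable lebesgue (\<lambda>z. indicator C z *\<^sub>R (norm (G z) powr p))"
      using Gp C_borel by (subst (asm) integrable_restrict_space) auto
    have "AE z in lebesgue. indicator C z *\<^sub>R (norm (G z) powr p) = norm (G' z) powr p"
      using AE_completion[OF G'_eq] by eventually_elim (use p G'0 in \<open>auto simp: indicator_def\<close>)
    then have "integrable lebesgue (\<lambda>z. norm (G' z) powr p)"
      by (rule integrable_cong_AE_imp[OF int, rotated]) (auto intro: measurable_completion)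
    then show ?thesis by (subst (asm) integrable_completion) auto
  qed
  have dom: "integrable lborel (\<lambda>z. indicator C z + norm (G' z) powr p)"
    using C_int G'_p by simp
  \<comment> \<open>As \<open>C\<close> is bounded, these two inequalities make both the gradient
    and its flux integrable.\<close>
  have pw: "a \<le> 1 + a powr p" "a powr (p - 1) \<le> 1 + a powr p" if "0 \<le> a" for a :: real
  proof -
    have "a \<le> 1 + a powr p \<and> a powr (p - 1) \<le> 1 + a powr p"
    proof (cases "a \<le> 1")
      case True
      then have "a powr (p - 1) \<le> 1" using that p powr_mono2[of "p - 1" a 1] by simp
      then show ?thesis using True powr_ge_zero[of a p] by linarith
    next
      case False
      then have "a powr 1 \<le> a powr p" "a powr (p - 1) \<le> a powr p"
        using p powr_mono[of 1 p a] powr_mono[of "p - 1" p a] by simp_all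
      moreover have "a powr 1 = a" using that by simp
      ultimately show ?thesis by (intro conjI) linarith+
    qed
    then show "a \<le> 1 + a powr p" "a powr (p - 1) \<le> 1 + a powr p" by auto
  qed
  have G'_int: "integrable lborel G'"
    by (rule Bochner_Integration.integrable_bound[OF dom])
      (use pw(1) G'0 in \<open>auto simp: indicator_def intro!: AE_I2\<close>)
  have [measurable]: "(\<lambda>z. p_flux p (G' z)) \<in> borel_measurable borel" unfolding p_flux_def by measurable
  have flux_int: "integrable lborel (\<lambda>z. p_flux p (G' z))"
    by (rule Bochner_Integration.integrable_bound[OF dom])
      (use pw(2) G'0 p in \<open>auto simp: indicator_def norm_p_flux intro!: AE_I2\<close>)
  have slices: "AE t in lborel. AE x in lebesgue. (x, t) \<in> C \<longrightarrow> G (x, t) = G' (x, t)"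
    using AE_lborel_prod_commute[OF G'_eq] by eventually_elim (rule AE_completion)
  have U_leb: "U \<in> sets lebesgue" using U by auto
  have T_leb: "?T \<in> sets lebesgue" by auto
  have W_t: "AE t in lborel. t \<in> ?T \<longrightarrow> W1p_with_grad p U (\<lambda>x. h (x, t)) (\<lambda>x. G (x, t))"
    using W T_leb unfolding parabolic_W1p_with_grad_def by (simp add: AE_restrict_space_iff AE_completion_iff)
  let ?grad = "\<lambda>\<phi> z. \<chi> i. frechet_derivative \<phi> (at z) (ex i)"
  have grad_bd: "continuous_on UNIV (?grad \<phi>)" "\<exists>B. \<forall>z. norm (?grad \<phi> z) \<le> B" if "\<phi> \<in> test_functions C" for \<phi>
  proof -
    show "continuous_on UNIV (?grad \<phi>)"
      by (intro continuous_on_vec_lambda test_function_derivative(4)[OF that])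
    have "\<forall>i. \<exists>B. \<forall>z. \<bar>frechet_derivative \<phi> (at z) (ex i)\<bar> \<le> B"
      using test_function_derivative(5)[OF that] by blast
    then obtain B where B: "\<And>i z. \<bar>frechet_derivative \<phi> (at z) (ex i)\<bar> \<le> B i"
      by metis
    have "norm (?grad \<phi> z) \<le> (\<Sum>i\<in>UNIV. B i)" for z
      by (rule order_trans[OF norm_le_l1_cart]) (auto intro!: sum_mono B)
    then show "\<exists>B. \<forall>z. norm (?grad \<phi> z) \<le> B" by blast
  qed
  have weak_grad: "(\<integral>y. frechet_derivative \<phi> (at y) (ex i) * H y \<partial>lborel) = - (\<integral>y. \<phi> y * G' y $ i \<partial>lborel)"
    if \<phi>: "\<phi> \<in> test_functions C" for \<phi> i
  proof -
    let ?F1 = "\<lambda>z. H z *\<^sub>R ?grad \<phi> z" and ?F2 = "\<lambda>z. \<phi> z *\<^sub>R G' z"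
    have [measurable]: "\<phi> \<in> borel_measurable borel" "?grad \<phi> \<in> borel_measurable borel" "H \<in> borel_measurable borel"
      using test_function_derivative(1)[OF \<phi>] grad_bd(1)[OF \<phi>] H_int by (auto intro: borel_measurable_continuous_onI)
    obtain B where B: "\<And>z. norm (?grad \<phi> z) \<le> B" using grad_bd(2)[OF \<phi>] by blast
    obtain B' where B': "\<And>z. \<bar>\<phi> z\<bar> \<le> B'" using test_function_derivative(2)[OF \<phi>] by blast
    have F1: "integrable lborel ?F1"
    proof (rule Bochner_Integration.integrable_bound)
      show "integrable lborel (\<lambda>z. B * \<bar>H z\<bar>)" using H_int by simp
      have "\<bar>H z\<bar> * norm (?grad \<phi> z) \<le> \<bar>H z\<bar> * \<bar>B\<bar>" for z
        using B[of z] by (intro mult_left_mono) auto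
      then show "AE z in lborel. norm (?F1 z) \<le> norm (B * \<bar>H z\<bar>)" by (simp add: abs_mult mult.commute)
    qed measurable
    have F2: "integrable lborel ?F2"
      by (rule integrable_bounded_scaleR[OF G'_int _ B']) measurable
    \<comment> \<open>The spatial gradient is given one time slice at a time: test it with the
      slices of \<phi>, then integrate over time.\<close>
    have "AE t in lborel. (\<integral>x. ?F1 (x, t) \<partial>lborel) = - (\<integral>x. ?F2 (x, t) \<partial>lborel)"
      using slices W_t
    proof eventually_elim
      case (elim t)
      show ?case
      proof (cases "t \<in> ?T")
        case False
        then have z: "?F1 (x, t) = 0" "?F2 (x, t) = 0" for x using G'0[of "(x, t)"] by (auto simp: H_def C_def)
        show ?thesis by (simp only: z Bochner_Integration.integral_zero minus_zero)
      next
        case True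
        have "(LINT x|lebesgue_on U. h (x, t) *\<^sub>R grad (\<lambda>x. \<phi> (x, t)) x) = (\<integral>x. ?F1 (x, t) \<partial>lborel)"
        proof (rule lebesgue_on_integral_eq_lborel[OF U_leb])
          show "(\<lambda>x. ?F1 (x, t)) \<in> borel_measurable borel" by measurable
          show "AE x in lebesgue. indicator U x *\<^sub>R h (x, t) *\<^sub>R grad (\<lambda>x. \<phi> (x, t)) x = ?F1 (x, t)"
            using True by (intro AE_I2) (simp add: H_def indicator_def test_function_slice(2)[OF \<phi>[unfolded C_def]])
        qed
        moreover have "(LINT x|lebesgue_on U. \<phi> (x, t) *\<^sub>R G (x, t)) = (\<integral>x. ?F2 (x, t) \<partial>lborel)"
        proof (rule lebesgue_on_integral_eq_lborel[OF U_leb])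
          show "AE x in lebesgue. indicator U x *\<^sub>R \<phi> (x, t) *\<^sub>R G (x, t) = ?F2 (x, t)"
            using elim(1)
          proof eventually_elim
            case (elim x)
            show ?case
            proof (cases "x \<in> U")
              case True
              then have "G (x, t) = G' (x, t)" using elim \<open>t \<in> ?T\<close> by (simp add: C_def)
              then show ?thesis using True by simp
            next
              case False
              then have "G' (x, t) = 0" by (intro G'0) (simp add: C_def)
              then show ?thesis using False by simp
            qed
          qed
          show "(\<lambda>x. ?F2 (x, t)) \<in> borel_measurable borel" by measurable
        qed
        ultimately show ?thesis
          using elim(2) True test_function_slice(1)[OF \<phi>[unfolded C_def]]
          unfolding W1p_with_grad_def by simp
      qed
    qed
    moreover have F1': "integrable (lborel \<Otimes>\<^sub>M lborel) (case_prod (\<lambda>x t. ?F1 (x, t)))"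
      and F2': "integrable (lborel \<Otimes>\<^sub>M lborel) (case_prod (\<lambda>x t. ?F2 (x, t)))"
      using F1 F2 by (simp_all only: lborel_prod case_prod_eta[of ?F1] case_prod_eta[of ?F2])
    ultimately have "(\<integral>t. \<integral>x. ?F1 (x, t) \<partial>lborel \<partial>lborel) = (\<integral>t. - (\<integral>x. ?F2 (x, t) \<partial>lborel) \<partial>lborel)"
      using lborel_pair.integrable_snd[OF F1'] lborel_pair.integrable_snd[OF F2'] by (intro integral_cong_AE) auto
    then have "integral\<^sup>L lborel ?F1 = - integral\<^sup>L lborel ?F2"
      using lborel_pair.integral_snd[OF F1'] lborel_pair.integral_snd[OF F2']
      by (simp only: lborel_prod case_prod_eta[of ?F1] case_prod_eta[of ?F2] Bochner_Integration.integral_minus)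
    then have "integral\<^sup>L lborel ?F1 $ i = - (integral\<^sup>L lborel ?F2 $ i)" by simp
    then show ?thesis
      using integral_bounded_linear[OF bounded_linear_vec_nth[of i] F1] integral_bounded_linear[OF bounded_linear_vec_nth[of i] F2]
      by (simp add: mult.commute)
  qed
  have weak_eq: "(\<Sum>i\<in>UNIV. \<integral>y. frechet_derivative \<phi> (at y) (ex i) * p_flux p (G' y) $ i \<partial>lborel)
          = (\<integral>y. frechet_derivative \<phi> (at y) et * H y \<partial>lborel)" if \<phi>: "\<phi> \<in> test_functions C" for \<phi>
  proof -
    let ?Dt = "\<lambda>z. frechet_derivative \<phi> (at z) et"
    let ?F1 = "\<lambda>z. p_flux p (G' z) \<bullet> ?grad \<phi> z" and ?F2 = "\<lambda>z. H z * ?Dt z"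
    have [measurable]: "?grad \<phi> \<in> borel_measurable borel" "H \<in> borel_measurable borel" "?Dt \<in> borel_measurable borel"
      using grad_bd(1)[OF \<phi>] H_int test_function_derivative(4)[OF \<phi>] by (auto intro: borel_measurable_continuous_onI)
    have Di[measurable]: "(\<lambda>z. frechet_derivative \<phi> (at z) (ex i)) \<in> borel_measurable borel" for i
      using test_function_derivative(4)[OF \<phi>] by (auto intro: borel_measurable_continuous_onI)
    have F1i: "integrable lborel (\<lambda>z. frechet_derivative \<phi> (at z) (ex i) * p_flux p (G' z) $ i)" for i
    proof -
      obtain B where B: "\<And>z. \<bar>frechet_derivative \<phi> (at z) (ex i)\<bar> \<le> B" using test_function_derivative(5)[OF \<phi>] by blast
      show ?thesis
        using integrable_bounded_scaleR[OF integrable_bounded_linear[OF bounded_linear_vec_nth[of i] flux_int] _ B] Di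
        by simp
    qed
    have F1_eq: "?F1 = (\<lambda>z. \<Sum>i\<in>UNIV. frechet_derivative \<phi> (at z) (ex i) * p_flux p (G' z) $ i)"
      by (simp add: inner_vec_def mult.commute)
    have F1: "integrable lborel ?F1" unfolding F1_eq using F1i by (intro Bochner_Integration.integrable_sum)
    obtain B' where B': "\<And>z. \<bar>?Dt z\<bar> \<le> B'" using test_function_derivative(5)[OF \<phi>] by blast
    have F2: "integrable lborel ?F2"
      using integrable_bounded_scaleR[OF H_int _ B'] by (simp add: mult.commute)
    have F1': "integrable (lborel \<Otimes>\<^sub>M lborel) (case_prod (\<lambda>x t. ?F1 (x, t)))"
      and F2': "integrable (lborel \<Otimes>\<^sub>M lborel) (case_prod (\<lambda>x t. ?F2 (x, t)))"
      using F1 F2 by (simp_all only: lborel_prod case_prod_eta[of ?F1] case_prod_eta[of ?F2])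
    have "(LINT t|lebesgue_on ?T. LINT x|lebesgue_on U.
                (norm (G (x, t)) powr (p - 2) *\<^sub>R G (x, t)) \<bullet> grad (\<lambda>y. \<phi> (y, t)) x)
      = (\<integral>t. \<integral>x. ?F1 (x, t) \<partial>lborel \<partial>lborel)"
    proof (rule lebesgue_on_integral_eq_lborel[OF T_leb])
      show "(\<lambda>t. \<integral>x. ?F1 (x, t) \<partial>lborel) \<in> borel_measurable borel"
        using lborel_pair.integrable_snd[OF F1'] by auto
      show "AE t in lebesgue. indicator ?T t *\<^sub>R (LINT x|lebesgue_on U.
                (norm (G (x, t)) powr (p - 2) *\<^sub>R G (x, t)) \<bullet> grad (\<lambda>y. \<phi> (y, t)) x) = (\<integral>x. ?F1 (x, t) \<partial>lborel)"
        using AE_completion[OF slices]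
      proof eventually_elim
        case (elim t)
        show ?case
        proof (cases "t \<in> ?T")
          case False
          then have z: "?F1 (x, t) = 0" for x using G'0[of "(x, t)"] by (simp add: C_def p_flux_def)
          show ?thesis using False by (simp only: z Bochner_Integration.integral_zero) simp
        next
          case True
          have "(LINT x|lebesgue_on U. (norm (G (x, t)) powr (p - 2) *\<^sub>R G (x, t)) \<bullet> grad (\<lambda>y. \<phi> (y, t)) x)
            = (\<integral>x. ?F1 (x, t) \<partial>lborel)"
          proof (rule lebesgue_on_integral_eq_lborel[OF U_leb])
            show "AE x in lebesgue. indicator U x *\<^sub>R ((norm (G (x, t)) powr (p - 2) *\<^sub>R G (x, t)) \<bullet> grad (\<lambda>y. \<phi> (y, t)) x) = ?F1 (x, t)"
              using elim
            proof eventually_elim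
              case (elim x)
              show ?case
              proof (cases "x \<in> U")
                case True
                then have "G (x, t) = G' (x, t)" using elim \<open>t \<in> ?T\<close> by (simp add: C_def)
                then show ?thesis
                  using True by (simp add: p_flux_def test_function_slice(2)[OF \<phi>[unfolded C_def]])
              next
                case False
                then have "G' (x, t) = 0" by (intro G'0) (simp add: C_def)
                then show ?thesis using False by (simp add: p_flux_def)
              qed
            qed
            show "(\<lambda>x. ?F1 (x, t)) \<in> borel_measurable borel" by measurable
          qed
          then show ?thesis using True by simp
        qed
      qed
    qed
    moreover have "(LINT t|lebesgue_on ?T. LINT x|lebesgue_on U. h (x, t) * deriv (\<lambda>s. \<phi> (x, s)) t)
      = (\<integral>t. \<integral>x. ?F2 (x, t) \<partial>lborel \<partial>lborel)"
    proof (rule lebesgue_on_integral_eq_lborel[OF T_leb])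
      show "(\<lambda>t. \<integral>x. ?F2 (x, t) \<partial>lborel) \<in> borel_measurable borel"
        using lborel_pair.integrable_snd[OF F2'] by auto
      show "AE t in lebesgue. indicator ?T t *\<^sub>R (LINT x|lebesgue_on U. h (x, t) * deriv (\<lambda>s. \<phi> (x, s)) t)
          = (\<integral>x. ?F2 (x, t) \<partial>lborel)"
      proof (rule AE_I2)
        fix t
        show "indicator ?T t *\<^sub>R (LINT x|lebesgue_on U. h (x, t) * deriv (\<lambda>s. \<phi> (x, s)) t)
          = (\<integral>x. ?F2 (x, t) \<partial>lborel)"
        proof (cases "t \<in> ?T")
          case False
          then have z: "?F2 (x, t) = 0" for x by (simp add: H_def)
          show ?thesis using False by (simp only: z Bochner_Integration.integral_zero) simp
        next
          case True
          have "(LINT x|lebesgue_on U. h (x, t) * deriv (\<lambda>s. \<phi> (x, s)) t) = (\<integral>x. ?F2 (x, t) \<partial>lborel)"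
          proof (rule lebesgue_on_integral_eq_lborel[OF U_leb])
            show "(\<lambda>x. ?F2 (x, t)) \<in> borel_measurable borel" by measurable
            show "AE x in lebesgue. indicator U x *\<^sub>R (h (x, t) * deriv (\<lambda>s. \<phi> (x, s)) t) = ?F2 (x, t)"
              using True by (intro AE_I2) (simp add: H_def indicator_def test_function_slice(3)[OF \<phi>[unfolded C_def]])
          qed
          then show ?thesis using True by simp
        qed
      qed
    qed
    ultimately have "integral\<^sup>L lborel ?F1 = integral\<^sup>L lborel ?F2"
      using eq[OF \<phi>[unfolded C_def]] lborel_pair.integral_snd[OF F1'] lborel_pair.integral_snd[OF F2']
      by (simp only: lborel_prod case_prod_eta[of ?F1] case_prod_eta[of ?F2] right_minus_eq)
    then show ?thesis using F1i unfolding F1_eq by (simp add: mult.commute)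
  qed
  show ?thesis by (intro conjI exI[of _ G'] ballI allI H_int G'_int G'_p flux_int weak_grad weak_eq)
qed

section \<open>The barrier\<close>

lemma has_dderiv_norm_powr:
  fixes z :: "(real^'n) \<times> real"
  assumes "fst z \<noteq> 0"
  shows "has_dderiv (\<lambda>z. norm (fst z) powr r) (ex i) (r * norm (fst z) powr (r - 2) * fst z $ i) z"
proof -
  \<comment> \<open>Written as a power of an inner product, the function is a power of a quadratic
    polynomial along each line.\<close>
  have norm_eq: "norm y powr s = (y \<bullet> y) powr (s / 2)" for y :: "real^'n" and s
    by (simp add: norm_eq_sqrt_inner powr_half_sqrt[symmetric] powr_powr)
  have "((\<lambda>s. (fst z + s *\<^sub>R axis i 1) \<bullet> (fst z + s *\<^sub>R axis i 1)) has_real_derivative 2 * fst z $ i) (at 0)"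
  proof -
    have "(\<lambda>s. (fst z + s *\<^sub>R axis i 1) \<bullet> (fst z + s *\<^sub>R axis i 1))
      = (\<lambda>s::real. fst z \<bullet> fst z + s * (2 * fst z $ i) + s * s)"
      by (auto simp: inner_add_left inner_add_right inner_axis inner_axis' algebra_simps)
    moreover have "((\<lambda>s::real. fst z \<bullet> fst z + s * (2 * fst z $ i) + s * s) has_real_derivative 2 * fst z $ i) (at 0)"
      by (auto intro!: derivative_eq_intros)
    ultimately show ?thesis by simp
  qed
  moreover have "((\<lambda>u. u powr (r / 2)) has_real_derivative r / 2 * (fst z \<bullet> fst z) powr (r / 2 - 1))
      (at ((fst z + 0 *\<^sub>R axis i 1) \<bullet> (fst z + 0 *\<^sub>R axis i 1)))"
    using assms has_real_derivative_powr[of "fst z \<bullet> fst z" "r / 2"] by simp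
  ultimately have "((\<lambda>s. ((fst z + s *\<^sub>R axis i 1) \<bullet> (fst z + s *\<^sub>R axis i 1)) powr (r / 2)) has_real_derivative
      r / 2 * (fst z \<bullet> fst z) powr (r / 2 - 1) * (2 * fst z $ i)) (at 0)"
    by (intro DERIV_chain2[where f = "\<lambda>u. u powr (r / 2)" and g = "\<lambda>s. (fst z + s *\<^sub>R axis i 1) \<bullet> (fst z + s *\<^sub>R axis i 1)"])
  moreover have "r / 2 * (fst z \<bullet> fst z) powr (r / 2 - 1) * (2 * fst z $ i) = r * norm (fst z) powr (r - 2) * fst z $ i"
    by (simp add: norm_eq diff_divide_distrib)
  moreover have "(\<lambda>s. norm (fst (z + s *\<^sub>R ex i)) powr r)
      = (\<lambda>s. ((fst z + s *\<^sub>R axis i 1) \<bullet> (fst z + s *\<^sub>R axis i 1)) powr (r / 2))"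
    by (simp add: norm_eq)
  ultimately show ?thesis unfolding has_dderiv_def by (simp only:)
qed

lemma has_dderiv_nth: "has_dderiv (\<lambda>z. fst z $ j) (ex i) (if i = j then 1 else 0) z"
  unfolding has_dderiv_def by (auto intro!: derivative_eq_intros simp: axis_def)

lemma has_dderiv_add:
  "has_dderiv f e f' z \<Longrightarrow> has_dderiv g e g' z \<Longrightarrow> has_dderiv (\<lambda>z. f z + g z) e (f' + g') z"
  unfolding has_dderiv_def by (auto intro!: derivative_eq_intros)

lemma has_dderiv_fst_const: "has_dderiv (\<lambda>z. g (fst z)) (0, s) 0 z"
  unfolding has_dderiv_def by simp

lemma has_dderiv_snd_const: "has_dderiv (\<lambda>z. g (snd z)) (v, 0) 0 z"
  unfolding has_dderiv_def by simp

lemma has_dderiv_snd_real: "(g has_real_derivative d) (at (snd z)) \<Longrightarrow> has_dderiv (\<lambda>z. g (snd z)) (0, 1) d z"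
  unfolding has_dderiv_def using DERIV_shift[of g d "snd z" 0]
  by (simp add: DERIV_def add.commute)

section \<open>The barrier, its flux, and comparison on boxes\<close>

definition barrier :: "real \<Rightarrow> real \<Rightarrow> real \<Rightarrow> real \<Rightarrow> (real^'n) \<times> real \<Rightarrow> real" where
  "barrier c a b e z = c * (- snd z) powr a * norm (fst z) powr (- b) + e / (- snd z)"

definition barrier_grad :: "real \<Rightarrow> real \<Rightarrow> real \<Rightarrow> (real^'n) \<times> real \<Rightarrow> real^'n" where
  "barrier_grad c a b z = (- (b * c) * (- snd z) powr a * norm (fst z) powr (- b - 2)) *\<^sub>R fst z"

text \<open>The gradient is radial of length b c (-t)^a |x|^(-b-1), so its flux has length of order
  |x|^(-(b+1)(p-1)); the additional 1 in the exponent normalises the factor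
  \<open>fst z\<close>.\<close>

lemma p_flux_barrier_grad:
  assumes "0 < b" "0 < c" "fst z \<noteq> 0"
  shows "p_flux p (barrier_grad c a b z)
    = (- ((b * c) powr (p - 1)) * (- snd z) powr (a * (p - 1)) * norm (fst z) powr (- ((b + 1) * (p - 1) + 1))) *\<^sub>R fst z"
proof -
  let ?r = "norm (fst z)" and ?t = "(- snd z) powr a"
  have r: "0 < ?r" using assms by simp
  have "norm (barrier_grad c a b z) = b * c * ?t * (?r powr (- b - 2) * ?r)"
    using assms by (simp add: barrier_grad_def abs_mult)
  also have "?r powr (- b - 2) * ?r = ?r powr (- b - 1)"
  proof -
    have "?r * ?r powr (- b - 2) = ?r powr (1 + (- b - 2))" by (rule powr_mult_base) simp
    also have "1 + (- b - 2) = - b - 1" by simp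
    finally show ?thesis by (simp only: mult.commute)
  qed
  finally have norm: "norm (barrier_grad c a b z) = (b * c) * ?t * ?r powr (- b - 1)" .
  have "norm (barrier_grad c a b z) powr (p - 2) = (b * c) powr (p - 2) * ?t powr (p - 2) * ?r powr ((- b - 1) * (p - 2))"
    unfolding norm using assms by (simp add: powr_mult powr_powr)
  then have "p_flux p (barrier_grad c a b z)
    = (- (((b * c) powr (p - 2) * (b * c)) * (?t powr (p - 2) * ?t) * (?r powr ((- b - 1) * (p - 2)) * ?r powr (- b - 2)))) *\<^sub>R fst z"
    unfolding p_flux_def by (simp add: barrier_grad_def mult_ac)
  also have "(b * c) powr (p - 2) * (b * c) = (b * c) powr (p - 1)"
    using powr_mult_base[of "b * c" "p - 2"] assms by (simp add: mult.commute)
  also have "?t powr (p - 2) * ?t = (- snd z) powr (a * (p - 1))"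
    using powr_mult_base[of ?t "p - 2"] by (simp add: powr_powr mult.commute)
  also have "?r powr ((- b - 1) * (p - 2)) * ?r powr (- b - 2) = ?r powr (- ((b + 1) * (p - 1) + 1))"
    by (simp add: powr_add[symmetric] algebra_simps)
  finally show ?thesis by simp
qed

text \<open>The weak equation is available only in cylinders compactly inside the open box. This
  suffices: stopping at a time \<tau> after \<open>z0\<close> but before \<open>t2\<close>, the set
  where \<open>h - w\<close> is at least \<delta>/2 is compact and misses the boundary, so a
  slightly smaller cylinder contains it.\<close>

lemma p_parabolic_le_supersolution:
  fixes a b :: "real^'n" and h w wt :: "(real^'n) \<times> real \<Rightarrow> real" and W :: "(real^'n) \<times> real \<Rightarrow> real^'n"
  assumes p: "1 < p" 
    and h: "p_parabolic p (box a b \<times> {t1<..<t2}) h" "continuous_on (closure (box a b \<times> {t1<..<t2})) h"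
    and sub: "closure (box a b \<times> {t1<..<t2}) \<subseteq> D"
    and w_x: "\<And>z i. z \<in> D \<Longrightarrow> has_dderiv w (ex i) (W z $ i) z"
    and w_t: "\<And>z. z \<in> D \<Longrightarrow> has_dderiv w et (wt z) z"
    and W_x: "\<And>z i. z \<in> D \<Longrightarrow> has_dderiv (\<lambda>z. p_flux p (W z) $ i) (ex i) (dF i z) z"
    and cont: "continuous_on D w" "continuous_on D wt" "continuous_on D W" "\<And>i. continuous_on D (dF i)"
      "continuous_on D (\<lambda>z. p_flux p (W z))"
    and super: "\<And>z. z \<in> D \<Longrightarrow> (\<Sum>i\<in>UNIV. dF i z) \<le> wt z"
    and boundary: "\<And>z. z \<in> parabolic_boundary (box a b) t1 t2 \<Longrightarrow> h z \<le> w z"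
    and z0: "z0 \<in> box a b \<times> {t1<..<t2}"
  shows "h z0 \<le> w z0"
proof (rule ccontr)
  let ?Q = "box a b \<times> {t1<..<t2}"
  assume "\<not> h z0 \<le> w z0"
  \<comment> \<open>Half of the supposed excess at \<open>z0\<close>, so that the conclusion
    \<open>h z0 - w z0 \<le> \<delta>\<close> is absurd.\<close>
  define \<delta> where "\<delta> = (h z0 - w z0) / 2"
  define \<tau> where "\<tau> = (snd z0 + t2) / 2"
  have \<delta>: "0 < \<delta>" using \<open>\<not> h z0 \<le> w z0\<close> by (simp add: \<delta>_def)
  have \<tau>: "snd z0 < \<tau>" "\<tau> < t2" using z0 by (auto simp: \<tau>_def)
  have ne: "box a b \<noteq> {}" "t1 < t2" using z0 by auto
  have cl: "closure ?Q = cbox a b \<times> {t1..t2}" using ne by (simp add: closure_Times closure_box)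
  have comp: "compact (closure ?Q)" unfolding cl by (intro compact_Times) auto
  define K where "K = {z \<in> closure ?Q. \<delta> / 2 \<le> h z - w z} \<inter> {z. snd z \<le> \<tau>}"
  have diff_cont: "continuous_on (closure ?Q) (\<lambda>z. h z - w z)"
    by (intro continuous_intros h continuous_on_subset[OF cont(1) sub])
  have "closed {z \<in> closure ?Q. \<delta> / 2 \<le> h z - w z}"
    using continuous_closed_preimage[OF diff_cont closed_closure closed_atLeast[of "\<delta> / 2"]]
    by (simp add: vimage_def Int_def)
  moreover have "closed {z :: (real^'n) \<times> real. snd z \<le> \<tau>}"
    by (intro closed_Collect_le continuous_intros)
  ultimately have "compact K" unfolding K_def
    by (intro compact_Int_closed) (auto simp: compact_eq_bounded_closed intro: bounded_subset[OF compact_imp_bounded[OF comp]])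
  \<comment> \<open>A point of the closed box before \<open>t2\<close> that is not in the open box
    lies on the parabolic boundary, where h - w \<le> 0 < \<delta>/2.\<close>
  have K_Q: "K \<subseteq> ?Q"
  proof
    fix z assume z: "z \<in> K"
    obtain x t where xt: "z = (x, t)" by (cases z)
    have "z \<notin> parabolic_boundary (box a b) t1 t2"
      using boundary[of z] z \<delta> by (auto simp: K_def)
    moreover have "x \<in> cbox a b" "t1 \<le> t" "t \<le> t2" "t \<le> \<tau>" using z by (auto simp: K_def cl xt)
    moreover have "frontier (box a b) = cbox a b - box a b" "closure (box a b) = cbox a b"
      by (simp_all only: frontier_def closure_box[OF ne(1)] interior_open[OF open_box])
    ultimately show "z \<in> ?Q" using \<tau> unfolding parabolic_boundary_def xt
      by (auto simp: less_le)
  qed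
  have z0_K: "z0 \<in> K" using z0 closure_subset[of ?Q] \<delta> \<tau> by (auto simp: K_def \<delta>_def)
  have "open ?Q" by (intro open_Times) auto
  from compact_subset_open_imp_cball_epsilon_subset[OF \<open>compact K\<close> this K_Q]
  obtain \<rho> where \<rho>: "0 < \<rho>" "(\<Union>x\<in>K. cball x \<rho>) \<subseteq> ?Q" by blast
  let ?one = "(\<chi> i. 1) :: real^'n"
  \<comment> \<open>Balls of radius \<rho> around points of \<open>K\<close> stay in the box, so a
    margin of \<rho>/2 at the sides, and in \<open>s1\<close> at the bottom, keeps \<open>K\<close>
    inside the smaller cylinder.\<close>
  define U where "U = box (a + (\<rho> / 2) *\<^sub>R ?one) (b - (\<rho> / 2) *\<^sub>R ?one)"
  define s1 where "s1 = t1 + \<rho> / 2"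
  \<comment> \<open>\<open>K\<close> ends at time \<tau>, so any time strictly between \<tau> and
    \<open>t2\<close> can serve as the top.\<close>
  define s2 where "s2 = (\<tau> + t2) / 2"
  have U: "open U" unfolding U_def by (rule open_box)
  have K_C: "K \<subseteq> U \<times> {s1<..<s2}"
  proof
    fix z assume z: "z \<in> K"
    obtain x t where xt: "z = (x, t)" by (cases z)
    have in_Q: "y \<in> ?Q" if "norm (y - z) \<le> \<rho>" for y
    proof -
      have "y \<in> cball z \<rho>" using that by (simp add: dist_norm norm_minus_commute)
      then show ?thesis using \<rho>(2) z by blast
    qed
    have "a $ i + \<rho> / 2 < x $ i" "x $ i < b $ i - \<rho> / 2" for i
    proof -
      have "(x + \<rho> *\<^sub>R axis i 1, t) \<in> ?Q" "(x - \<rho> *\<^sub>R axis i 1, t) \<in> ?Q"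
        by (rule in_Q; use \<rho>(1) in \<open>simp add: xt norm_Pair norm_axis_1\<close>)+
      then have "x + \<rho> *\<^sub>R axis i 1 \<in> box a b" "x - \<rho> *\<^sub>R axis i 1 \<in> box a b"
        by blast+
      then have "(x + \<rho> *\<^sub>R axis i 1) $ i < b $ i" "a $ i < (x - \<rho> *\<^sub>R axis i 1) $ i"
        unfolding mem_box_cart by blast+
      then show "a $ i + \<rho> / 2 < x $ i" "x $ i < b $ i - \<rho> / 2" using \<rho>(1) by auto
    qed
    moreover have "s1 < t"
    proof -
      have "(x, t - \<rho>) \<in> ?Q" by (rule in_Q) (use \<rho>(1) in \<open>simp add: xt norm_Pair\<close>)
      then show ?thesis using \<rho>(1) by (auto simp: s1_def)
    qed
    moreover have "t < s2" using z \<tau> by (auto simp: K_def s2_def xt)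
    ultimately show "z \<in> U \<times> {s1<..<s2}" by (auto simp: U_def mem_box_cart xt)
  qed
  let ?C = "U \<times> {s1<..<s2}"
  have s: "s1 < s2" using K_C z0_K by auto
  have "closure ?C \<subseteq> cbox (a + (\<rho> / 2) *\<^sub>R ?one) (b - (\<rho> / 2) *\<^sub>R ?one) \<times> {s1..s2}"
    unfolding U_def by (intro closure_minimal closed_Times Sigma_mono box_subset_cbox) auto
  also have "\<dots> \<subseteq> ?Q"
  proof (rule Sigma_mono)
    show "cbox (a + (\<rho> / 2) *\<^sub>R ?one) (b - (\<rho> / 2) *\<^sub>R ?one) \<subseteq> box a b"
    proof
      fix y assume "y \<in> cbox (a + (\<rho> / 2) *\<^sub>R ?one) (b - (\<rho> / 2) *\<^sub>R ?one)"
      then have y: "a $ i + \<rho> / 2 \<le> y $ i \<and> y $ i \<le> b $ i - \<rho> / 2" for i by (simp add: mem_box_cart)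
      show "y \<in> box a b" unfolding mem_box_cart
      proof
        fix i show "a $ i < y $ i \<and> y $ i < b $ i" using y[of i] \<rho>(1) by linarith
      qed
    qed
    show "{s1..s2} \<subseteq> {t1<..<t2}" using \<rho>(1) \<tau> by (auto simp: s1_def s2_def)
  qed
  finally have C_Q: "closure ?C \<subseteq> ?Q" .
  have C_Q': "closure ?C \<subseteq> closure ?Q" using C_Q closure_subset by blast
  have C_comp: "compact (closure ?C)"
    using bounded_subset[OF compact_imp_bounded[OF comp] C_Q'] by (simp add: compact_eq_bounded_closed)
  have C_D: "?C \<subseteq> D" using closure_subset[of ?C] C_Q' sub by blast
  have h_C: "continuous_on (closure ?C) h" by (rule continuous_on_subset[OF h(2) C_Q'])
  have "weak_solution p ?Q (\<lambda>z. ereal (h z))" using h(1) by (simp add: p_parabolic_def)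
  note ws = this[unfolded weak_solution_def compactly_inside_def, THEN spec, of U, THEN spec, of s1, THEN spec, of s2, THEN mp]
  obtain G where W: "parabolic_W1p_with_grad p U s1 s2 h G"
    and eq: "\<forall>\<phi>\<in>test_functions ?C.
             (LINT t|lebesgue_on {s1<..<s2}. LINT x|lebesgue_on U.
                (norm (G (x, t)) powr (p - 2) *\<^sub>R G (x, t)) \<bullet> grad (\<lambda>y. \<phi> (y, t)) x)
           - (LINT t|lebesgue_on {s1<..<s2}. LINT x|lebesgue_on U. h (x, t) * deriv (\<lambda>s. \<phi> (x, s)) t) = 0"
    using conjunct2[OF conjunct2[OF ws]] U s C_comp C_Q by (simp only: real_of_ereal.simps) blast
  note eq' = bspec[OF eq]
  note data = weak_solution_borel_data[OF p U C_comp h_C W eq']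
  obtain G' where G': "integrable lborel G'" "integrable lborel (\<lambda>z. norm (G' z) powr p)"
      "integrable lborel (\<lambda>z. p_flux p (G' z))"
      "\<forall>\<phi>\<in>test_functions ?C. \<forall>i.
        (\<integral>y. frechet_derivative \<phi> (at y) (ex i) * (indicator ?C y * h y) \<partial>lborel) = - (\<integral>y. \<phi> y * G' y $ i \<partial>lborel)"
      "\<forall>\<phi>\<in>test_functions ?C.
        (\<Sum>i\<in>UNIV. \<integral>y. frechet_derivative \<phi> (at y) (ex i) * p_flux p (G' y) $ i \<partial>lborel)
          = (\<integral>y. frechet_derivative \<phi> (at y) et * (indicator ?C y * h y) \<partial>lborel)"
    using conjunct2[OF data] by blast
  interpret parabolic_comparison p \<delta> \<tau> ?C K "\<lambda>z. indicator ?C z * h z" w wt G' W dF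
  proof
    show "continuous_on ?C (\<lambda>z. indicator ?C z * h z)"
      by (rule continuous_on_eq[OF continuous_on_subset[OF h_C closure_subset]]) simp
    show "z \<in> K" if "z \<in> ?C" "snd z \<le> \<tau>" "\<delta> / 2 \<le> indicator ?C z * h z - w z" for z
      using that C_Q' closure_subset[of ?C] unfolding K_def by auto
    show "integrable lborel (\<lambda>z. indicator ?C z * h z)" using data by blast
    show "integrable lborel G'" "integrable lborel (\<lambda>z. norm (G' z) powr p)"
      "integrable lborel (\<lambda>z. p_flux p (G' z))" using G'(1-3) by blast+
    show "open ?C" by (intro open_Times U open_greaterThanLessThan)
    show "continuous_on ?C w" "continuous_on ?C wt" "continuous_on ?C W"
      "continuous_on ?C (\<lambda>z. p_flux p (W z))" "\<And>i. continuous_on ?C (dF i)"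
      by (rule continuous_on_subset[OF _ C_D], rule cont)+
    fix z assume "z \<in> ?C"
    then have "z \<in> D" using C_D by blast
    then show "has_dderiv w (ex i) (W z $ i) z" "has_dderiv w et (wt z) z"
      "has_dderiv (\<lambda>z. p_flux p (W z) $ i) (ex i) (dF i z) z" "(\<Sum>i\<in>UNIV. dF i z) \<le> wt z" for i
      using w_x w_t W_x super by blast+
  next
    fix \<phi> assume "\<phi> \<in> test_functions ?C"
    then show "(\<integral>y. frechet_derivative \<phi> (at y) (ex i) * (indicator ?C y * h y) \<partial>lborel) = - (\<integral>y. \<phi> y * G' y $ i \<partial>lborel)"
      "(\<Sum>i\<in>UNIV. \<integral>y. frechet_derivative \<phi> (at y) (ex i) * p_flux p (G' y) $ i \<partial>lborel)
          = (\<integral>y. frechet_derivative \<phi> (at y) et * (indicator ?C y * h y) \<partial>lborel)" for i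
      using G'(4,5) by blast+
  qed (fact p \<delta> \<open>compact K\<close> K_C)+
  have "indicator ?C z0 * h z0 - w z0 \<le> \<delta>"
    using z0_K K_C \<tau> by (intro subsolution_le_supersolution) auto
  then show False using z0_K K_C \<delta> by (auto simp: \<delta>_def)
qed

section \<open>Derivatives of the barrier and the supersolution inequality\<close>

lemma barrier_has_dderiv_t:
  assumes "snd z < 0"
  shows "has_dderiv (barrier c a b e) et
    (- (c * a * (- snd z) powr (a - 1) * norm (fst z) powr (- b)) + e / (snd z)\<^sup>2) z"
proof -
  have "((\<lambda>t. (- t) powr a) has_real_derivative a * (- snd z) powr (a - 1) * (- 1)) (at (snd z))"
    by (rule DERIV_chain2[OF has_real_derivative_powr]) (use assms in \<open>auto intro!: derivative_eq_intros\<close>)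
  then have p1: "has_dderiv (\<lambda>z. (- snd z) powr a) et (a * (- snd z) powr (a - 1) * (- 1)) z"
    by (rule has_dderiv_snd_real)
  have "((\<lambda>t. e / (- t)) has_real_derivative e / (snd z)\<^sup>2) (at (snd z))"
    using assms by (auto intro!: derivative_eq_intros simp: power2_eq_square)
  then have p2: "has_dderiv (\<lambda>z. e / (- snd z)) et (e / (snd z)\<^sup>2) z"
    by (rule has_dderiv_snd_real)
  from has_dderiv_add[OF has_dderiv_mult[OF has_dderiv_mult[OF has_dderiv_const[of c] p1]
        has_dderiv_fst_const[of "\<lambda>x. norm x powr (- b)" 1]] p2]
  show ?thesis by (simp add: barrier_def[abs_def] mult_ac)
qed

lemma barrier_has_dderiv_x:
  assumes "fst z \<noteq> 0"
  shows "has_dderiv (barrier c a b e) (ex i) (barrier_grad c a b z $ i) z"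
proof -
  from has_dderiv_add[OF has_dderiv_mult[OF has_dderiv_snd_const[of "\<lambda>t. c * (- t) powr a" "axis i 1"]
        has_dderiv_norm_powr[OF assms, of "- b" i]] has_dderiv_snd_const[of "\<lambda>t. e / (- t)" "axis i 1"]]
  show ?thesis by (simp add: barrier_def[abs_def] barrier_grad_def mult_ac)
qed

lemma radial_field_has_dderiv:
  fixes z :: "(real^'n) \<times> real"
  assumes "fst z \<noteq> 0"
  shows "has_dderiv (\<lambda>z. ((- k * (- snd z) powr \<alpha> * norm (fst z) powr (- \<beta>)) *\<^sub>R fst z) $ i) (ex i)
    (- k * (- snd z) powr \<alpha> * (norm (fst z) powr (- \<beta>) - \<beta> * norm (fst z) powr (- \<beta> - 2) * (fst z $ i)\<^sup>2)) z"
proof -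
  from has_dderiv_mult[OF has_dderiv_mult[OF has_dderiv_snd_const[of "\<lambda>t. - k * (- t) powr \<alpha>" "axis i 1"]
        has_dderiv_norm_powr[OF assms, of "- \<beta>" i]] has_dderiv_nth[of i i]]
  show ?thesis by (simp add: algebra_simps power2_eq_square)
qed

text \<open>The summands are the diagonal derivatives of the field |x|^(-\<beta>) x, so this
  computes its divergence.\<close>

lemma radial_field_divergence:
  fixes x :: "real^'n"
  assumes "x \<noteq> 0"
  shows "(\<Sum>i\<in>UNIV. norm x powr (- \<beta>) - \<beta> * norm x powr (- \<beta> - 2) * (x $ i)\<^sup>2) = (real CARD('n) - \<beta>) * norm x powr (- \<beta>)"
proof -
  have "(\<Sum>i\<in>UNIV. (x $ i)\<^sup>2) = (norm x)\<^sup>2"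
    unfolding power2_norm_eq_inner inner_vec_def by (simp add: power2_eq_square)
  moreover have "norm x powr (- \<beta> - 2) * (norm x)\<^sup>2 = norm x powr (- \<beta>)"
    using assms by (simp add: powr_diff powr_numeral)
  ultimately show ?thesis
    by (simp add: sum_subtractf sum_distrib_left[symmetric] mult.assoc left_diff_distrib)
qed

lemma powr_le_max_exponent:
  fixes r :: real
  assumes "0 < r" "r < 1" "b \<le> \<beta>"
  shows "r powr (- b) \<le> r powr (- \<beta>)"
  using assms by (intro powr_mono') auto

text \<open>Removing the axis and positive times keeps all powers smooth, and |x| < 1 makes a more
  negative power of |x| the larger one.\<close>

definition slab :: "((real^'n) \<times> real) set" where
  "slab = {z. fst z \<noteq> 0 \<and> norm (fst z) < 1 \<and> snd z < 0}"

lemma barrier_superparabolic: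
  fixes D :: "((real^'n) \<times> real) set"
  assumes p: "1 < p" "p < 2" and b: "0 < b" "b * (2 - p) \<le> p" and c: "0 < c" and e: "0 \<le> e" 
    and a: "a = 1 / (2 - p)"
    and supersol: "c * a \<le> (b * c) powr (p - 1) * (real CARD('n) - ((b + 1) * (p - 1) + 1))"
    and D: "D \<subseteq> slab"
  shows "p_superparabolic p D (\<lambda>z. ereal (barrier c a b e z))"
proof -
  define \<beta> where "\<beta> = (b + 1) * (p - 1) + 1"
  define k where "k = (b * c) powr (p - 1)"
  define \<alpha> where "\<alpha> = a * (p - 1)"
  define dF where "dF i z = - k * (- snd z) powr \<alpha> * (norm (fst z) powr (- \<beta>) - \<beta> * norm (fst z) powr (- \<beta> - 2) * (fst z $ i)\<^sup>2)"
    for i :: 'n and z :: "(real^'n) \<times> real"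
  define wt where "wt z = - (c * a * (- snd z) powr (a - 1) * norm (fst z) powr (- b)) + e / (snd z)\<^sup>2"
    for z :: "(real^'n) \<times> real"
  have flux: "p_flux p (barrier_grad c a b z) = (- k * (- snd z) powr \<alpha> * norm (fst z) powr (- \<beta>)) *\<^sub>R fst z"
    if "z \<in> slab" for z :: "(real^'n) \<times> real"
    using p_flux_barrier_grad[OF b(1) c, of z p a] that by (simp add: slab_def k_def \<alpha>_def \<beta>_def)
  have open_slab: "open (slab :: ((real^'n) \<times> real) set)"
    unfolding slab_def by (intro open_Collect_conj open_Collect_neq open_Collect_less continuous_intros)
  have cont: "continuous_on slab (barrier c a b e)" "continuous_on slab wt" "continuous_on slab (barrier_grad c a b)"
    "continuous_on slab (dF i)" for i
    unfolding barrier_def wt_def barrier_grad_def dF_def slab_def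
    by (intro continuous_intros; auto)+
  have "continuous_on slab (\<lambda>z::(real^'n) \<times> real. (- k * (- snd z) powr \<alpha> * norm (fst z) powr (- \<beta>)) *\<^sub>R fst z)"
    unfolding slab_def by (intro continuous_intros) auto
  then have cont_flux: "continuous_on slab (\<lambda>z::(real^'n) \<times> real. p_flux p (barrier_grad c a b z))"
    by (rule continuous_on_eq) (simp add: flux)
  have flux_x: "has_dderiv (\<lambda>z. p_flux p (barrier_grad c a b z) $ i) (ex i) (dF i z) z" if "z \<in> slab" for i z
    by (rule has_dderiv_transform_open[OF _ open_slab that, of "\<lambda>z. ((- k * (- snd z) powr \<alpha> * norm (fst z) powr (- \<beta>)) *\<^sub>R fst z) $ i"])
      (use radial_field_has_dderiv[of z k \<alpha> \<beta> i] that flux in \<open>simp_all add: slab_def dF_def\<close>)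
  have super: "(\<Sum>i\<in>UNIV. dF i z) \<le> wt z" if z: "z \<in> slab" for z
  proof -
    have r: "0 < norm (fst z)" "norm (fst z) < 1" "snd z < 0" using z by (auto simp: slab_def)
    have "a - 1 = \<alpha>" using p by (simp add: a \<alpha>_def field_simps)
    \<comment> \<open>Indeed \<beta> - b = p - b(2-p).\<close>
    have "b \<le> \<beta>" using b by (simp add: \<beta>_def algebra_simps)
    then have rb: "norm (fst z) powr (- b) \<le> norm (fst z) powr (- \<beta>)" by (rule powr_le_max_exponent[OF r(1,2)])
    have "0 \<le> c * a" using c a p by simp
    have "c * a * norm (fst z) powr (- b) \<le> k * (real CARD('n) - \<beta>) * norm (fst z) powr (- \<beta>)"
    proof (rule mult_mono[OF _ rb])
      show "c * a \<le> k * (real CARD('n) - \<beta>)" using supersol by (simp add: k_def \<beta>_def)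
      then show "0 \<le> k * (real CARD('n) - \<beta>)" using \<open>0 \<le> c * a\<close> by linarith
    qed simp
    then have "(- snd z) powr \<alpha> * (c * a * norm (fst z) powr (- b)) \<le> (- snd z) powr \<alpha> * (k * (real CARD('n) - \<beta>) * norm (fst z) powr (- \<beta>))"
      by (intro mult_left_mono) auto
    moreover have "(\<Sum>i\<in>UNIV. dF i z) = - k * (- snd z) powr \<alpha> * ((real CARD('n) - \<beta>) * norm (fst z) powr (- \<beta>))"
      unfolding dF_def sum_distrib_left[symmetric] using r radial_field_divergence[of "fst z" \<beta>] by simp
    moreover have "0 \<le> e / (snd z)\<^sup>2" using e by simp
    ultimately show ?thesis unfolding wt_def \<open>a - 1 = \<alpha>\<close> by (simp add: mult_ac)
  qed
  have w_x: "has_dderiv (barrier c a b e) (ex i) (barrier_grad c a b z $ i) z" if "z \<in> slab" for i and z :: "(real^'n) \<times> real"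
    using that by (intro barrier_has_dderiv_x) (simp add: slab_def)
  have w_t: "has_dderiv (barrier c a b e) et (wt z) z" if "z \<in> slab" for z
    using that unfolding wt_def by (intro barrier_has_dderiv_t) (simp add: slab_def)
  show ?thesis unfolding p_superparabolic_def
  proof (intro conjI allI)
    show "\<forall>z\<in>D. ereal (barrier c a b e z) \<noteq> - \<infinity>" by simp
    show "lower_semicontinuous_on D (\<lambda>z. ereal (barrier c a b e z))"
      unfolding lower_semicontinuous_on_def
    proof
      fix z assume "z \<in> D"
      have "((\<lambda>z. ereal (barrier c a b e z)) \<longlongrightarrow> ereal (barrier c a b e z)) (at z within D)"
        using continuous_on_subset[OF cont(1) D] \<open>z \<in> D\<close> by (simp add: continuous_on_def)
      then show "ereal (barrier c a b e z) \<le> Liminf (at z within D) (\<lambda>z. ereal (barrier c a b e z))"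
        by (auto simp: le_Liminf_iff intro: order_tendstoD)
    qed
    show "D \<subseteq> closure {z \<in> D. \<bar>ereal (barrier c a b e z)\<bar> \<noteq> \<infinity>}"
      using closure_subset by simp
  next
    fix a' b' :: "real^'n" and t1 t2 h
    show "let Q = box a' b' in
        (\<forall>i. a' $ i < b' $ i) \<and> t1 < t2 \<and> compactly_inside (Q \<times> {t1<..<t2}) D \<and>
        p_parabolic p (Q \<times> {t1<..<t2}) h \<and> continuous_on (closure (Q \<times> {t1<..<t2})) h \<and>
        (\<forall>z\<in>parabolic_boundary Q t1 t2. ereal (h z) \<le> ereal (barrier c a b e z)) \<longrightarrow>
        (\<forall>z\<in>Q \<times> {t1<..<t2}. ereal (h z) \<le> ereal (barrier c a b e z))"
      unfolding Let_def
    proof (intro impI ballI)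
      fix z
      assume asm: "(\<forall>i. a' $ i < b' $ i) \<and> t1 < t2 \<and> compactly_inside (box a' b' \<times> {t1<..<t2}) D \<and>
        p_parabolic p (box a' b' \<times> {t1<..<t2}) h \<and> continuous_on (closure (box a' b' \<times> {t1<..<t2})) h \<and>
        (\<forall>z\<in>parabolic_boundary (box a' b') t1 t2. ereal (h z) \<le> ereal (barrier c a b e z))"
        and z: "z \<in> box a' b' \<times> {t1<..<t2}"
      then have "closure (box a' b' \<times> {t1<..<t2}) \<subseteq> slab" using D by (auto simp: compactly_inside_def)
      moreover have "h z \<le> barrier c a b e z" if "z \<in> parabolic_boundary (box a' b') t1 t2" for z
        using asm that by auto
      ultimately have "h z \<le> barrier c a b e z"
        using asm p(1)
        by (intro p_parabolic_le_supersolution[where D = slab and w = "barrier c a b e",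
              OF _ _ _ _ w_x w_t flux_x cont(1,2,3) _ cont_flux super _ z]) (auto intro: cont(4))
      then show "ereal (h z) \<le> ereal (barrier c a b e z)" by simp
    qed
  qed
qed

section \<open>Irregularity of the origin\<close>

lemma power_domain_iff:
  "z \<in> power_domain l \<theta> \<longleftrightarrow> 0 < - snd z \<and> - snd z < \<theta> * norm (fst z) powr l \<and> \<theta> * norm (fst z) powr l < \<theta>"
  by (cases z) (simp add: power_domain_def)

text \<open>Continuity at x = 0 is where the positivity of \<open>l\<close> enters.\<close>

lemma continuous_on_norm_powr:
  assumes "0 < l"
  shows "continuous_on UNIV (\<lambda>z::(real^'n) \<times> real. \<theta> * norm (fst z) powr l)"
  using assms by (intro continuous_intros continuous_on_powr') auto

lemma open_power_domain:
  assumes "0 < l"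
  shows "open (power_domain l \<theta> :: ((real^'n) \<times> real) set)"
proof -
  have "(power_domain l \<theta> :: ((real^'n) \<times> real) set)
    = {z. 0 < - snd z \<and> - snd z < \<theta> * norm (fst z) powr l \<and> \<theta> * norm (fst z) powr l < \<theta>}"
    using power_domain_iff by blast
  also have "open \<dots>"
    by (intro open_Collect_conj open_Collect_less continuous_intros continuous_on_norm_powr assms)
  finally show ?thesis .
qed

lemma power_domain_subset_slab:
  assumes "0 < l" "0 < \<theta>"
  shows "power_domain l \<theta> \<subseteq> (slab :: ((real^'n) \<times> real) set)"
proof
  fix z :: "(real^'n) \<times> real" assume z: "z \<in> power_domain l \<theta>"
  have "norm (fst z) < 1"
  proof (rule ccontr)
    assume "\<not> norm (fst z) < 1"
    then have "1 \<le> norm (fst z) powr l" using assms by (intro ge_one_powr_ge_zero) auto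
    then show False using z assms by (simp add: power_domain_iff)
  qed
  moreover have "fst z \<noteq> 0" using z by (auto simp: power_domain_iff)
  ultimately show "z \<in> slab" using z by (simp add: slab_def power_domain_iff)
qed

lemma closure_power_domain:
  assumes "0 < l" "0 < \<theta>" "z \<in> closure (power_domain l \<theta> :: ((real^'n) \<times> real) set)"
  shows "snd z \<le> 0" "- snd z \<le> \<theta> * norm (fst z) powr l" "norm (fst z) \<le> 1"
proof -
  have "closed {z :: (real^'n) \<times> real. snd z \<le> 0 \<and> - snd z \<le> \<theta> * norm (fst z) powr l \<and> norm (fst z) \<le> 1}"
    by (intro closed_Collect_conj closed_Collect_le continuous_intros continuous_on_norm_powr assms)
  moreover have "power_domain l \<theta> \<subseteq> {z :: (real^'n) \<times> real. snd z \<le> 0 \<and> - snd z \<le> \<theta> * norm (fst z) powr l \<and> norm (fst z) \<le> 1}"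
    using power_domain_subset_slab[OF assms(1,2)] by (auto simp: slab_def power_domain_iff)
  ultimately have "closure (power_domain l \<theta>) \<subseteq> {z :: (real^'n) \<times> real. snd z \<le> 0 \<and> - snd z \<le> \<theta> * norm (fst z) powr l \<and> norm (fst z) \<le> 1}"
    by (intro closure_minimal)
  with assms(3) show "snd z \<le> 0" "- snd z \<le> \<theta> * norm (fst z) powr l" "norm (fst z) \<le> 1" by auto
qed

lemma barrier_on_paraboloid:
  fixes r \<theta> :: real
  assumes "0 < r" "0 < \<theta>" "b = l * a"
  shows "c * (\<theta> * r powr l) powr a * r powr (- b) = c * \<theta> powr a"
proof -
  have "(\<theta> * r powr l) powr a = \<theta> powr a * r powr (l * a)"
    using assms by (subst powr_mult) (auto simp: powr_powr)
  moreover have "r powr (l * a) * r powr (- b) = 1"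
    using assms by (simp add: powr_add[symmetric])
  ultimately show ?thesis by (simp add: mult.assoc)
qed

text \<open>Three kinds of boundary points: where t = 0, including the origin, the term e / (-t)
  exceeds \<open>m\<close> nearby; where |x| = 1 the boundary function is 0; at the remaining ones
  the main term alone is at least \<open>m\<close>, the maximum of the boundary function.\<close>

lemma barrier_upper_class:
  fixes c a b l \<theta> e :: real
  defines "m \<equiv> c * \<theta> powr a"
  assumes super: "p_superparabolic p (power_domain l \<theta>) (\<lambda>z::(real^'n) \<times> real. ereal (barrier c a b e z))"
    and l: "0 < l" and \<theta>: "0 < \<theta>" and c: "0 < c" and a: "0 < a" and b: "b = l * a" and e: "0 < e"
  shows "(\<lambda>z. ereal (barrier c a b e z)) \<in> upper_class p (power_domain l \<theta>) (\<lambda>z::(real^'n) \<times> real. m * (1 - norm (fst z)))"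
  unfolding upper_class_def
proof (intro CollectI conjI super ballI)
  let ?D = "power_domain l \<theta> :: ((real^'n) \<times> real) set"
  let ?f = "\<lambda>z::(real^'n) \<times> real. m * (1 - norm (fst z))"
  fix \<xi> :: "(real^'n) \<times> real" assume "\<xi> \<in> frontier ?D"
  then have \<xi>: "\<xi> \<in> closure ?D" "\<xi> \<notin> ?D"
    using interior_open[OF open_power_domain[OF l]] by (auto simp: frontier_def)
  note cl = closure_power_domain[OF l \<theta> \<xi>(1)]
  have m: "0 < m" using c \<theta> by (simp add: m_def)
  have "eventually (\<lambda>z. y < ereal (barrier c a b e z)) (at \<xi> within ?D)" if y: "y < ereal (?f \<xi>)" for y
  proof (cases "snd \<xi> = 0")
    case True
    \<comment> \<open>Within the domain, -t < e/m means e / (-t) > m.\<close>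
    have "open {z :: (real^'n) \<times> real. - snd z < e / m}"
      by (intro open_Collect_less continuous_intros)
    moreover have "\<xi> \<in> {z. - snd z < e / m}" using True e m by simp
    ultimately have "eventually (\<lambda>z. - snd z < e / m) (nhds \<xi>)"
      by (auto simp: eventually_nhds)
    then have "eventually (\<lambda>z. z \<in> ?D \<longrightarrow> - snd z < e / m) (at \<xi>)"
      by (auto simp: eventually_at_filter elim: eventually_mono)
    moreover have "y < ereal (barrier c a b e z)" if "z \<in> ?D" "- snd z < e / m" for z
    proof -
      have "0 < - snd z" using that by (simp add: power_domain_iff)
      then have "m < e / (- snd z)" using that m by (simp add: field_simps)
      also have "\<dots> \<le> barrier c a b e z" using c by (simp add: barrier_def)
      finally have "m < barrier c a b e z" .
      moreover have "?f \<xi> \<le> m" using m by simp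
      ultimately have "?f \<xi> < barrier c a b e z" by linarith
      then show ?thesis using y by (meson ereal_less_eq(3) less_imp_le less_le_trans)
    qed
    ultimately show ?thesis by (auto simp: eventually_at_filter elim!: eventually_mono)
  next
    case False
    then have t: "snd \<xi> < 0" using cl by simp
    \<comment> \<open>At x = 0 the bound on -t would be \<open>0 powr l = 0\<close>, contradicting t
      < 0.\<close>
    then have x: "fst \<xi> \<noteq> 0" using cl(2) by auto
    have "isCont (barrier c a b e) \<xi>"
      unfolding barrier_def[abs_def] using t x by (intro continuous_intros) auto
    then have "((\<lambda>z. ereal (barrier c a b e z)) \<longlongrightarrow> ereal (barrier c a b e \<xi>)) (at \<xi> within ?D)"
      by (auto simp: isCont_def intro: tendsto_within_subset)
    moreover have "?f \<xi> \<le> barrier c a b e \<xi>"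
    proof (cases "norm (fst \<xi>) = 1")
      case True
      moreover have "0 \<le> barrier c a b e \<xi>"
        unfolding barrier_def using c e t by (intro add_nonneg_nonneg mult_nonneg_nonneg divide_nonneg_pos) auto
      ultimately show ?thesis by simp
    next
      case False
      then have "norm (fst \<xi>) < 1" using cl(3) by simp
      then have "norm (fst \<xi>) powr l < 1" using l x powr_less_mono2[of l "norm (fst \<xi>)" 1] by simp
      \<comment> \<open>The other two defining inequalities hold at \<xi>, so this is the one that
        fails strictly.\<close>
      then have "\<theta> * norm (fst \<xi>) powr l \<le> - snd \<xi>"
        using \<xi>(2) t \<theta> by (auto simp: power_domain_iff not_less)
      then have "(\<theta> * norm (fst \<xi>) powr l) powr a \<le> (- snd \<xi>) powr a" using a \<theta> by (intro powr_mono2) auto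
      then have "c * (\<theta> * norm (fst \<xi>) powr l) powr a * norm (fst \<xi>) powr (- b) \<le> c * (- snd \<xi>) powr a * norm (fst \<xi>) powr (- b)"
        using c by (intro mult_right_mono mult_left_mono) auto
      moreover have "c * (\<theta> * norm (fst \<xi>) powr l) powr a * norm (fst \<xi>) powr (- b) = m"
        unfolding m_def using x by (intro barrier_on_paraboloid \<theta> b) simp
      moreover have "0 \<le> e / (- snd \<xi>)" using e t by (intro divide_nonneg_pos) auto
      moreover have "?f \<xi> \<le> m" using m by simp
      ultimately show ?thesis unfolding barrier_def by linarith
    qed
    then have "y < ereal (barrier c a b e \<xi>)" using y by (meson ereal_less_eq(3) less_le_trans)
    ultimately show ?thesis by (rule order_tendstoD)
  qed
  then show "ereal (?f \<xi>) \<le> Liminf (at \<xi> within ?D) (\<lambda>z. ereal (barrier c a b e z))"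
    by (simp add: le_Liminf_iff)
qed

theorem proposition1p4:
  fixes p l :: real
  assumes "1 < p" "p < 2" "2 \<le> CARD('n::finite)" "0 < l"
    and "p < 2 * real CARD('n) / (real CARD('n) + 1) \<Longrightarrow> l \<le> p"
    and "p \<ge> 2 * real CARD('n) / (real CARD('n) + 1) \<Longrightarrow> l < (real CARD('n) - p) * (2 - p) / (p - 1)"
  shows "\<forall>\<theta>>0. irregular_point p (power_domain l \<theta> :: ((real^'n) \<times> real) set) (0, 0)"
proof (intro allI impI)
  fix \<theta> :: real assume \<theta>: "0 < \<theta>"
  note p = assms(1,2) and l = assms(4)
  let ?n = "real CARD('n)"
  let ?D = "power_domain l \<theta> :: ((real^'n) \<times> real) set"
  \<comment> \<open>The gap between the two bounds on \<open>l\<close>, multiplied by p - 1, is 2n -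
    p(n+1); its sign decides which bound implies the other.\<close>
  have identity: "(?n - p) * (2 - p) = p * (p - 1) + (2 * ?n - p * (?n + 1))" by (simp add: algebra_simps)
  have l_bound: "l \<le> p \<and> l * (p - 1) < (?n - p) * (2 - p)"
  proof (cases "p < 2 * ?n / (?n + 1)")
    case True
    then have "p * (?n + 1) < 2 * ?n" by (simp add: pos_less_divide_eq)
    moreover have "l * (p - 1) \<le> p * (p - 1)" using assms(5)[OF True] p by (intro mult_right_mono) auto
    ultimately show ?thesis using assms(5)[OF True] identity by linarith
  next
    case False
    then have "2 * ?n \<le> p * (?n + 1)" by (simp add: pos_divide_le_eq not_less)
    moreover have less: "l * (p - 1) < (?n - p) * (2 - p)" using assms(6) False p by (simp add: pos_less_divide_eq)
    ultimately have "l * (p - 1) < p * (p - 1)" using identity by linarith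
    then have "l < p" using p by simp
    then show ?thesis using less by simp
  qed
  define a where "a = 1 / (2 - p)"
  define b where "b = l * a"
  define \<gamma> where "\<gamma> = ?n - ((b + 1) * (p - 1) + 1)"
  \<comment> \<open>The solution of c a = (b c)^(p-1) \<gamma>: equivalently c^(2-p) = b^(p-1)
    \<gamma> / a, and \<open>a\<close> is the reciprocal of 2 - p.\<close>
  define c where "c = (b powr (p - 1) * \<gamma> / a) powr a"
  define m where "m = c * \<theta> powr a"
  have a: "0 < a" "a * (2 - p) = 1" using p by (auto simp: a_def)
  have b: "0 < b" "b * (2 - p) = l" using l a by (auto simp: b_def)
  have \<gamma>: "0 < \<gamma>"
  proof -
    have "(b * (p - 1)) * (2 - p) = (b * (2 - p)) * (p - 1)" by (simp only: mult_ac)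
    then have "(b * (p - 1)) * (2 - p) < (?n - p) * (2 - p)" using l_bound by (simp only: b(2))
    then have "b * (p - 1) < ?n - p" using p by simp
    then show ?thesis by (simp add: \<gamma>_def algebra_simps)
  qed
  have c: "0 < c" using b \<gamma> a by (simp add: c_def)
  have supersol: "c * a \<le> (b * c) powr (p - 1) * \<gamma>"
  proof -
    have "c powr (2 - p) = b powr (p - 1) * \<gamma> / a"
      using a b \<gamma> by (simp add: c_def powr_powr)
    then have "a * c powr (2 - p) * c powr (p - 1) = (b powr (p - 1) * c powr (p - 1)) * \<gamma>" using a by (simp add: field_simps)
    moreover have "c powr (2 - p) * c powr (p - 1) = c" using c by (simp add: powr_add[symmetric])
    moreover have "b powr (p - 1) * c powr (p - 1) = (b * c) powr (p - 1)" using b c by (simp add: powr_mult)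
    ultimately show ?thesis by (simp add: mult_ac)
  qed
  have upper: "upper_Perron p ?D (\<lambda>z. m * (1 - norm (fst z))) z \<le> ereal (c * (- snd z) powr a * norm (fst z) powr (- b))"
    if z: "z \<in> ?D" for z
  proof (rule ereal_le_epsilon2)
    fix \<epsilon> :: real assume "0 < \<epsilon>"
    \<comment> \<open>The correction may depend on the point \<open>z\<close> at which the infimum
      is estimated; this choice makes it equal to \<epsilon> there.\<close>
    define e where "e = \<epsilon> * (- snd z)"
    have "0 < - snd z" using z by (simp add: power_domain_iff)
    then have e: "0 < e" "e / (- snd z) = \<epsilon>"
      using mult_pos_pos[OF \<open>0 < \<epsilon>\<close> \<open>0 < - snd z\<close>] \<open>0 < - snd z\<close> by (simp_all add: e_def)
    have "p_superparabolic p ?D (\<lambda>z. ereal (barrier c a b e z))"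
      using b c e p l_bound supersol
      by (intro barrier_superparabolic power_domain_subset_slab l \<theta> a_def) (auto simp: \<gamma>_def)
    from barrier_upper_class[OF this l \<theta> c a(1) b_def e(1)]
    have "upper_Perron p ?D (\<lambda>z. m * (1 - norm (fst z))) z \<le> ereal (barrier c a b e z)"
      unfolding upper_Perron_def m_def by (rule INF_lower)
    also have "\<dots> = ereal (c * (- snd z) powr a * norm (fst z) powr (- b)) + ereal \<epsilon>"
      by (simp only: barrier_def e(2) plus_ereal.simps)
    finally show "upper_Perron p ?D (\<lambda>z. m * (1 - norm (fst z))) z
      \<le> ereal (c * (- snd z) powr a * norm (fst z) powr (- b)) + ereal \<epsilon>" .
  qed
  \<comment> \<open>Some unit direction is wanted, and index types are nonempty.\<close>
  obtain i :: 'n where True by blast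
  define \<zeta> where "\<zeta> s = (s *\<^sub>R axis i 1 :: real^'n, - (\<theta> / 2 * s powr l))" for s :: real
  have \<zeta>_D: "\<zeta> s \<in> ?D" if "0 < s" "s < 1" for s
  proof -
    have "s powr l < 1" using that l powr_less_mono2[of l s 1] by simp
    then show ?thesis using that \<theta> by (simp add: \<zeta>_def power_domain_iff norm_axis_1)
  qed
  have in_D: "eventually (\<lambda>s. 0 < s \<and> s < 1) (at_right (0::real))"
    using eventually_at_right_real[of 0 1] by (auto elim: eventually_mono)
  have "(\<zeta> \<longlongrightarrow> (0 *\<^sub>R axis i 1, - (\<theta> / 2 * 0))) (at_right 0)"
    unfolding \<zeta>_def[abs_def]
    by (intro tendsto_intros tendsto_zero_powrI[of _ _ _ l]) (auto simp: l eventually_at_filter)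
  then have \<zeta>_lim: "(\<zeta> \<longlongrightarrow> (0, 0)) (at_right 0)" by simp
  \<comment> \<open>The filter leaves out the origin, so besides convergence the curve has to stay
    in the domain and avoid (0, 0).\<close>
  then have lim: "filterlim \<zeta> (at (0, 0) within ?D) (at_right 0)"
    unfolding filterlim_at using in_D
    by (auto elim!: eventually_mono intro: \<zeta>_D) (auto simp: \<zeta>_def)
  have "(0, 0) \<in> closure ?D"
  proof (rule Lim_in_closed_set[OF closed_closure _ _ \<zeta>_lim])
    show "eventually (\<lambda>s. \<zeta> s \<in> closure ?D) (at_right 0)"
      using in_D by eventually_elim (use \<zeta>_D closure_subset in blast)
  qed simp
  moreover have "(0, 0) \<notin> ?D" by (simp add: power_domain_iff)
  ultimately have frontier: "(0, 0) \<in> frontier ?D"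
    using interior_subset by (auto simp: frontier_def)
  show "irregular_point p ?D (0, 0)"
    unfolding irregular_point_def
  proof (intro conjI notI frontier)
    assume "regular_point p ?D (0, 0)"
    moreover have "continuous_on (frontier ?D) (\<lambda>z. m * (1 - norm (fst z)))" by (intro continuous_intros)
    ultimately have "(upper_Perron p ?D (\<lambda>z. m * (1 - norm (fst z))) \<longlongrightarrow> ereal (m * (1 - norm (fst (0 :: real^'n, 0 :: real))))) (at (0, 0) within ?D)"
      unfolding regular_point_def by blast
    from filterlim_compose[OF this lim]
    have "((\<lambda>s. upper_Perron p ?D (\<lambda>z. m * (1 - norm (fst z))) (\<zeta> s)) \<longlongrightarrow> ereal m) (at_right 0)" by simp
    moreover have "eventually (\<lambda>s. upper_Perron p ?D (\<lambda>z. m * (1 - norm (fst z))) (\<zeta> s) \<le> ereal (c * (\<theta> / 2) powr a)) (at_right 0)"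
      using in_D
    proof eventually_elim
      case (elim s)
      have "c * (- snd (\<zeta> s)) powr a * norm (fst (\<zeta> s)) powr (- b) = c * (\<theta> / 2) powr a"
        using barrier_on_paraboloid[of s "\<theta> / 2" b l a c] elim \<theta> by (simp add: \<zeta>_def norm_axis_1 b_def)
      with upper[OF \<zeta>_D] elim show ?case by metis
    qed
    \<comment> \<open>Regularity would make the Perron solution tend to \<open>m\<close> along the
      curve, where it is bounded by the value of the barrier for \<theta>/2.\<close>
    ultimately have "ereal m \<le> ereal (c * (\<theta> / 2) powr a)"
      by (rule tendsto_upperbound) simp
    moreover have "(\<theta> / 2) powr a < \<theta> powr a" using \<theta> a by (intro powr_less_mono2) auto
    ultimately show False using c by (simp add: m_def)
  qed
qed

end
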